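(* There exist an absolute constant $c>0$ and an algorithm, based on rounding $r$ rounds of the Lasserre hierarchy, such that for every $\epsilon>0$ and every Unique Games instance $\mathcal I$ with objective value $v$ and alphabet size $k$ satisfying $\mathrm{rank}_{\ge\tau}(\mathcal I)\le \epsilon^{c} r/k$, where $\tau=\epsilon^{c}$, the algorithm outputs an assignment $x$ with $\mathrm{val}_{\mathcal I}(x)>v-\epsilon$.
   Context: A Unique Games instance $\mathcal I$ on vertex set $V=[n]$ with alphabet $[k]$ is a probability distribution over triples $(i,j,\pi)$ where $i,j\in V$ and $\pi$ is a permutation of $[k]$; for $x\in[k]^n$, $\mathrm{val}_{\mathcal I}(x)=\Pr_{(i,j,\pi)\sim\mathcal I}[x_j=\pi(x_i)]$, and the objective value is $\max_x\mathrm{val}_{\mathcal I}(x)$. The constraint graph (weight of $\{i,j\}$ = total probability of constraints on $i,j$) is assumed regular and is identified with its normalized adjacency matrix (symmetric, nonnegative, row sums $1$); $\mathrm{rank}_{\ge\tau}(\mathcal I)$ is the number of its eigenvalues larger than $\tau$. The $r$-round Lasserre relaxation: consistent local distributions $\mu_T$ on $[k]^T$ for all $T\subseteq V$ with $|T|\le r+2$ (local random variables $X_1,\dots,X_n$), together with vectors $v_{S,\alpha}$ ($|S|\le r+2$, $\alpha\in[k]^S$) with $\langle v_{S,\alpha},v_{T,\beta}\rangle=\Pr[X_S=\alpha,X_T=\beta]$ whenever $|S\cup T|\le r+2$; objective $\mathbb E_{(i,j,\pi)\sim\mathcal I}\Pr[X_j=\pi(X_i)]$. *)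

theory Defs
  imports
    "HOL-Probability.Probability_Mass_Function"
    "HOL-Combinatorics.Permutations"
    "Jordan_Normal_Form.Char_Poly"
begin

text \<open>Vertices are \<open>{..<n}\<close> and labels are \<open>{..<k}\<close>. The permutations of \<open>{..<k}\<close> are functions
  on \<open>nat\<close> that fix everything outside \<open>{..<k}\<close>, so there are finitely many possible constraints
  and every instance has finite support.\<close>

type_synonym ug_constraint = "nat \<times> nat \<times> (nat \<Rightarrow> nat)"

definition ug_instance :: "nat \<Rightarrow> nat \<Rightarrow> ug_constraint pmf \<Rightarrow> bool" where
  "ug_instance n k I \<longleftrightarrow> 0 < k \<and> set_pmf I \<subseteq> {..<n} \<times> {..<n} \<times> {p. p permutes {..<k}}"

definition assignments :: "nat set \<Rightarrow> nat \<Rightarrow> (nat \<Rightarrow> nat) set" where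
  "assignments T k = T \<rightarrow>\<^sub>E {..<k}"

definition ug_val :: "ug_constraint pmf \<Rightarrow> (nat \<Rightarrow> nat) \<Rightarrow> real" where
  "ug_val I x = measure_pmf.prob I {(i, j, p). x j = p (x i)}"

definition ug_opt :: "nat \<Rightarrow> nat \<Rightarrow> ug_constraint pmf \<Rightarrow> real" where
  "ug_opt n k I = Max (ug_val I ` assignments {..<n} k)"

text \<open>Constraints on \<open>(i, j)\<close> and on \<open>(j, i)\<close> contribute to the same unordered edge. Constraints
  with \<open>i = j\<close> are allowed; such a loop enters the weight matrix, and hence the degree, once.\<close>

definition edge_weight :: "ug_constraint pmf \<Rightarrow> nat \<Rightarrow> nat \<Rightarrow> real" where
  "edge_weight I i j = measure_pmf.prob I {(a, b, p). {a, b} = {i, j}}"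

definition weighted_degree :: "nat \<Rightarrow> ug_constraint pmf \<Rightarrow> nat \<Rightarrow> real" where
  "weighted_degree n I i = (\<Sum>j<n. edge_weight I i j)"

definition regular_instance :: "nat \<Rightarrow> ug_constraint pmf \<Rightarrow> bool" where
  "regular_instance n I \<longleftrightarrow> (\<forall>i<n. \<forall>j<n. weighted_degree n I i = weighted_degree n I j)"

definition normalized_adjacency :: "nat \<Rightarrow> ug_constraint pmf \<Rightarrow> real mat" where
  "normalized_adjacency n I = mat n n (\<lambda>(i, j). edge_weight I i j / weighted_degree n I i)"

text \<open>Eigenvalues are counted with multiplicity. The matrix of a regular instance is real
  symmetric, so all roots of its characteristic polynomial are real.\<close>

definition threshold_rank :: "nat \<Rightarrow> ug_constraint pmf \<Rightarrow> real \<Rightarrow> nat" where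
  "threshold_rank n I \<tau> = size {# x \<in># proots (char_poly (normalized_adjacency n I)). \<tau> < x #}"

text \<open>\<open>local_dist \<sigma> T\<close> is the joint distribution of the local random variables indexed by \<open>T\<close>, and
  \<open>lvec \<sigma> S \<alpha>\<close> is given by its first \<open>ldim \<sigma>\<close> coordinates. Values at sets of more than \<open>r + 2\<close>
  vertices are irrelevant to the relaxation.\<close>

record lasserre =
  local_dist :: "nat set \<Rightarrow> (nat \<Rightarrow> nat) pmf"
  ldim :: nat
  lvec :: "nat set \<Rightarrow> (nat \<Rightarrow> nat) \<Rightarrow> nat \<Rightarrow> real"

definition lasserre_feasible :: "nat \<Rightarrow> nat \<Rightarrow> nat \<Rightarrow> lasserre \<Rightarrow> bool" where
  "lasserre_feasible n k r \<sigma> \<longleftrightarrow>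
     (\<forall>T \<subseteq> {..<n}. card T \<le> r + 2 \<longrightarrow> set_pmf (local_dist \<sigma> T) \<subseteq> assignments T k) \<and>
     (\<forall>T \<subseteq> {..<n}. \<forall>S \<subseteq> T. card T \<le> r + 2 \<longrightarrow>
        map_pmf (\<lambda>x. restrict x S) (local_dist \<sigma> T) = local_dist \<sigma> S) \<and>
     (\<forall>S \<subseteq> {..<n}. \<forall>T \<subseteq> {..<n}. card (S \<union> T) \<le> r + 2 \<longrightarrow>
        (\<forall>\<alpha> \<in> assignments S k. \<forall>\<beta> \<in> assignments T k.
           (\<Sum>l<ldim \<sigma>. lvec \<sigma> S \<alpha> l * lvec \<sigma> T \<beta> l) =
             measure_pmf.prob (local_dist \<sigma> (S \<union> T)) {x. restrict x S = \<alpha> \<and> restrict x T = \<beta>}))"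

definition lasserre_objective :: "ug_constraint pmf \<Rightarrow> lasserre \<Rightarrow> real" where
  "lasserre_objective I \<sigma> = measure_pmf.expectation I
     (\<lambda>(i, j, p). measure_pmf.prob (local_dist \<sigma> {i, j}) {x. x j = p (x i)})"

definition lasserre_optimal :: "nat \<Rightarrow> nat \<Rightarrow> nat \<Rightarrow> ug_constraint pmf \<Rightarrow> lasserre \<Rightarrow> bool" where
  "lasserre_optimal n k r I \<sigma> \<longleftrightarrow> lasserre_feasible n k r \<sigma> \<and>
     (\<forall>\<sigma>'. lasserre_feasible n k r \<sigma>' \<longrightarrow> lasserre_objective I \<sigma>' \<le> lasserre_objective I \<sigma>)"

text \<open>A rounding algorithm is a program for a real-arithmetic RAM: it has a random-access memory
  of natural numbers, a random-access memory of reals with exact field arithmetic and comparison,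
  and read access to the instance and to the given solution of the relaxation. One program serves
  all inputs. Program constants are integers, so that no information can be hidden in them, and
  natural numbers have only unit-cost addition and truncated subtraction, which keeps unit-cost
  time honest.\<close>

record ug_input =
  in_n :: nat
  in_k :: nat
  in_r :: nat
  in_eps :: real
  in_inst :: "ug_constraint pmf"
  in_list :: "ug_constraint list"
  in_sol :: lasserre

record memory =
  nmem :: "nat \<Rightarrow> nat"
  rmem :: "nat \<Rightarrow> real"

text \<open>\<open>CFst\<close>, \<open>CSnd\<close>, \<open>CPerm\<close> and \<open>CProb\<close> read the two vertices, the image of a label, and the
  probability of the constraint at the given position of \<open>in_list\<close>.

  \<open>LProb q b b'\<close> and \<open>LVec q b b' l\<close> query the solution at the partial assignment given by the
  \<open>q\<close> vertices stored from address \<open>b\<close> and the \<open>q\<close> labels stored from address \<open>b'\<close>, namely its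
  local probability and the \<open>l\<close>-th coordinate of its vector. If a vertex is repeated, its
  first label counts. At most \<open>r + 2\<close> vertices can be queried, so one query never reveals anything
  outside the \<open>r\<close>-round relaxation.\<close>

datatype nexp =
    NLit nat | NMem nexp | NAdd nexp nexp | NSub nexp nexp
  | NumVertices | NumLabels | NumRounds | NumConstraints
  | CFst nexp | CSnd nexp | CPerm nexp nexp
  | SolDim

datatype rexp =
    RLit int | RMem nexp | RAdd rexp rexp | RSub rexp rexp | RMul rexp rexp | RDiv rexp rexp
  | Eps
  | CProb nexp
  | LProb nexp nexp nexp | LVec nexp nexp nexp nexp

datatype bexp = NLess nexp nexp | RLess rexp rexp | BNot bexp | BAnd bexp bexp

datatype prog =
    Skip
  | NSet nexp nexp
  | RSet nexp rexp
  | Seq prog prog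
  | Cond bexp prog prog
  | While bexp prog

primrec neval :: "ug_input \<Rightarrow> memory \<Rightarrow> nexp \<Rightarrow> nat" where
  "neval In s (NLit m) = m"
| "neval In s (NMem e) = nmem s (neval In s e)"
| "neval In s (NAdd e f) = neval In s e + neval In s f"
| "neval In s (NSub e f) = neval In s e - neval In s f"
| "neval In s NumVertices = in_n In"
| "neval In s NumLabels = in_k In"
| "neval In s NumRounds = in_r In"
| "neval In s NumConstraints = length (in_list In)"
| "neval In s (CFst e) = (let c = neval In s e in
     if c < length (in_list In) then fst (in_list In ! c) else 0)"
| "neval In s (CSnd e) = (let c = neval In s e in
     if c < length (in_list In) then fst (snd (in_list In ! c)) else 0)"
| "neval In s (CPerm e f) = (let c = neval In s e in
     if c < length (in_list In) then snd (snd (in_list In ! c)) (neval In s f) else 0)"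
| "neval In s SolDim = ldim (in_sol In)"

definition query_set :: "memory \<Rightarrow> nat \<Rightarrow> nat \<Rightarrow> nat set" where
  "query_set s q b = set (map (nmem s) [b..<b + q])"

definition query_labels :: "memory \<Rightarrow> nat \<Rightarrow> nat \<Rightarrow> nat \<Rightarrow> nat \<Rightarrow> nat" where
  "query_labels s q b b' =
     restrict (\<lambda>i. the (map_of (zip (map (nmem s) [b..<b + q]) (map (nmem s) [b'..<b' + q])) i))
       (query_set s q b)"

definition legal_query :: "ug_input \<Rightarrow> memory \<Rightarrow> nat \<Rightarrow> nat \<Rightarrow> nat \<Rightarrow> bool" where
  "legal_query In s q b b' \<longleftrightarrow> q \<le> in_r In + 2 \<and> query_set s q b \<subseteq> {..<in_n In} \<and>
     query_labels s q b b' \<in> assignments (query_set s q b) (in_k In)"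

primrec reval :: "ug_input \<Rightarrow> memory \<Rightarrow> rexp \<Rightarrow> real" where
  "reval In s (RLit z) = of_int z"
| "reval In s (RMem e) = rmem s (neval In s e)"
| "reval In s (RAdd e f) = reval In s e + reval In s f"
| "reval In s (RSub e f) = reval In s e - reval In s f"
| "reval In s (RMul e f) = reval In s e * reval In s f"
| "reval In s (RDiv e f) = reval In s e / reval In s f"
| "reval In s Eps = in_eps In"
| "reval In s (CProb e) = (let c = neval In s e in
     if c < length (in_list In) then pmf (in_inst In) (in_list In ! c) else 0)"
| "reval In s (LProb e f g) =
     (let q = neval In s e; b = neval In s f; b' = neval In s g in
      if legal_query In s q b b'
      then pmf (local_dist (in_sol In) (query_set s q b)) (query_labels s q b b') else 0)"
| "reval In s (LVec e f g h) =
     (let q = neval In s e; b = neval In s f; b' = neval In s g; l = neval In s h in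
      if legal_query In s q b b' \<and> l < ldim (in_sol In)
      then lvec (in_sol In) (query_set s q b) (query_labels s q b b') l else 0)"

primrec beval :: "ug_input \<Rightarrow> memory \<Rightarrow> bexp \<Rightarrow> bool" where
  "beval In s (NLess e f) \<longleftrightarrow> neval In s e < neval In s f"
| "beval In s (RLess e f) \<longleftrightarrow> reval In s e < reval In s f"
| "beval In s (BNot b) \<longleftrightarrow> \<not> beval In s b"
| "beval In s (BAnd b c) \<longleftrightarrow> beval In s b \<and> beval In s c"

text \<open>\<open>exec In P s t s'\<close>: started in memory \<open>s\<close>, program \<open>P\<close> halts in memory \<open>s'\<close> after \<open>t\<close> steps.\<close>

inductive exec :: "ug_input \<Rightarrow> prog \<Rightarrow> memory \<Rightarrow> nat \<Rightarrow> memory \<Rightarrow> bool" for In where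
  Skip: "exec In Skip s 1 s"
| NSet: "exec In (NSet e f) s 1 (s\<lparr>nmem := (nmem s)(neval In s e := neval In s f)\<rparr>)"
| RSet: "exec In (RSet e f) s 1 (s\<lparr>rmem := (rmem s)(neval In s e := reval In s f)\<rparr>)"
| Seq: "exec In P s t s' \<Longrightarrow> exec In Q s' u s'' \<Longrightarrow> exec In (Seq P Q) s (t + u) s''"
| CondTrue: "beval In s b \<Longrightarrow> exec In P s t s' \<Longrightarrow> exec In (Cond b P Q) s (t + 1) s'"
| CondFalse: "\<not> beval In s b \<Longrightarrow> exec In Q s t s' \<Longrightarrow> exec In (Cond b P Q) s (t + 1) s'"
| WhileFalse: "\<not> beval In s b \<Longrightarrow> exec In (While b P) s 1 s"
| WhileTrue: "beval In s b \<Longrightarrow> exec In P s t s' \<Longrightarrow> exec In (While b P) s' u s'' \<Longrightarrow>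
    exec In (While b P) s (t + u + 1) s''"

text \<open>The memory is initially zero, and the output assignment is read off from the first \<open>n\<close>
  cells of the memory of natural numbers.\<close>

definition outputs_within :: "prog \<Rightarrow> ug_input \<Rightarrow> nat \<Rightarrow> (nat \<Rightarrow> nat) \<Rightarrow> bool" where
  "outputs_within P In B x \<longleftrightarrow>
     (\<exists>t s. exec In P \<lparr>nmem = (\<lambda>_. 0), rmem = (\<lambda>_. 0)\<rparr> t s \<and> t \<le> B \<and>
            x = restrict (nmem s) {..<in_n In})"

text \<open>Without a resource bound exhaustive search would be an admissible algorithm. The time allowed
  for rounding is polynomial in the size \<open>(n k)\<^bsup>O(r)\<^esup>\<close> of the \<open>r\<close>-round relaxation and the
  number of constraints.\<close>

definition time_bound :: "nat \<Rightarrow> ug_input \<Rightarrow> nat" where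
  "time_bound C In =
     C * (in_r In + length (in_list In) + (in_n In * in_k In) ^ (in_r In + 2)) ^ C"

end

theory Submission
  imports Defs "Jordan_Normal_Form.Schur_Decomposition" "Jordan_Normal_Form.Spectral_Radius"
begin

text \<open>Condition the local distributions on a set \<open>E\<close> of (vertex, label) pairs and round the vertices independently.
  With conditional marginals \<open>q\<close> and covariances \<open>C\<close>, the matrix
  \<open>M i j = (\<Sum>a b. C i a j b ^ 2 / sqrt (q i a * q j b))\<close> is positive semidefinite with entries in \<open>[0, 1]\<close>, and the loss
  on a constraint between \<open>i\<close> and \<open>j\<close> is at most \<open>sqrt (M i j)\<close>, whatever its permutation. If there are \<open>m\<close>
  eigenvalues above \<open>\<tau>\<close>, the spectral theorem bounds the average of \<open>M\<close> over the edges by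
  \<open>\<tau> + (1 - \<tau>) * sqrt (m * \<delta>)\<close> with \<open>\<delta>\<close> the average of \<open>M\<close> over all pairs. So a large rounding loss
  forces \<open>\<delta>\<close> to be at least of order \<open>\<epsilon> ^ 6 / m\<close>, and then conditioning on one more vertex increases
  the objective plus a small multiple of the average collision probability \<open>(\<Sum>a. q i a ^ 2)\<close> by a fixed
  amount for some choice of its label. As this potential is bounded, some set of at most \<open>r\<close> pairs
  has a small rounding loss.

  The program tries all lists of \<open>r\<close> pairs, derandomizes the independent rounding by conditional
  expectations, and keeps the best assignment.\<close>

text \<open>The denominator \<open>sqrt (q i a * q j b)\<close> meets three demands at once. It
  factors over the two endpoints, so positive semidefiniteness survives. It keeps the diagonal of
  \<open>M\<close> at most 1 for every alphabet size, where dividing by \<open>q i a * q j b\<close>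
  would give k - 1 for full support. And it is the geometric mean of the two normalizations under
  which the squared covariance is the variance explained by conditioning on one endpoint, so the
  AM-GM inequality leads from \<open>M\<close> to the gain of a conditioning step. Conditioning
  preserves the objective only on average over the label, and the collision probability also grows
  only on average. A single label has to serve both, hence one weighted potential. Its weight
  \<open>w = \<epsilon> * (1 - \<epsilon>) / 4\<close> limits the loss of objective, and the factor
  1 - \<epsilon> matches the room left above an objective of at least \<epsilon>, so that the number
  of steps stays of order m / \<epsilon>^7 even when \<epsilon> approaches 1. That regime dictates
  the constants: the theorem offers only an exponent, and no multiplicative constant, to absorb
  losses.\<close>

no_notation Finite_Cartesian_Product.vec_nth (infixl "$" 90)
no_notation inner (infix "\<bullet>" 70)

section \<open>Spectral theorem for real symmetric matrices\<close>

text \<open>Over the complex numbers an eigenvalue z exists. For its eigenvector v the form v* A v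
  equals both z |v|^2 and its own conjugate, so z is real and is a root of the real characteristic
  polynomial.\<close>

lemma real_symmetric_eigenvalue:
  fixes A :: "real mat"
  assumes A: "A \<in> carrier_mat n n" and sym: "A\<^sup>T = A" and n: "0 < n"
  obtains e where "eigenvalue A e"
proof -
  let ?B = "map_mat complex_of_real A"
  have B: "?B \<in> carrier_mat n n" using A by simp
  obtain z where ez: "eigenvalue ?B z"
    using spectrum_non_empty[OF B n] unfolding spectrum_def by auto
  then obtain v where v: "v \<in> carrier_vec n" "v \<noteq> 0\<^sub>v n" "?B *\<^sub>v v = z \<cdot>\<^sub>v v"
    unfolding eigenvalue_def eigenvector_def using B by auto
  have symij: "A $$ (i, j) = A $$ (j, i)" if "i < n" "j < n" for i j
    using arg_cong[OF sym, of "\<lambda>M. M $$ (i, j)"] A that by simp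
  define Q where "Q = (\<Sum>i<n. \<Sum>j<n. cnj (v $ i) * complex_of_real (A $$ (i, j)) * v $ j)"
  define N where "N = (\<Sum>i<n. cnj (v $ i) * v $ i)"
  have row: "(\<Sum>j<n. complex_of_real (A $$ (i, j)) * v $ j) = z * v $ i" if "i < n" for i
    using arg_cong[OF v(3), of "\<lambda>x. x $ i"] that A v(1)
    by (simp add: scalar_prod_def lessThan_atLeast0)
  have "Q = (\<Sum>i<n. cnj (v $ i) * (\<Sum>j<n. complex_of_real (A $$ (i, j)) * v $ j))"
    unfolding Q_def by (simp add: sum_distrib_left mult.assoc)
  also have "\<dots> = z * N"
    unfolding N_def sum_distrib_left[of z] by (intro sum.cong refl) (simp add: row)
  finally have QN: "Q = z * N" .
  have "cnj Q = (\<Sum>i<n. \<Sum>j<n. v $ i * complex_of_real (A $$ (i, j)) * cnj (v $ j))"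
    unfolding Q_def by (simp add: cnj_sum)
  also have "\<dots> = (\<Sum>j<n. \<Sum>i<n. v $ i * complex_of_real (A $$ (i, j)) * cnj (v $ j))"
    by (rule sum.swap)
  also have "\<dots> = Q"
    unfolding Q_def by (intro sum.cong refl) (simp add: symij mult_ac)
  finally have Qr: "cnj Q = Q" .
  have N': "N = complex_of_real (\<Sum>i<n. (cmod (v $ i))\<^sup>2)"
    unfolding N_def of_real_sum by (intro sum.cong refl) (metis complex_norm_square mult.commute)
  obtain i where i: "i < n" "v $ i \<noteq> 0"
    using v(1,2) by (metis carrier_vecD eq_vecI index_zero_vec)
  have "0 < (\<Sum>i<n. (cmod (v $ i))\<^sup>2)"
    by (rule sum_pos2[of _ i]) (use i in auto)
  hence N0: "N \<noteq> 0" "cnj N = N" unfolding N' by (simp_all del: of_real_sum)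
  have "cnj z = z" using Qr N0 by (auto simp: QN)
  then obtain e where e: "z = complex_of_real e"
    by (metis Reals_cnj_iff Reals_cases)
  have "poly (char_poly ?B) z = 0" using ez eigenvalue_root_char_poly[OF B] by simp
  hence "poly (char_poly A) e = 0"
    unfolding of_real_hom.char_poly_hom[OF A] e by simp
  hence "eigenvalue A e" using eigenvalue_root_char_poly[OF A] by simp
  thus ?thesis by (rule that)
qed

text \<open>Complete v to a basis, apply Gram-Schmidt and normalize. Gram-Schmidt leaves the head of
  the list unchanged, so the first column stays parallel to v.\<close>

lemma orthonormal_completion:
  fixes v :: "real vec"
  assumes v: "v \<in> carrier_vec n" and v0: "v \<noteq> 0\<^sub>v n"
  obtains W c where "W \<in> carrier_mat n n" "W\<^sup>T * W = 1\<^sub>m n" "col W 0 = c \<cdot>\<^sub>v v"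
proof -
  interpret cof_vec_space n "TYPE(real)" .
  define b where "b = basis_completion v"
  define ws where "ws = gram_schmidt n b"
  note bc = basis_completion[OF v v0, folded b_def]
  have n: "0 < n" using v v0 by (metis carrier_vecD eq_vecI gr0I index_zero_vec(2) less_nat_zero_code)
  from gram_schmidt_result[OF bc(2) bc(4) bc(5) refl, folded ws_def]
  have ws: "set ws \<subseteq> carrier_vec n" "corthogonal ws" "length ws = n"
    using bc(6) by auto
  obtain vs where bv: "b = v # vs" using bc(6,7) n by (cases b) auto
  have hd: "hd ws = v" using gram_schmidt_hd[OF v, of vs] unfolding ws_def bv .
  have cv: "ws ! i \<in> carrier_vec n" if "i < n" for i using ws that by auto
  define d where "d i = sqrt (ws ! i \<bullet> ws ! i)" for i
  define us where "us = map (\<lambda>i. inverse (d i) \<cdot>\<^sub>v ws ! i) [0..<n]"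
  have orth: "(ws ! i \<bullet> ws ! j = 0) = (i \<noteq> j)" if "i < n" "j < n" for i j
    using corthogonalD[OF ws(2)] ws(3) that by simp
  have pos: "0 < ws ! i \<bullet> ws ! i" if "i < n" for i
  proof -
    have "0 \<le> ws ! i \<bullet> ws ! i" by (simp add: scalar_prod_def sum_nonneg)
    moreover have "ws ! i \<bullet> ws ! i \<noteq> 0" using orth[OF that that] by simp
    ultimately show ?thesis by simp
  qed
  have us: "us ! i = inverse (d i) \<cdot>\<^sub>v ws ! i" "us ! i \<in> carrier_vec n" if "i < n" for i
    using that cv by (auto simp: us_def)
  have ip: "us ! i \<bullet> us ! j = (if i = j then 1 else 0)" if ij: "i < n" "j < n" for i j
  proof -
    have "us ! i \<bullet> us ! j = inverse (d i) * inverse (d j) * (ws ! i \<bullet> ws ! j)"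
      using cv[OF ij(1)] cv[OF ij(2)] ij
      by (simp add: us smult_scalar_prod_distrib[of _ n] scalar_prod_smult_distrib[of _ n])
    also have "\<dots> = (if i = j then 1 else 0)"
    proof (cases "i = j")
      case True
      have "d i * d i = ws ! i \<bullet> ws ! i" "d i \<noteq> 0" using pos[OF ij(1)] by (auto simp: d_def)
      then show ?thesis using True pos[OF ij(1)] by (simp add: field_simps)
    next
      case False
      then show ?thesis using orth[OF ij] by simp
    qed
    finally show ?thesis .
  qed
  define W where "W = mat_of_cols n us"
  have len: "length us = n" by (simp add: us_def)
  have W: "W \<in> carrier_mat n n" unfolding W_def using len by auto
  have colW: "col W i = us ! i" if "i < n" for i
    unfolding W_def using len that us by (simp add: col_mat_of_cols)
  have "W\<^sup>T * W = 1\<^sub>m n"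
    by (rule eq_matI) (use W in \<open>auto simp: colW ip\<close>)
  moreover have "col W 0 = inverse (d 0) \<cdot>\<^sub>v v"
    using colW[OF n] us(1)[OF n] hd ws(3) n by (cases ws) auto
  ultimately show ?thesis using W that by blast
qed

text \<open>Deflation: in an orthonormal basis that starts with an eigenvector the first column of
  the matrix is a multiple of the first unit vector, and by symmetry so is the first row. The
  induction hypothesis diagonalizes the remaining block.\<close>

theorem real_symmetric_diagonalization:
  fixes A :: "real mat"
  assumes "A \<in> carrier_mat n n" "A\<^sup>T = A"
  shows "\<exists>P D. P \<in> carrier_mat n n \<and> D \<in> carrier_mat n n \<and> P\<^sup>T * P =
      1\<^sub>m n \<and>
    diagonal_mat D \<and> A = P * D * P\<^sup>T"
  using assms
proof (induction n arbitrary: A)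
  case 0
  then show ?case
    by (intro exI[of _ "1\<^sub>m 0"] exI[of _ A]) (auto simp: diagonal_mat_def intro!: eq_matI)
next
  case (Suc n A)
  let ?N = "Suc n"
  note A = Suc.prems(1) and sym = Suc.prems(2)
  obtain e where "eigenvalue A e" using real_symmetric_eigenvalue[OF A sym] by auto
  then obtain v where v: "v \<in> carrier_vec ?N" "v \<noteq> 0\<^sub>v ?N" "A *\<^sub>v v =
      e \<cdot>\<^sub>v v"
    unfolding eigenvalue_def eigenvector_def using A by auto
  obtain W c where W: "W \<in> carrier_mat ?N ?N" and WW: "W\<^sup>T * W = 1\<^sub>m ?N"
    and W0: "col W 0 = c \<cdot>\<^sub>v v" using orthonormal_completion[OF v(1,2)] by blast
  have Wt: "W\<^sup>T \<in> carrier_mat ?N ?N" using W by simp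
  have WW': "W * W\<^sup>T = 1\<^sub>m ?N" using mat_mult_left_right_inverse[OF Wt W WW] .
  define B where "B = W\<^sup>T * A * W"
  have B: "B \<in> carrier_mat ?N ?N" unfolding B_def using W A by simp
  have Bsym: "B\<^sup>T = B"
    unfolding B_def using W A sym
    by (simp add: transpose_mult[of _ ?N ?N _ ?N] assoc_mult_mat[of _ ?N ?N _ ?N _ ?N])
  have colB: "col B 0 = e \<cdot>\<^sub>v unit_vec ?N 0"
  proof -
    have "col B 0 = col (W\<^sup>T * (A * W)) 0"
      unfolding B_def using W A Wt by (simp add: assoc_mult_mat[of _ ?N ?N _ ?N _ ?N])
    also have "\<dots> = W\<^sup>T *\<^sub>v col (A * W) 0" by (rule col_mult2[of _ ?N ?N _ ?N]) (use Wt A W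
        in auto)
    also have "col (A * W) 0 = A *\<^sub>v col W 0" by (rule col_mult2[of _ ?N ?N _ ?N]) (use A W in auto)
    also have "A *\<^sub>v col W 0 = e \<cdot>\<^sub>v col W 0"
      unfolding W0 using v A by (simp add: mult_mat_vec[of _ ?N ?N] smult_smult_assoc mult.commute)
    also have "W\<^sup>T *\<^sub>v (e \<cdot>\<^sub>v col W 0) =
        e \<cdot>\<^sub>v (W\<^sup>T *\<^sub>v col W 0)"
      by (rule mult_mat_vec[of _ ?N ?N]) (use W Wt col_dim[of W 0] in auto)
    also have "W\<^sup>T *\<^sub>v col W 0 = col (W\<^sup>T * W) 0"
      by (rule col_mult2[of _ ?N ?N _ ?N, symmetric]) (use W Wt in auto)
    finally show ?thesis by (simp add: WW)
  qed
  define C where "C = mat n n (\<lambda>(i, j). B $$ (Suc i, Suc j))"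
  have C: "C \<in> carrier_mat n n" by (simp add: C_def)
  have Bij: "B $$ (i, j) = B $$ (j, i)" if "i < ?N" "j < ?N" for i j
    using arg_cong[OF Bsym, of "\<lambda>M. M $$ (i, j)"] B that by simp
  have B0: "B $$ (i, 0) = (if i = 0 then e else 0)" if "i < ?N" for i
    using arg_cong[OF colB, of "\<lambda>x. x $ i"] B that by simp
  have Csym: "C\<^sup>T = C" by (rule eq_matI) (auto simp: C_def Bij)
  obtain P D where P: "P \<in> carrier_mat n n" and D: "D \<in> carrier_mat n n"
    and PP: "P\<^sup>T * P = 1\<^sub>m n" and dD: "diagonal_mat D" and CP: "C = P * D * P\<^sup>T"
    using Suc.IH[OF C Csym] by blast
  let ?E = "mat 1 1 (\<lambda>_. e)"
  let ?Z = "\<lambda>X Y. four_block_mat X (0\<^sub>m 1 n) (0\<^sub>m n 1) Y"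
  have BZ: "B = ?Z ?E C"
  proof (rule eq_matI)
    fix i j assume "i < dim_row (?Z ?E C)" "j < dim_col (?Z ?E C)"
    then have ij: "i < ?N" "j < ?N" by (simp_all add: C_def)
    show "B $$ (i, j) = ?Z ?E C $$ (i, j)"
      using ij B0[OF ij(1)] B0[OF ij(2)] Bij[OF ij] by (auto simp: C_def)
  qed (use B in \<open>auto simp: C_def\<close>)
  define P' where "P' = ?Z (1\<^sub>m 1) P"
  define D' where "D' = ?Z ?E D"
  have P': "P' \<in> carrier_mat ?N ?N"
    unfolding P'_def using four_block_carrier_mat[OF one_carrier_mat[of 1] P] by simp
  have D': "D' \<in> carrier_mat ?N ?N"
    unfolding D'_def using four_block_carrier_mat[of ?E 1 1 D n n] D by simp
  have P't: "P'\<^sup>T = ?Z (1\<^sub>m 1) P\<^sup>T"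
    unfolding P'_def using P by (subst transpose_four_block_mat[of _ 1 1 _ n _ n]) auto
  have P'P': "P'\<^sup>T * P' = 1\<^sub>m ?N"
    unfolding P't unfolding P'_def
    by (subst mult_four_block_mat[of _ 1 1 _ n _ n _ _ 1 _ n]) (use P PP in auto)
  have BD: "B = P' * D' * P'\<^sup>T"
  proof -
    have "P' * D' = ?Z ?E (P * D)"
      unfolding P'_def D'_def
      by (subst mult_four_block_mat[of _ 1 1 _ n _ n _ _ 1 _ n]) (use P D in auto)
    moreover have "?Z ?E (P * D) * ?Z (1\<^sub>m 1) P\<^sup>T = ?Z ?E (P * D * P\<^sup>T)"
      by (subst mult_four_block_mat[of _ 1 1 _ n _ n _ _ 1 _ n]) (use P D in auto)
    ultimately show ?thesis unfolding BZ P't CP by simp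
  qed
  have dD': "diagonal_mat D'"
    unfolding D'_def diagonal_mat_def using dD D
    by (auto simp: diagonal_mat_def)
  have R: "W * P' \<in> carrier_mat ?N ?N" using W P' by simp
  have P't_c: "P'\<^sup>T \<in> carrier_mat ?N ?N" using P' by simp
  note as = assoc_mult_mat[of _ ?N ?N _ ?N _ ?N]
  have Rt: "(W * P')\<^sup>T = P'\<^sup>T * W\<^sup>T" using W P' by (simp add: transpose_mult[of _ ?N ?N _ ?N])
  have "(W * P')\<^sup>T * (W * P') = P'\<^sup>T * ((W\<^sup>T * W) * P')"
    unfolding Rt using W Wt P' P't_c by (simp add: as)
  also have "\<dots> = 1\<^sub>m ?N" using P' P'P' by (simp add: WW)
  finally have RR: "(W * P')\<^sup>T * (W * P') = 1\<^sub>m ?N" .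
  have "A = (W * W\<^sup>T) * A * (W * W\<^sup>T)" using A by (simp add: WW')
  also have "\<dots> = W * B * W\<^sup>T" unfolding B_def using W Wt A by (simp add: as)
  also have "\<dots> = (W * P') * D' * (W * P')\<^sup>T"
    unfolding BD Rt using W Wt P' P't_c D' by (simp add: as)
  finally show ?case using R D' RR dD' by blast
qed

lemma proots_linear_factors:
  fixes es :: "real list"
  shows "proots (\<Prod>a\<leftarrow>es. [:- a, 1:]) = mset es"
proof (induction es)
  case (Cons a es)
  have "(\<Prod>a\<leftarrow>es. [:- a, 1:]) \<noteq> 0" by (auto simp: prod_list_zero_iff)
  then show ?case using Cons by (simp add: proots_mult del: mult_pCons_left)
qed simp

text \<open>Coordinate form of the diagonalization. The last property identifies the eigenvalue list
  with the root multiset in which the threshold rank is counted.\<close>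

corollary real_symmetric_spectral:
  fixes A :: "real mat"
  assumes A: "A \<in> carrier_mat n n" and sym: "A\<^sup>T = A"
  obtains e :: "nat \<Rightarrow> nat \<Rightarrow> real" and l :: "nat \<Rightarrow> real"
  where "\<And>i j. i < n \<Longrightarrow> j < n \<Longrightarrow> A $$ (i, j) =
      (\<Sum>s<n. l s * e s i * e s j)"
    and "\<And>s t. s < n \<Longrightarrow> t < n \<Longrightarrow> (\<Sum>i<n. e s i * e t i) = (if s =
        t then 1 else 0)"
    and "\<And>i j. i < n \<Longrightarrow> j < n \<Longrightarrow> (\<Sum>s<n. e s i * e s j) = (if i =
        j then 1 else 0)"
    and "proots (char_poly A) = mset (map l [0..<n])"
proof -
  obtain P D where P: "P \<in> carrier_mat n n" and D: "D \<in> carrier_mat n n"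
    and PP: "P\<^sup>T * P = 1\<^sub>m n" and dD: "diagonal_mat D" and AP: "A = P * D * P\<^sup>T"
    using real_symmetric_diagonalization[OF A sym] by blast
  have Pt: "P\<^sup>T \<in> carrier_mat n n" using P by simp
  have PP': "P * P\<^sup>T = 1\<^sub>m n" using mat_mult_left_right_inverse[OF Pt P PP] .
  define e where "e s i = P $$ (i, s)" for s i
  define l where "l s = D $$ (s, s)" for s
  have PD: "(P * D) $$ (i, s) = l s * e s i" if "i < n" "s < n" for i s
  proof -
    have "(P * D) $$ (i, s) = (\<Sum>t<n. P $$ (i, t) * D $$ (t, s))"
      using P D that by (simp add: scalar_prod_def lessThan_atLeast0)
    also have "\<dots> = (\<Sum>t<n. if t = s then P $$ (i, s) * D $$ (s, s) else 0)"
      by (rule sum.cong) (use dD D that in \<open>auto simp: diagonal_mat_def\<close>)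
    also have "\<dots> = l s * e s i" using that by (simp add: l_def e_def)
    finally show ?thesis .
  qed
  have 1: "A $$ (i, j) = (\<Sum>s<n. l s * e s i * e s j)" if "i < n" "j < n" for i j
  proof -
    have "A $$ (i, j) = (\<Sum>s<n. (P * D) $$ (i, s) * P $$ (j, s))"
      unfolding AP using P D that
      by (subst index_mult_mat(1)) (auto simp: scalar_prod_def lessThan_atLeast0)
    also have "\<dots> = (\<Sum>s<n. l s * e s i * e s j)"
      by (rule sum.cong) (use that in \<open>auto simp: PD e_def\<close>)
    finally show ?thesis .
  qed
  have 2: "(\<Sum>i<n. e s i * e t i) = (if s = t then 1 else 0)" if "s < n" "t < n" for s t
    using arg_cong[OF PP, of "\<lambda>M. M $$ (s, t)"] P that
    by (simp add: scalar_prod_def lessThan_atLeast0 e_def)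
  have 3: "(\<Sum>s<n. e s i * e s j) = (if i = j then 1 else 0)" if "i < n" "j < n" for i j
    using arg_cong[OF PP', of "\<lambda>M. M $$ (i, j)"] P that
    by (simp add: scalar_prod_def lessThan_atLeast0 e_def)
  have "similar_mat_wit A D P P\<^sup>T"
    using A D P PP PP' AP by (intro similar_mat_witI[of _ _ n]) auto
  then have "char_poly A = char_poly D" by (intro char_poly_similar) (auto simp: similar_mat_def)
  also have "\<dots> = (\<Prod>a\<leftarrow>diag_mat D. [:- a, 1:])"
    by (rule char_poly_upper_triangular[OF D])
      (use dD D in \<open>auto simp: diagonal_mat_def upper_triangular_def\<close>)
  also have "diag_mat D = map l [0..<n]" using D by (simp add: diag_mat_def l_def)
  finally have 4: "proots (char_poly A) = mset (map l [0..<n])"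
    by (simp only: proots_linear_factors)
  show ?thesis using that[OF 1 2 3 4] .
qed

section \<open>Trace of a product under an eigenvalue threshold\<close>

lemma double_sum_rank_one:
  "(\<Sum>i<n. \<Sum>j<n. f i * f j * (g i * g j)) = ((\<Sum>i<n. f i * g i) ^ 2 :: real)"
  by (simp add: power2_eq_square sum_product mult_ac)

lemma sum_sum_swap_out:
  "(\<Sum>i<n. \<Sum>j<n. \<Sum>s\<in>T. f i j s) = (\<Sum>s\<in>T. \<Sum>i<n. \<Sum>j<n. (f i j s :: real))"
proof -
  have "(\<Sum>i<n. \<Sum>j<n. \<Sum>s\<in>T. f i j s) = (\<Sum>i<n. \<Sum>s\<in>T. \<Sum>j<n. f i j s)"
    by (intro sum.cong refl sum.swap)
  also have "\<dots> = (\<Sum>s\<in>T. \<Sum>i<n. \<Sum>j<n. f i j s)" by (rule sum.swap)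
  finally show ?thesis .
qed

text \<open>In the eigenbasis the left side is the sum of \<open>l s * R s\<close>, where the
  quadratic forms \<open>R s\<close> of \<open>M\<close> are nonnegative and add up to the trace of
  \<open>M\<close>. Replacing \<open>l s\<close> by 1 above the threshold and by \<tau> below it
  leaves the mass of \<open>M\<close> on the top eigenspace, which Cauchy-Schwarz bounds by
  Frobenius norms.\<close>

lemma spectral_trace_bound:
  fixes A :: "real mat" and M :: "nat \<Rightarrow> nat \<Rightarrow> real"
  assumes A: "A \<in> carrier_mat n n" and sym: "A\<^sup>T = A"
    and contr: "\<And>x. (\<Sum>i<n. \<Sum>j<n. x i * x j * A $$ (i, j)) \<le> (\<Sum>i<n. x i ^ 2)"
    and psd: "\<And>x. 0 \<le> (\<Sum>i<n. \<Sum>j<n. x i * x j * M i j)"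
    and \<tau>: "\<tau> < 1"
  defines "m \<equiv> size {# x \<in># proots (char_poly A). \<tau> < x #}"
  shows "(\<Sum>i<n. \<Sum>j<n. A $$ (i, j) * M i j) \<le>
    \<tau> * (\<Sum>i<n. M i i) + (1 - \<tau>) * (sqrt m * sqrt (\<Sum>i<n. \<Sum>j<n. M i j ^ 2))"
proof -
  obtain e l where Ae: "\<And>i j. i < n \<Longrightarrow> j < n \<Longrightarrow> A $$ (i, j) =
      (\<Sum>s<n. l s * e s i * e s j)"
    and orth: "\<And>s t. s < n \<Longrightarrow> t < n \<Longrightarrow> (\<Sum>i<n. e s i * e t i) = (if s =
        t then 1 else 0)"
    and compl: "\<And>i j. i < n \<Longrightarrow> j < n \<Longrightarrow> (\<Sum>s<n. e s i * e s j) = (if i =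
        j then 1 else 0)"
    and pr: "proots (char_poly A) = mset (map l [0..<n])"
    by (rule real_symmetric_spectral[OF A sym]) (rule that)
  define R where "R s = (\<Sum>i<n. \<Sum>j<n. e s i * e s j * M i j)" for s
  define T where "T = {s. s < n \<and> \<tau> < l s}"
  have fT: "finite T" "T \<subseteq> {..<n}" by (auto simp: T_def)
  have R0: "0 \<le> R s" for s unfolding R_def by (rule psd)
  have "m = length (filter (\<lambda>s. \<tau> < l s) [0..<n])"
    unfolding m_def pr mset_filter[symmetric] size_mset filter_map length_map o_def ..
  also have "\<dots> = card (set (filter (\<lambda>s. \<tau> < l s) [0..<n]))"
    by (rule distinct_card[symmetric]) simp
  also have "set (filter (\<lambda>s. \<tau> < l s) [0..<n]) = T" by (auto simp: T_def)
  finally have mT: "m = card T" .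
  \<comment> \<open>The quadratic form of \<open>A\<close> at its own unit eigenvector is the
    eigenvalue, so the contraction property bounds it.\<close>
  have l1: "l s \<le> 1" if s: "s < n" for s
  proof -
    have "(\<Sum>i<n. \<Sum>j<n. e s i * e s j * A $$ (i, j)) =
        (\<Sum>i<n. \<Sum>j<n. \<Sum>t<n. l t * (e s i * e s j * (e t i * e t j)))"
      by (intro sum.cong refl) (simp add: Ae sum_distrib_left mult_ac)
    also have "\<dots> = (\<Sum>t<n. l t * (\<Sum>i<n. \<Sum>j<n. e s i * e s j * (e t i * e t j)))"
      by (subst sum_sum_swap_out) (simp add: sum_distrib_left)
    also have "\<dots> = (\<Sum>t<n. if t = s then l t else 0)"
      unfolding double_sum_rank_one by (intro sum.cong refl) (use orth s in auto)
    also have "\<dots> = l s" using s by simp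
    finally have "l s \<le> (\<Sum>i<n. e s i ^ 2)" using contr[of "e s"] by simp
    then show ?thesis using orth[OF s s] by (simp add: power2_eq_square)
  qed
  have "(\<Sum>i<n. \<Sum>j<n. A $$ (i, j) * M i j) =
      (\<Sum>i<n. \<Sum>j<n. \<Sum>s<n. l s * (e s i * e s j * M i j))"
    by (intro sum.cong refl) (simp add: Ae sum_distrib_left mult_ac)
  also have "\<dots> = (\<Sum>s<n. l s * R s)"
    by (subst sum_sum_swap_out) (simp add: R_def sum_distrib_left)
  also have "\<dots> \<le> (\<Sum>s<n. \<tau> * R s + (1 - \<tau>) * (if s \<in> T then R s else 0))"
  proof (rule sum_mono)
    fix s assume s: "s \<in> {..<n}"
    show "l s * R s \<le> \<tau> * R s + (1 - \<tau>) * (if s \<in> T then R s else 0)"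
    proof (cases "s \<in> T")
      case True
      then show ?thesis using mult_right_mono[OF l1[of s] R0[of s]] s by (simp add: algebra_simps)
    next
      case False
      then show ?thesis using s R0[of s] by (simp add: T_def mult_right_mono)
    qed
  qed
  also have "\<dots> = \<tau> * (\<Sum>s<n. R s) + (1 - \<tau>) * (\<Sum>s\<in>T. R s)"
    using fT by (simp add: sum.distrib sum_distrib_left[symmetric] sum.inter_restrict[symmetric] Int_absorb1)
  also have "(\<Sum>s<n. R s) = (\<Sum>i<n. M i i)"
  proof -
    have "(\<Sum>s<n. R s) = (\<Sum>i<n. \<Sum>j<n. \<Sum>s<n. e s i * e s j * M i j)"
      unfolding R_def by (rule sum_sum_swap_out[symmetric])
    also have "\<dots> = (\<Sum>i<n. \<Sum>j<n. if i = j then M i j else 0)"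
      by (intro sum.cong refl) (simp add: sum_distrib_right[symmetric] compl)
    finally show ?thesis by simp
  qed
  finally have main: "(\<Sum>i<n. \<Sum>j<n. A $$ (i, j) * M i j) \<le>
      \<tau> * (\<Sum>i<n. M i i) + (1 - \<tau>) * (\<Sum>s\<in>T. R s)" .
  have "(\<Sum>s\<in>T. R s) \<le> sqrt m * sqrt (\<Sum>i<n. \<Sum>j<n. M i j ^ 2)"
  proof -
    \<comment> \<open>The orthogonal projection onto the eigenspaces above \<tau>; its squared
      Frobenius norm is its rank \<open>card T\<close>.\<close>
    define P where "P i j = (\<Sum>s\<in>T. e s i * e s j)" for i j
    have sw: "(\<Sum>i<n. \<Sum>j<n. P i j * f i j) =
        (\<Sum>s\<in>T. \<Sum>i<n. \<Sum>j<n. e s i * e s j * f i j)" for f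
      unfolding P_def sum_distrib_right by (rule sum_sum_swap_out)
    have "(\<Sum>i<n. \<Sum>j<n. P i j ^ 2) = (\<Sum>s\<in>T. \<Sum>i<n. \<Sum>j<n. e s i * e s j * P i j)"
      by (simp add: power2_eq_square sw)
    also have "\<dots> = (\<Sum>s\<in>T. \<Sum>t\<in>T. \<Sum>i<n. \<Sum>j<n. e s i * e s j * (e t i * e t j))"
      unfolding P_def sum_distrib_left by (intro sum.cong refl sum_sum_swap_out)
    also have "\<dots> = (\<Sum>s\<in>T. \<Sum>t\<in>T. if s = t then 1 else 0)"
      unfolding double_sum_rank_one by (intro sum.cong refl) (use orth fT
          in \<open>auto simp: subset_iff\<close>)
    also have "\<dots> = card T" using fT by simp
    finally have PP: "(\<Sum>i<n. \<Sum>j<n. P i j ^ 2) = m" using mT by simp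
    have "(\<Sum>s\<in>T. R s) = (\<Sum>(i, j)\<in>{..<n} \<times> {..<n}. P i j * M i j)"
      unfolding R_def sum.cartesian_product[symmetric] by (simp add: sw)
    also have "\<dots> \<le> L2_set (\<lambda>(i, j). P i j) ({..<n} \<times> {..<n}) * L2_set (\<lambda>(i,
        j). M i j) ({..<n} \<times> {..<n})"
      by (rule order_trans[OF _ L2_set_mult_ineq], rule sum_mono)
        (auto simp: abs_mult[symmetric] split: prod.splits)
    also have "\<dots> = sqrt m * sqrt (\<Sum>i<n. \<Sum>j<n. M i j ^ 2)"
      unfolding L2_set_def PP[symmetric] by (simp add: sum.cartesian_product case_prod_beta')
    finally show ?thesis .
  qed
  then have "(1 - \<tau>) * (\<Sum>s\<in>T. R s) \<le>
      (1 - \<tau>) * (sqrt m * sqrt (\<Sum>i<n. \<Sum>j<n. M i j ^ 2))"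
    using \<tau> by (intro mult_left_mono) auto
  with main show ?thesis by linarith
qed

section \<open>Pairwise correlations of local distributions\<close>

lemma weighted_mean_square:
  fixes w x :: "'a \<Rightarrow> real"
  assumes "\<And>i. i \<in> S \<Longrightarrow> 0 \<le> w i" "sum w S = 1"
  shows "(\<Sum>i\<in>S. w i * x i) ^ 2 \<le> (\<Sum>i\<in>S. w i * x i ^ 2)"
proof -
  define m where "m = (\<Sum>i\<in>S. w i * x i)"
  have "0 \<le> (\<Sum>i\<in>S. w i * (x i - m) ^ 2)" using assms(1) by (intro sum_nonneg) auto
  also have "\<dots> = (\<Sum>i\<in>S. w i * x i ^ 2) - 2 * m * (\<Sum>i\<in>S. w i * x i) + m ^ 2 * sum w S"
    by (simp add: sum_distrib_left sum_subtractf[symmetric] sum.distrib[symmetric]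
        power2_eq_square algebra_simps)
  finally show ?thesis using assms(2) by (simp add: m_def power2_eq_square)
qed

text \<open>\<open>q\<close> and \<open>J\<close> stand for the one- and two-vertex marginals after
  conditioning. Positive semidefiniteness of the covariances is recorded by explicit vectors
  \<open>u\<close>, because these can be tensored with themselves.\<close>

locale pair_marginals =
  fixes n k d :: nat
    and q :: "nat \<Rightarrow> nat \<Rightarrow> real"
    and J :: "nat \<Rightarrow> nat \<Rightarrow> nat \<Rightarrow> nat \<Rightarrow> real"
    and u :: "nat \<Rightarrow> nat \<Rightarrow> nat \<Rightarrow> real"
  assumes q_nonneg: "i < n \<Longrightarrow> a < k \<Longrightarrow> 0 \<le> q i a"
    and q_sum: "i < n \<Longrightarrow> (\<Sum>a<k. q i a) = 1"
    and J_nonneg: "i < n \<Longrightarrow> a < k \<Longrightarrow> j < n \<Longrightarrow>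
        b < k \<Longrightarrow> 0 \<le> J i a j b"
    and J_sum: "i < n \<Longrightarrow> a < k \<Longrightarrow> j < n \<Longrightarrow>
        (\<Sum>b<k. J i a j b) = q i a"
    and J_sym: "J i a j b = J j b i a"
    and J_diag: "i < n \<Longrightarrow> a < k \<Longrightarrow> b < k \<Longrightarrow> J i a i b = (if a =
        b then q i a else 0)"
    and gram: "i < n \<Longrightarrow> a < k \<Longrightarrow> j < n \<Longrightarrow> b < k \<Longrightarrow>
      J i a j b - q i a * q j b = (\<Sum>l<d. u i a l * u j b l)"
begin

definition C :: "nat \<Rightarrow> nat \<Rightarrow> nat \<Rightarrow> nat \<Rightarrow> real" where
  "C i a j b = J i a j b - q i a * q j b"

definition M :: "nat \<Rightarrow> nat \<Rightarrow> real" where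
  "M i j = (\<Sum>a<k. \<Sum>b<k. C i a j b ^ 2 / sqrt (q i a * q j b))"

lemma C_sym: "C i a j b = C j b i a"
  by (simp add: C_def J_sym[of i a] mult.commute)

lemma M_sym: "M i j = M j i"
  unfolding M_def by (subst sum.swap) (simp add: C_sym[of i] mult.commute[of "q i _"])

lemma J_le: "i < n \<Longrightarrow> a < k \<Longrightarrow> j < n \<Longrightarrow> b < k \<Longrightarrow>
    J i a j b \<le> q i a"
  unfolding J_sum[of i a j, symmetric]
  by (rule member_le_sum) (auto intro: J_nonneg)

text \<open>\<open>J\<close> is squeezed between 0 and either marginal. This makes the convention x
  / 0 = 0 harmless in every quotient of a covariance by a marginal.\<close>

lemma C_eq_0:
  assumes "i < n" "a < k" "j < n" "b < k" "q i a = 0 \<or> q j b = 0"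
  shows "C i a j b = 0"
proof -
  have "J i a j b \<le> 0"
    using assms J_le[of i a j b] J_le[of j b i a] J_sym[of i a j b] by auto
  with J_nonneg[OF assms(1-4)] assms(5) show ?thesis by (auto simp: C_def)
qed

lemma M_nonneg: "i < n \<Longrightarrow> j < n \<Longrightarrow> 0 \<le> M i j"
  unfolding M_def by (intro sum_nonneg divide_nonneg_nonneg) (auto simp: q_nonneg)

text \<open>The Hadamard square of a Gram matrix is the Gram matrix of the tensor squares.\<close>
lemma M_psd: "0 \<le> (\<Sum>i<n. \<Sum>j<n. x i * x j * M i j)"
proof -
  define s where "s i a = x i / sqrt (q i a)" for i a
  have sq: "x i * x j * (C i a j b ^ 2 / sqrt (q i a * q j b)) =
      (\<Sum>l<d. \<Sum>m<d. (s i a * u i a l * u i a m) * (s j b * u j b l * u j b m))"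
    if "i < n" "j < n" "a < k" "b < k" for i j a b
    using that unfolding C_def gram[OF that(1,3,2,4)]
    by (simp add: power2_eq_square sum_product sum_distrib_left sum_divide_distrib s_def
        real_sqrt_mult mult_ac)
  have "(\<Sum>i<n. \<Sum>j<n. x i * x j * M i j) =
      (\<Sum>i<n. \<Sum>j<n. \<Sum>a<k. \<Sum>b<k. \<Sum>l<d. \<Sum>m<d.
        (s i a * u i a l * u i a m) * (s j b * u j b l * u j b m))"
    unfolding M_def sum_distrib_left by (intro sum.cong refl) (use sq in auto)
  also have "\<dots> = (\<Sum>(i, a)\<in>{..<n} \<times> {..<k}. \<Sum>(j, b)\<in>{..<n} \<times> {..<k}.
      \<Sum>(l, m)\<in>{..<d} \<times> {..<d}.
        (s i a * u i a l * u i a m) * (s j b * u j b l * u j b m))"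
    unfolding sum.cartesian_product[symmetric] by (rule sum.cong[OF refl], rule sum.swap)
  also have "\<dots> = (\<Sum>(l, m)\<in>{..<d} \<times> {..<d}. \<Sum>(i, a)\<in>{..<n} \<times> {..<k}.
      \<Sum>(j, b)\<in>{..<n} \<times> {..<k}.
        (s i a * u i a l * u i a m) * (s j b * u j b l * u j b m))"
    unfolding case_prod_beta' by (rule trans[OF sum.cong[OF refl sum.swap] sum.swap])
  also have "\<dots> = (\<Sum>(l, m)\<in>{..<d} \<times> {..<d}. (\<Sum>(i, a)\<in>{..<n} \<times> {..<k}. s i
      a * u i a l * u i a m) ^ 2)"
    by (intro sum.cong refl) (simp add: power2_eq_square sum_product case_prod_beta')
  also have "\<dots> \<ge> 0" by (intro sum_nonneg) auto
  finally show ?thesis .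
qed

text \<open>On the diagonal the covariance is that of indicators of a single variable, and the
  summands split into a diagonal part and the rank-one part \<open>x a * x b\<close>. Hence
  \<open>M i i\<close> is 1 - 2 s + (sum of q^(3/2))^2 with s the collision probability, and
  Cauchy-Schwarz bounds the last square by s.\<close>

lemma M_diag_le_1:
  assumes i: "i < n"
  shows "M i i \<le> 1"
proof -
  define x where "x a = sqrt (q i a) * q i a" for a
  have "C i a i b ^ 2 / sqrt (q i a * q i b) =
      (if a = b then q i a - 2 * q i a ^ 2 else 0) + x a * x b" if ab: "a < k" "b < k" for a b
  proof (cases "q i a = 0 \<or> q i b = 0")
    case True
    then show ?thesis using C_eq_0[OF i ab(1) i ab(2)] by (auto simp: x_def)
  next
    case False
    then have pos: "0 < q i a" "0 < q i b" using q_nonneg i ab by (auto simp: less_le)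
    define s t where "s = sqrt (q i a)" and "t = sqrt (q i b)"
    have st: "q i a = s ^ 2" "q i b = t ^ 2" "0 < s" "0 < t" using pos by (simp_all add: s_def t_def)
    show ?thesis
    proof (cases "a = b")
      case True
      then show ?thesis using st
        by (simp add: C_def J_diag i ab x_def s_def[symmetric] real_sqrt_mult field_simps power2_eq_square)
    next
      case False
      then show ?thesis using st
        by (simp add: C_def J_diag i ab x_def s_def[symmetric] t_def[symmetric] real_sqrt_mult
            field_simps power2_eq_square)
    qed
  qed
  then have "M i i = (\<Sum>a<k. \<Sum>b<k. (if a = b then q i a - 2 * q i a ^ 2 else 0) + x a * x b)"
    unfolding M_def by (intro sum.cong refl) auto
  also have "\<dots> = (\<Sum>a<k. q i a) - 2 * (\<Sum>a<k. q i a ^ 2) + (\<Sum>a<k. x a) ^ 2"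
    by (simp add: sum.distrib sum_subtractf sum_distrib_left[symmetric] sum_distrib_right[symmetric]
        power2_eq_square)
  also have "(\<Sum>a<k. x a) ^ 2 \<le> (\<Sum>a<k. sqrt (q i a) ^ 2) * (\<Sum>a<k. q i a ^ 2)"
    unfolding x_def by (rule Cauchy_Schwarz_ineq_sum)
  also have "(\<Sum>a<k. sqrt (q i a) ^ 2) = 1" using q_sum[OF i] q_nonneg[OF i] by simp
  finally have "M i i \<le> 1 - (\<Sum>a<k. q i a ^ 2)" using q_sum[OF i] by simp
  moreover have "0 \<le> (\<Sum>a<k. q i a ^ 2)" by (intro sum_nonneg) auto
  ultimately show ?thesis by linarith
qed

text \<open>Testing positive semidefiniteness on the difference of the unit vectors at i and j gives
  \<open>2 * M i j \<le> M i i + M j j\<close>.\<close>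

lemma M_le_1:
  assumes "i < n" "j < n"
  shows "M i j \<le> 1"
proof (cases "i = j")
  case False
  define x where "x s = (if s = i then 1 else if s = j then - 1 else (0::real))" for s
  have in2: "(\<Sum>s<n. x s * f s) = f i - f j" for f
  proof -
    have "(\<Sum>s<n. x s * f s) = (\<Sum>s<n. (if s = i then f i else 0) - (if s = j then f j else 0))"
      by (intro sum.cong) (use False in \<open>auto simp: x_def\<close>)
    then show ?thesis using assms by (simp add: sum_subtractf)
  qed
  have "0 \<le> (\<Sum>s<n. x s * (\<Sum>t<n. x t * M s t))"
    using M_psd[of x] by (simp add: sum_distrib_left mult_ac)
  also have "\<dots> = M i i - M i j - (M j i - M j j)" by (simp add: in2)
  finally show ?thesis using M_diag_le_1[OF assms(1)] M_diag_le_1[OF assms(2)] M_sym[of i j] by linarith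
qed (use assms M_diag_le_1 in simp)

text \<open>The loss is the sum of \<open>C i a j (\<pi> a)\<close> along the graph of \<pi>.
  Cauchy-Schwarz with weights \<open>s a\<close> leaves part of the sum defining
  \<open>M i j\<close>, whichever permutation it is, times the sum of the weights, which is at most
  1 by AM-GM because \<pi> permutes the marginals of j.\<close>

lemma rounding_loss:
  assumes i: "i < n" and j: "j < n" and \<pi>: "\<pi> permutes {..<k}"
  shows "(\<Sum>a<k. J i a j (\<pi> a)) - (\<Sum>a<k. q i a * q j (\<pi> a)) \<le> sqrt (M i j)"
proof -
  have \<pi>k: "\<pi> a < k" if "a < k" for a using permutes_in_image[OF \<pi>, of a] that by simp
  define s where "s a = sqrt (q i a * q j (\<pi> a))" for a
  have s0: "0 \<le> s a" if "a < k" for a using that q_nonneg i j \<pi>k by (simp add: s_def)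
  have "(\<Sum>a<k. J i a j (\<pi> a)) - (\<Sum>a<k. q i a * q j (\<pi> a)) = (\<Sum>a<k. C i a j (\<pi> a))"
    by (simp add: C_def sum_subtractf)
  also have "\<dots> = (\<Sum>a<k. C i a j (\<pi> a) / sqrt (s a) * sqrt (s a))"
    using C_eq_0 i j \<pi>k by (intro sum.cong refl) (auto simp: s_def)
  finally have "((\<Sum>a<k. J i a j (\<pi> a)) - (\<Sum>a<k. q i a * q j (\<pi> a))) ^ 2 \<le>
      (\<Sum>a<k. (C i a j (\<pi> a) / sqrt (s a)) ^ 2) * (\<Sum>a<k. sqrt (s a) ^ 2)"
    using Cauchy_Schwarz_ineq_sum[of "\<lambda>a. C i a j (\<pi> a) / sqrt (s a)" "\<lambda>a. sqrt (s a)"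
        "{..<k}"] by simp
  also have "\<dots> \<le> M i j * 1"
  proof (rule mult_mono)
    have "(\<Sum>a<k. (C i a j (\<pi> a) / sqrt (s a)) ^ 2) = (\<Sum>a<k. C i a j (\<pi> a) ^ 2 / s a)"
      using s0 by (intro sum.cong refl) (simp add: power_divide)
    also have "\<dots> \<le> M i j"
      unfolding M_def s_def
      by (intro sum_mono member_le_sum[of "\<pi> _" "{..<k}" "\<lambda>b. C i _ j b ^ 2 / sqrt (q i _ * q j
          b)"])
        (auto simp: \<pi>k q_nonneg i j intro!: divide_nonneg_nonneg)
    finally show "(\<Sum>a<k. (C i a j (\<pi> a) / sqrt (s a)) ^ 2) \<le> M i j" .
    have "(\<Sum>a<k. sqrt (s a) ^ 2) = (\<Sum>a<k. s a)" using s0 by (intro sum.cong) auto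
    also have "\<dots> \<le> (\<Sum>a<k. (q i a + q j (\<pi> a)) / 2)"
      unfolding s_def by (intro sum_mono arith_geo_mean_sqrt) (use q_nonneg i j \<pi>k in auto)
    also have "\<dots> = ((\<Sum>a<k. q i a) + (\<Sum>a<k. q j (\<pi> a))) / 2"
      by (simp add: sum.distrib sum_divide_distrib[symmetric])
    also have "(\<Sum>a<k. q j (\<pi> a)) = (\<Sum>a<k. q j a)"
      using sum.permute[OF \<pi>, of "q j"] by (simp add: o_def)
    finally show "(\<Sum>a<k. sqrt (s a) ^ 2) \<le> 1" using q_sum i j by simp
  qed (auto simp: M_nonneg i j intro!: sum_nonneg)
  finally show ?thesis by (simp add: real_le_rsqrt)
qed

text \<open>The law of total variance: \<open>J i a j b / q j b\<close> is the probability of label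
  a at i conditioned on label b at j, and the extra term is the variance of this conditional
  probability over b.\<close>

lemma conditioning_square:
  assumes "i < n" "a < k" "j < n"
  shows "(\<Sum>b<k. q j b * (J i a j b / q j b) ^ 2) = q i a ^ 2 + (\<Sum>b<k. C i a j b ^ 2 / q j b)"
proof -
  have "(\<Sum>b<k. C i a j b ^ 2 / q j b) =
      (\<Sum>b<k. q j b * (J i a j b / q j b) ^ 2 - 2 * q i a * J i a j b + q i a ^ 2 * q j b)"
  proof (intro sum.cong refl)
    fix b assume "b \<in> {..<k}"
    then have b: "b < k" by simp
    show "C i a j b ^ 2 / q j b = q j b * (J i a j b / q j b) ^ 2 - 2 * q i a * J i a j b + q i a ^ 2 * q j b"
    proof (cases "q j b = 0")
      case True
      then have "C i a j b = 0" using C_eq_0 assms b by blast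
      then show ?thesis using True by (simp add: C_def)
    next
      case False
      then show ?thesis by (simp add: C_def field_simps power2_eq_square)
    qed
  qed
  also have "\<dots> = (\<Sum>b<k. q j b * (J i a j b / q j b) ^ 2) - 2 * q i a * (\<Sum>b<k. J i a j b) + q i
      a ^ 2 * (\<Sum>b<k. q j b)"
    by (simp add: sum.distrib sum_subtractf sum_distrib_left)
  finally show ?thesis using J_sum[OF assms] q_sum[OF assms(3)] by (simp add: power2_eq_square)
qed

text \<open>AM-GM turns the reciprocal geometric mean into the average of 1 / \<open>q i a\<close>
  and 1 / \<open>q j b\<close>, and the two halves agree after exchanging i and j. The right side is
  n times the gain in \<open>collision\<close>, summed over the vertices j one may condition
  on.\<close>

lemma sum_M_le: "(\<Sum>i<n. \<Sum>j<n. M i j) \<le>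
    (\<Sum>j<n. \<Sum>i<n. \<Sum>a<k. \<Sum>b<k. C i a j b ^ 2 / q j b)"
proof -
  define G where "G i j = (\<Sum>a<k. \<Sum>b<k. C i a j b ^ 2 / q j b)" for i j
  have G': "(\<Sum>a<k. \<Sum>b<k. C i a j b ^ 2 / q i a) = G j i" for i j
    unfolding G_def by (subst sum.swap) (simp add: C_sym[of i])
  have MG: "M i j \<le> (G i j + G j i) / 2" if ij: "i < n" "j < n" for i j
  proof -
    have "M i j \<le> (\<Sum>a<k. \<Sum>b<k. (C i a j b ^ 2 / q j b + C i a j b ^ 2 / q i a) / 2)"
      unfolding M_def
    proof (intro sum_mono)
      fix a b assume "a \<in> {..<k}" "b \<in> {..<k}"
      then have ab: "a < k" "b < k" by auto
      show "C i a j b ^ 2 / sqrt (q i a * q j b) \<le> (C i a j b ^ 2 / q j b + C i a j b ^ 2 / q i a) / 2"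
      proof (cases "q i a = 0 \<or> q j b = 0")
        case True
        then show ?thesis using C_eq_0 ij ab by auto
      next
        case False
        then have pos: "0 < q i a" "0 < q j b" using q_nonneg ij ab by (auto simp: less_le)
        have "1 / sqrt (q i a * q j b) = sqrt ((1 / q i a) * (1 / q j b))"
          by (simp add: real_sqrt_divide)
        also have "\<dots> \<le> (1 / q i a + 1 / q j b) / 2" using pos by (intro arith_geo_mean_sqrt) auto
        finally have "C i a j b ^ 2 * (1 / sqrt (q i a * q j b)) \<le>
            C i a j b ^ 2 * ((1 / q i a + 1 / q j b) / 2)"
          by (intro mult_left_mono) auto
        then show ?thesis by (simp add: algebra_simps)
      qed
    qed
    also have "\<dots> = (G i j + G j i) / 2"
      unfolding G'[of i j, symmetric] unfolding G_def by (simp add: sum.distrib sum_divide_distrib[symmetric])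
    finally show ?thesis .
  qed
  have "(\<Sum>i<n. \<Sum>j<n. M i j) \<le> (\<Sum>i<n. \<Sum>j<n. (G i j + G j i) / 2)"
    by (intro sum_mono) (use MG in auto)
  also have "\<dots> = ((\<Sum>i<n. \<Sum>j<n. G i j) + (\<Sum>i<n. \<Sum>j<n. G j i)) / 2"
    by (simp add: sum.distrib sum_divide_distrib[symmetric])
  also have "(\<Sum>i<n. \<Sum>j<n. G i j) = (\<Sum>i<n. \<Sum>j<n. G j i)" by (rule sum.swap)
  finally show ?thesis unfolding G_def by simp
qed

end

section \<open>Regular instances\<close>

lemma finite_set_pmf_ug: "ug_instance n k I \<Longrightarrow> finite (set_pmf I)"
  unfolding ug_instance_def
  by (erule conjE, erule finite_subset) (auto intro!: finite_cartesian_product finite_permutations)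

lemma ug_instance_dest:
  assumes "ug_instance n k I" "(i, j, \<pi>) \<in> set_pmf I"
  shows "i < n" "j < n" "\<pi> permutes {..<k}"
  using assms by (auto simp: ug_instance_def)

lemma prob_eq_sum:
  assumes "finite (set_pmf I)"
  shows "measure_pmf.prob I A = (\<Sum>c\<in>set_pmf I. pmf I c * (if c \<in> A then 1 else 0))"
proof -
  have "measure_pmf.prob I A = measure_pmf.prob I (A \<inter> set_pmf I)" by (simp add: measure_Int_set_pmf)
  also have "\<dots> = (\<Sum>c\<in>A \<inter> set_pmf I. pmf I c)" using assms
      by (simp add: measure_measure_pmf_finite)
  also have "\<dots> = (\<Sum>c\<in>set_pmf I. pmf I c * (if c \<in> A then 1 else 0))"
    using assms by (subst Int_commute) (simp add: sum.inter_restrict if_distrib cong: if_cong)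
  finally show ?thesis .
qed

lemma sum_pmf_set_pmf: "finite (set_pmf I) \<Longrightarrow> (\<Sum>c\<in>set_pmf I. pmf I c) = 1"
  by (rule sum_pmf_eq_1) auto

text \<open>A constraint between distinct vertices is met at (a, b) and at (b, a), a loop only once;
  hence the factor 2 off the diagonal.\<close>

lemma sum_edge_weight:
  assumes ug: "ug_instance n k I" and g: "\<And>i j. g i j = (g j i :: real)"
  shows "(\<Sum>i<n. \<Sum>j<n. edge_weight I i j * g i j) =
    (\<Sum>(a, b, \<pi>)\<in>set_pmf I. pmf I (a, b, \<pi>) * (if a = b then g a b else 2 * g a b))"
proof -
  note fin = finite_set_pmf_ug[OF ug]
  have one: "(\<Sum>i<n. \<Sum>j<n. (if {a, b} = {i, j} then g i j else 0)) = (if a =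
      b then g a b else 2 * g a b)"
    if ab: "a < n" "b < n" for a b
  proof -
    have "(\<Sum>i<n. \<Sum>j<n. (if {a, b} = {i, j} then g i j else 0)) =
        (\<Sum>i<n. (if i = a then g a b else 0) + (if i = b \<and> a \<noteq> b then g b a else 0))"
    proof (intro sum.cong refl)
      fix i assume "i \<in> {..<n}"
      have "(\<Sum>j<n. (if {a, b} = {i, j} then g i j else 0)) =
          (\<Sum>j<n. (if j = b then if i = a then g a b else 0 else 0) +
            (if j = a then if i = b \<and> a \<noteq> b then g b a else 0 else 0))"
        by (intro sum.cong refl) (auto simp: doubleton_eq_iff)
      also have "\<dots> = (if i = a then g a b else 0) + (if i = b \<and> a \<noteq> b then g b a else 0)"
        using ab by (simp add: sum.distrib)
      finally show "(\<Sum>j<n. (if {a, b} = {i, j} then g i j else 0)) = \<dots>" .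
    qed
    also have "\<dots> = g a b + (if a \<noteq> b then g b a else 0)"
      using ab by (simp add: sum.distrib)
    finally show ?thesis using g[of a b] by simp
  qed
  have "(\<Sum>i<n. \<Sum>j<n. edge_weight I i j * g i j) =
      (\<Sum>i<n. \<Sum>j<n. \<Sum>c\<in>set_pmf I. pmf I c * (case c of (a, b, \<pi>) \<Rightarrow> if {a, b}
          = {i, j} then g i j else 0))"
    unfolding edge_weight_def prob_eq_sum[OF fin] sum_distrib_right
    by (intro sum.cong refl) (simp add: split_def)
  also have "\<dots> = (\<Sum>c\<in>set_pmf I. pmf I c *
      (\<Sum>i<n. \<Sum>j<n. (case c of (a, b, \<pi>) \<Rightarrow> if {a, b} = {i, j} then g i j else 0)))"
    by (subst sum_sum_swap_out) (simp add: sum_distrib_left)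
  also have "\<dots> = (\<Sum>(a, b, \<pi>)\<in>set_pmf I. pmf I (a, b, \<pi>) * (if a =
      b then g a b else 2 * g a b))"
  proof (rule sum.cong[OF refl])
    fix c assume c: "c \<in> set_pmf I"
    obtain a b \<pi> where abp: "c = (a, b, \<pi>)" by (cases c)
    with c have "a < n" "b < n" using ug_instance_dest[OF ug] by auto
    from one[OF this] show "pmf I c *
        (\<Sum>i<n. \<Sum>j<n. (case c of (a, b, \<pi>) \<Rightarrow> if {a, b} = {i, j} then g i j else 0)) =
      (case c of (a, b, \<pi>) \<Rightarrow> pmf I (a, b, \<pi>) * (if a = b then g a b else 2 * g a b))"
      unfolding abp by simp
  qed
  finally show ?thesis .
qed

locale regular_ug =
  fixes n k :: nat and I :: "ug_constraint pmf"
  assumes ug: "ug_instance n k I" and regular: "regular_instance n I"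
begin

lemmas fin = finite_set_pmf_ug[OF ug]
lemmas inst = ug_instance_dest[OF ug]

lemma k_pos: "0 < k" using ug by (simp add: ug_instance_def)

lemma n_pos: "0 < n"
proof -
  obtain c where "c \<in> set_pmf I" using set_pmf_not_empty[of I] by auto
  then show ?thesis using inst by (cases c) fastforce
qed

definition A :: "nat \<Rightarrow> nat \<Rightarrow> real" where
  "A i j = edge_weight I i j / weighted_degree n I i"

lemma edge_weight_sym: "edge_weight I i j = edge_weight I j i"
  unfolding edge_weight_def by (simp add: insert_commute)

lemma edge_weight_nonneg: "0 \<le> edge_weight I i j"
  by (simp add: edge_weight_def)

definition deg :: real where "deg = weighted_degree n I 0"

lemma degree_const: "i < n \<Longrightarrow> weighted_degree n I i = deg"
  unfolding deg_def using regular n_pos unfolding regular_instance_def by blast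

text \<open>Loops contribute once and all other constraints twice to the sum of the degrees, and the
  probabilities add up to 1.\<close>

lemma degree_bounds:
  "1 \<le> real n * deg" "real n * deg \<le> 2"
proof -
  have "real n * deg = (\<Sum>i<n. weighted_degree n I i)"
    by (simp add: degree_const)
  also have "\<dots> = (\<Sum>(a, b, \<pi>)\<in>set_pmf I. pmf I (a, b, \<pi>) * (if a = b then 1 else 2))"
    unfolding weighted_degree_def using sum_edge_weight[OF ug, of "\<lambda>_ _. 1"]
        by (simp add: split_def cong: if_cong)
  finally have eq: "real n * deg = \<dots>" .
  have "(\<Sum>c\<in>set_pmf I. pmf I c) \<le>
      (\<Sum>(a, b, \<pi>)\<in>set_pmf I. pmf I (a, b, \<pi>) * (if a = b then 1 else 2))"
    by (intro sum_mono) (simp add: split_def)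
  then show "1 \<le> real n * deg" by (simp add: eq sum_pmf_set_pmf[OF fin])
  have "(\<Sum>(a, b, \<pi>)\<in>set_pmf I. pmf I (a, b, \<pi>) * (if a = b then 1 else 2)) \<le>
      (\<Sum>c\<in>set_pmf I. 2 * pmf I c)"
    by (intro sum_mono) (simp add: split_def)
  then show "real n * deg \<le> 2"
    by (simp add: eq sum_pmf_set_pmf[OF fin] sum_distrib_left[symmetric])
qed

lemma degree_pos: "0 < deg"
proof (rule ccontr)
  assume "\<not> 0 < deg"
  then have "real n * deg \<le> 0" by (intro mult_nonneg_nonpos) auto
  with degree_bounds(1) show False by linarith
qed

lemma A_nonneg: "i < n \<Longrightarrow> 0 \<le> A i j"
  using degree_pos by (simp add: A_def edge_weight_nonneg degree_const)

lemma A_sym: "i < n \<Longrightarrow> j < n \<Longrightarrow> A i j = A j i"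
  by (simp add: A_def edge_weight_sym[of i j] degree_const)

lemma A_row_sum: "i < n \<Longrightarrow> (\<Sum>j<n. A i j) = 1"
  using degree_pos degree_const[of i]
  by (simp add: A_def sum_divide_distrib[symmetric] weighted_degree_def[symmetric])

text \<open>Bound each product by the mean of the two squares and use that rows and columns sum to
  1. This is what keeps all eigenvalues at most 1.\<close>

lemma A_contraction: "(\<Sum>i<n. \<Sum>j<n. x i * x j * A i j) \<le> (\<Sum>i<n. x i ^ 2)"
proof -
  have "(\<Sum>i<n. \<Sum>j<n. x i * x j * A i j) \<le>
      (\<Sum>i<n. \<Sum>j<n. (x i ^ 2 * A i j + x j ^ 2 * A j i) / 2)"
  proof (intro sum_mono)
    fix i j assume "i \<in> {..<n}" "j \<in> {..<n}"
    then have ij: "i < n" "j < n" by auto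
    have "x i * x j \<le> (x i ^ 2 + x j ^ 2) / 2" using sum_squares_bound[of "x i" "x j"] by simp
    then have "x i * x j * A i j \<le> (x i ^ 2 + x j ^ 2) / 2 * A i j"
      using A_nonneg[OF ij(1)] by (rule mult_right_mono)
    then show "x i * x j * A i j \<le> (x i ^ 2 * A i j + x j ^ 2 * A j i) / 2"
      using A_sym[OF ij] by (simp add: algebra_simps)
  qed
  also have "\<dots> = ((\<Sum>i<n. \<Sum>j<n. x i ^ 2 * A i j) + (\<Sum>i<n. \<Sum>j<n. x j ^ 2 * A j i)) / 2"
    by (simp add: sum.distrib sum_divide_distrib[symmetric])
  also have "(\<Sum>i<n. \<Sum>j<n. x j ^ 2 * A j i) = (\<Sum>i<n. \<Sum>j<n. x i ^ 2 * A i j)"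
      by (rule sum.swap)
  also have "(\<Sum>i<n. \<Sum>j<n. x i ^ 2 * A i j) = (\<Sum>i<n. x i ^ 2)"
    by (simp add: sum_distrib_left[symmetric] A_row_sum)
  finally show ?thesis by simp
qed

text \<open>Each constraint kept on the left is counted twice in the sum over ordered pairs, while
  normalization divides by \<open>n * deg\<close>, which is at most 2; the two factors
  cancel.\<close>

lemma constraint_sum_le_edge_average:
  assumes g: "\<And>i j. g i j = (g j i :: real)" and g0: "\<And>i j. i < n \<Longrightarrow>
      j < n \<Longrightarrow> 0 \<le> g i j"
  shows "(\<Sum>(i, j, \<pi>)\<in>set_pmf I. pmf I (i, j, \<pi>) * (if i = j then 0 else g i j)) \<le>
    (\<Sum>i<n. \<Sum>j<n. A i j * g i j) / n"
proof -
  let ?D = "deg"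
  let ?S = "\<Sum>i<n. \<Sum>j<n. edge_weight I i j * g i j"
  have S0: "0 \<le> ?S" by (intro sum_nonneg mult_nonneg_nonneg) (auto simp: edge_weight_nonneg g0)
  have "(\<Sum>(i, j, \<pi>)\<in>set_pmf I. pmf I (i, j, \<pi>) * (if i = j then 0 else g i j)) * 2 \<le> ?S"
    unfolding sum_edge_weight[OF ug g] sum_distrib_right
    by (intro sum_mono) (auto dest: inst simp: g0)
  also have "?S * (real n * ?D) \<le> ?S * 2" by (rule mult_left_mono[OF degree_bounds(2) S0])
  then have "?S \<le> 2 * (?S / (real n * ?D))" using degree_bounds(1) by (simp add: field_simps)
  also have "?S / (real n * ?D) = (\<Sum>i<n. \<Sum>j<n. A i j * g i j) / n"
    by (simp add: A_def degree_const sum_divide_distrib[symmetric] mult.commute)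
  finally show ?thesis by simp
qed

text \<open>The weights \<open>A i j / n\<close> form a probability distribution on pairs, so
  Jensen's inequality moves the square root outside the average; what remains is the trace of
  \<open>A\<close> times \<open>M\<close>.\<close>

lemma edge_correlation_bound:
  fixes M :: "nat \<Rightarrow> nat \<Rightarrow> real"
  assumes M_sym: "\<And>i j. M i j = M j i"
    and M0: "\<And>i j. i < n \<Longrightarrow> j < n \<Longrightarrow> 0 \<le> M i j"
    and M1: "\<And>i j. i < n \<Longrightarrow> j < n \<Longrightarrow> M i j \<le> 1"
    and psd: "\<And>x. 0 \<le> (\<Sum>i<n. \<Sum>j<n. x i * x j * M i j)"
    and \<tau>: "0 \<le> \<tau>" "\<tau> < 1"
  defines "m \<equiv> threshold_rank n I \<tau>"
  shows "(\<Sum>(i, j, \<pi>)\<in>set_pmf I. pmf I (i, j, \<pi>) * (if i = j then 0 else sqrt (M i j))) \<le>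
    sqrt (\<tau> + (1 - \<tau>) * sqrt (m * ((\<Sum>i<n. \<Sum>j<n. M i j) / n ^ 2)))"
proof -
  let ?N = "normalized_adjacency n I"
  have Nij: "?N $$ (i, j) = A i j" if "i < n" "j < n" for i j
    using that by (simp add: normalized_adjacency_def A_def)
  have NC: "?N \<in> carrier_mat n n" by (simp add: normalized_adjacency_def)
  have NT: "?N\<^sup>T = ?N"
    by (rule eq_matI) (use NC in \<open>auto simp: Nij A_sym\<close>)
  define Y where "Y = (\<Sum>i<n. \<Sum>j<n. A i j * sqrt (M i j)) / n"
  let ?S = "\<Sum>i<n. \<Sum>j<n. M i j"
  have le_Y: "(\<Sum>(i, j, \<pi>)\<in>set_pmf I. pmf I (i, j, \<pi>) * (if i =
      j then 0 else sqrt (M i j))) \<le> Y"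
    unfolding Y_def by (rule constraint_sum_le_edge_average) (use M_sym M0 in auto)
  have "Y = (\<Sum>z\<in>{..<n} \<times> {..<n}. (case z of (i, j) \<Rightarrow> A i j / n) * (case z of (i, j)
      \<Rightarrow> sqrt (M i j)))"
    unfolding Y_def sum.cartesian_product sum_divide_distrib by (intro sum.cong) auto
  then have "Y ^ 2 \<le> (\<Sum>z\<in>{..<n} \<times> {..<n}. (case z of (i, j) \<Rightarrow> A i j / n) *
      (case z of (i, j) \<Rightarrow> sqrt (M i j)) ^ 2)"
    by (simp only:) (rule weighted_mean_square, use n_pos
        in \<open>auto simp: A_nonneg sum.cartesian_product[symmetric]
        sum_divide_distrib[symmetric] A_row_sum\<close>)
  also have "\<dots> = (\<Sum>z\<in>{..<n} \<times> {..<n}. (case z of (i, j) \<Rightarrow> A i j * M i j / n))"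
    by (intro sum.cong) (auto simp: M0)
  also have "\<dots> = (\<Sum>i<n. \<Sum>j<n. ?N $$ (i, j) * M i j) / n"
    by (simp add: sum.cartesian_product[symmetric] sum_divide_distrib[symmetric] Nij)
  also have "\<dots> \<le> (\<tau> * (\<Sum>i<n. M i i) + (1 - \<tau>) * (sqrt m * sqrt (\<Sum>i<n. \<Sum>j<n.
      M i j ^ 2))) / n"
    unfolding m_def threshold_rank_def
    by (intro divide_right_mono spectral_trace_bound[OF NC NT _ psd \<tau>(2)])
      (use A_contraction in \<open>auto simp: Nij\<close>)
  also have "\<dots> \<le> (\<tau> * n + (1 - \<tau>) * (sqrt m * sqrt ?S)) / n"
  proof (intro divide_right_mono add_mono mult_left_mono)
    have "(\<Sum>i<n. M i i) \<le> (\<Sum>i<n. 1)" by (intro sum_mono) (use M1 in auto)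
    then show "(\<Sum>i<n. M i i) \<le> n" by simp
    \<comment> \<open>Entries in [0, 1] dominate their squares, so the Frobenius norm is controlled
      by the plain average of \<open>M\<close>, the quantity that conditioning can reduce.\<close>
    have "(\<Sum>i<n. \<Sum>j<n. M i j ^ 2) \<le> ?S"
      by (intro sum_mono) (use M0 M1 in \<open>auto simp: power2_eq_square mult_left_le\<close>)
    then show "sqrt (\<Sum>i<n. \<Sum>j<n. M i j ^ 2) \<le> sqrt ?S" by simp
  qed (use \<tau> in auto)
  also have "\<dots> = \<tau> + (1 - \<tau>) * sqrt (m * (?S / n ^ 2))"
    using n_pos by (simp add: real_sqrt_mult real_sqrt_divide field_simps)
  finally have "Y ^ 2 \<le> \<tau> + (1 - \<tau>) * sqrt (m * (?S / n ^ 2))" .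
  then have "Y \<le> sqrt (\<tau> + (1 - \<tau>) * sqrt (m * (?S / n ^ 2)))" by (rule real_le_rsqrt)
  with le_Y show ?thesis by (rule order_trans)
qed

end

section \<open>Conditioning and the potential\<close>

text \<open>\<open>p E\<close> is the pseudo-probability that every (vertex, label) pair of
  \<open>E\<close> holds, and \<open>vec E\<close> the vector of that event. Indexing by sets of
  pairs makes conditioning a mere \<open>insert\<close>; contradictory sets are allowed and have
  probability 0.\<close>

locale ug_relaxation = regular_ug +
  fixes r d :: nat
    and p :: "(nat \<times> nat) set \<Rightarrow> real"
    and vec :: "(nat \<times> nat) set \<Rightarrow> nat \<Rightarrow> real"
  assumes p_empty: "p {} = 1"
    and p_nonneg: "E \<subseteq> {..<n} \<times> {..<k} \<Longrightarrow> card E \<le> r + 2 \<Longrightarrow>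
        0 \<le> p E"
    and p_split: "E \<subseteq> {..<n} \<times> {..<k} \<Longrightarrow> card E \<le> r + 1 \<Longrightarrow>
        j < n \<Longrightarrow>
      (\<Sum>b<k. p (insert (j, b) E)) = p E"
    and p_excl: "E \<subseteq> {..<n} \<times> {..<k} \<Longrightarrow> card E \<le> r + 2 \<Longrightarrow>
        (i, a) \<in> E \<Longrightarrow> (i, b) \<in> E \<Longrightarrow>
      a \<noteq> b \<Longrightarrow> p E = 0"
    and p_gram: "E \<subseteq> {..<n} \<times> {..<k} \<Longrightarrow>
        F \<subseteq> {..<n} \<times> {..<k} \<Longrightarrow> card (E \<union> F) \<le> r + 2 \<Longrightarrow>
      p (E \<union> F) = (\<Sum>l<d. vec E l * vec F l)"
begin

abbreviation grid :: "(nat \<times> nat) set" where "grid \<equiv> {..<n} \<times> {..<k}"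

text \<open>The bound \<open>r\<close> leaves room for the two further pairs needed for conditional
  pair marginals, and positivity makes conditioning meaningful.\<close>

definition state :: "(nat \<times> nat) set \<Rightarrow> bool" where
  "state E \<longleftrightarrow> E \<subseteq> grid \<and> card E \<le> r \<and> 0 < p E"

definition q :: "(nat \<times> nat) set \<Rightarrow> nat \<Rightarrow> nat \<Rightarrow> real" where
  "q E i a = p (insert (i, a) E) / p E"

definition J :: "(nat \<times> nat) set \<Rightarrow> nat \<Rightarrow> nat \<Rightarrow> nat \<Rightarrow> nat
    \<Rightarrow> real" where
  "J E i a j b = p (insert (i, a) (insert (j, b) E)) / p E"

text \<open>The event vector projected orthogonally to \<open>vec E\<close> and rescaled:
  \<open>q E i a\<close> is the projection coefficient and \<open>p E\<close> the squared length of
  \<open>vec E\<close>. Inner products of these vectors are therefore the conditional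
  covariances.\<close>

definition u :: "(nat \<times> nat) set \<Rightarrow> nat \<Rightarrow> nat \<Rightarrow> nat \<Rightarrow>
    real" where
  "u E i a l = (vec (insert (i, a) E) l - q E i a * vec E l) / sqrt (p E)"

lemma card_insert_le_Suc: "card (insert x E) \<le> Suc (card E)"
  using card_insert_le_m1[of "Suc (card E)" E x] by simp

lemma pair_marginals:
  assumes E: "state E"
  shows "pair_marginals n k d (q E) (J E) (u E)"
proof
  note E' = E[unfolded state_def]
  have c1: "card (insert x E) \<le> r + 1" for x using card_insert_le_Suc[of x E] E' by simp
  have c2: "card (insert x (insert y E)) \<le> r + 2" for x y
    using card_insert_le_Suc[of x "insert y E"] c1[of y] by simp
  have sub: "insert (i, a) E \<subseteq> grid" if "i < n" "a < k" for i a using that E' by auto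
  have pE: "0 < p E" using E' by simp
  show "0 \<le> q E i a" if "i < n" "a < k" for i a
    using p_nonneg[OF sub[OF that]] c1[of "(i, a)"] pE by (simp add: q_def)
  show "(\<Sum>a<k. q E i a) = 1" if "i < n" for i
    using p_split[of E i] E' that by (simp add: q_def sum_divide_distrib[symmetric])
  show "0 \<le> J E i a j b" if "i < n" "a < k" "j < n" "b < k" for i a j b
    using p_nonneg[of "insert (i, a) (insert (j, b) E)"] that E' c2 by (auto simp: J_def)
  show "(\<Sum>b<k. J E i a j b) = q E i a" if "i < n" "a < k" "j < n" for i a j
    using p_split[OF sub[OF that(1,2)] c1 that(3)]
    by (simp add: J_def q_def sum_divide_distrib[symmetric] insert_commute)
  show "J E i a j b = J E j b i a" for i a j b by (simp add: J_def insert_commute)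
  show "J E i a i b = (if a = b then q E i a else 0)" if "i < n" "a < k" "b < k" for i a b
    using p_excl[of "insert (i, a) (insert (i, b) E)" i a b] that E' c2
    by (auto simp: J_def q_def)
  show "J E i a j b - q E i a * q E j b = (\<Sum>l<d. u E i a l * u E j b l)"
    if ij: "i < n" "a < k" "j < n" "b < k" for i a j b
  proof -
    let ?v = "vec (insert (i, a) E)" and ?w = "vec (insert (j, b) E)" and ?z = "vec E"
    have g1: "p (insert (i, a) (insert (j, b) E)) = (\<Sum>l<d. ?v l * ?w l)"
      using p_gram[OF sub[OF ij(1,2)] sub[OF ij(3,4)]] c2 by (simp add: insert_commute)
    have g2: "q E i a * p E = (\<Sum>l<d. ?v l * ?z l)"
      using p_gram[OF sub[OF ij(1,2)], of E] E' c1[of "(i, a)"] by (simp add: q_def insert_absorb Un_absorb2)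
    have g3: "q E j b * p E = (\<Sum>l<d. ?w l * ?z l)"
      using p_gram[OF sub[OF ij(3,4)], of E] E' c1[of "(j, b)"] by (simp add: q_def insert_absorb Un_absorb2)
    have g4: "p E = (\<Sum>l<d. ?z l * ?z l)"
      using p_gram[of E E] E' by simp
    have "(\<Sum>l<d. u E i a l * u E j b l) =
        (\<Sum>l<d. ((?v l * ?w l - q E j b * (?v l * ?z l)) - q E i a * (?w l * ?z l) +
          q E i a * q E j b * (?z l * ?z l)) / p E)"
      using pE by (intro sum.cong refl) (simp add: u_def field_simps)
    also have "\<dots> = ((\<Sum>l<d. ?v l * ?w l) - q E j b * (\<Sum>l<d. ?v l * ?z l) -
          q E i a * (\<Sum>l<d. ?w l * ?z l) + q E i a * q E j b * (\<Sum>l<d. ?z l * ?z l)) / p E"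
      by (simp add: sum.distrib sum_subtractf sum_distrib_left sum_divide_distrib[symmetric])
    also have "\<dots> = J E i a j b - q E i a * q E j b"
      unfolding g1[symmetric] g2[symmetric] g3[symmetric] g4[symmetric] J_def
      using pE by (simp add: field_simps)
    finally show ?thesis ..
  qed
qed

section \<open>Conditional objective, independent rounding and their gap\<close>

definition constraint_val :: "(nat \<times> nat) set \<Rightarrow> ug_constraint \<Rightarrow> real" where
  "constraint_val E = (\<lambda>(i, j, \<pi>). \<Sum>a<k. J E i a j (\<pi> a))"

definition objective :: "(nat \<times> nat) set \<Rightarrow> real" where
  "objective E = (\<Sum>c\<in>set_pmf I. pmf I c * constraint_val E c)"

text \<open>The two ends of a loop receive the same draw, so a loop is evaluated by one marginal;
  with this convention loops lose nothing in the rounding.\<close>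

definition rounded_val :: "(nat \<times> nat) set \<Rightarrow> ug_constraint \<Rightarrow> real" where
  "rounded_val E = (\<lambda>(i, j, \<pi>). if i = j then \<Sum>a<k. if \<pi> a = a then q E i a else 0
     else \<Sum>a<k. q E i a * q E j (\<pi> a))"

definition rounded :: "(nat \<times> nat) set \<Rightarrow> real" where
  "rounded E = (\<Sum>c\<in>set_pmf I. pmf I c * rounded_val E c)"

definition collision :: "(nat \<times> nat) set \<Rightarrow> real" where
  "collision E = (\<Sum>i<n. \<Sum>a<k. q E i a ^ 2) / n"

definition potential :: "real \<Rightarrow> (nat \<times> nat) set \<Rightarrow> real" where
  "potential w E = objective E + w * collision E"

definition corr :: "(nat \<times> nat) set \<Rightarrow> nat \<Rightarrow> nat \<Rightarrow> real" where
  "corr E = pair_marginals.M k (q E) (J E)"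

definition mean_corr :: "(nat \<times> nat) set \<Rightarrow> real" where
  "mean_corr E = (\<Sum>i<n. \<Sum>j<n. corr E i j) / n ^ 2"

lemma perm_lt: "\<pi> permutes {..<k} \<Longrightarrow> a < k \<Longrightarrow> \<pi> a < k"
  using permutes_in_image[of \<pi> "{..<k}" a] by simp

lemma loop_val:
  assumes "state E" "(i, i, \<pi>) \<in> set_pmf I"
  shows "constraint_val E (i, i, \<pi>) = rounded_val E (i, i, \<pi>)"
proof -
  interpret pair_marginals n k d "q E" "J E" "u E" by (rule pair_marginals[OF assms(1)])
  show ?thesis
    using inst[OF assms(2)] unfolding constraint_val_def rounded_val_def
    by (auto intro!: sum.cong simp: J_diag perm_lt)
qed

lemma constraint_val_bounds:
  assumes "state E" "c \<in> set_pmf I"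
  shows "0 \<le> constraint_val E c" "constraint_val E c \<le> 1"
proof -
  interpret pair_marginals n k d "q E" "J E" "u E" by (rule pair_marginals[OF assms(1)])
  obtain i j \<pi> where c: "c = (i, j, \<pi>)" by (cases c)
  note i = inst[OF assms(2)[unfolded c]]
  have pa: "\<pi> a < k" if "a < k" for a using perm_lt[OF i(3) that] .
  show "0 \<le> constraint_val E c"
    unfolding c constraint_val_def using i pa by (auto intro!: sum_nonneg J_nonneg)
  have "constraint_val E c \<le> (\<Sum>a<k. q E i a)"
    unfolding c constraint_val_def using i pa by (auto intro!: sum_mono J_le)
  then show "constraint_val E c \<le> 1" using q_sum i by simp
qed

lemma objective_le_1: "state E \<Longrightarrow> objective E \<le> 1"
  unfolding objective_def sum_pmf_set_pmf[OF fin, symmetric]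
  by (intro sum_mono) (simp add: constraint_val_bounds mult_left_le)

lemma collision_bounds:
  assumes "state E"
  shows "0 \<le> collision E" "collision E \<le> 1"
proof -
  interpret pair_marginals n k d "q E" "J E" "u E" by (rule pair_marginals[OF assms])
  show "0 \<le> collision E" unfolding collision_def by (intro divide_nonneg_nonneg sum_nonneg) auto
  have "q E i a ^ 2 \<le> q E i a" if "i < n" "a < k" for i a
  proof -
    have "q E i a \<le> (\<Sum>a<k. q E i a)"
      by (rule member_le_sum[of a "{..<k}"]) (use that q_nonneg in auto)
    then show ?thesis using that q_nonneg q_sum by (simp add: power2_eq_square mult_left_le)
  qed
  then have "(\<Sum>i<n. \<Sum>a<k. q E i a ^ 2) \<le> (\<Sum>i<n. \<Sum>a<k. q E i a)" by (intro sum_mono) auto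
  also have "\<dots> = n" by (simp add: q_sum)
  finally show "collision E \<le> 1" using n_pos by (simp add: collision_def)
qed

lemma rounded_nonneg:
  assumes "state E"
  shows "0 \<le> rounded E"
proof -
  interpret pair_marginals n k d "q E" "J E" "u E" by (rule pair_marginals[OF assms])
  have "0 \<le> rounded_val E c" if "c \<in> set_pmf I" for c
  proof -
    obtain i j \<pi> where c: "c = (i, j, \<pi>)" by (cases c)
    note i = inst[OF that[unfolded c]]
    show ?thesis
      unfolding c rounded_val_def
      using i perm_lt[OF i(3)] by (auto intro!: sum_nonneg mult_nonneg_nonneg q_nonneg)
  qed
  then show ?thesis unfolding rounded_def by (intro sum_nonneg mult_nonneg_nonneg) auto
qed

text \<open>Each \<open>J\<close> value is at most both of its marginals, so its square is at most
  their product; Cauchy-Schwarz over the k labels and Jensen over the constraints do the rest. This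
  crude bound serves the case of a small alphabet and \<epsilon> close to 1.\<close>

lemma rounded_ge_square:
  assumes E: "state E"
  shows "objective E ^ 2 / k \<le> rounded E"
proof -
  interpret pair_marginals n k d "q E" "J E" "u E" by (rule pair_marginals[OF E])
  have *: "constraint_val E c ^ 2 / k \<le> rounded_val E c" if c: "c \<in> set_pmf I" for c
  proof -
    obtain i j \<pi> where ijp: "c = (i, j, \<pi>)" by (cases c)
    note i = inst[OF c[unfolded ijp]]
    show ?thesis
    proof (cases "i = j")
      case True
      have "constraint_val E c ^ 2 \<le> constraint_val E c * 1"
        using constraint_val_bounds[OF E c] by (simp add: power2_eq_square mult_left_le)
      also have "constraint_val E c * 1 \<le> constraint_val E c * k"
        using constraint_val_bounds(1)[OF E c] k_pos by (intro mult_left_mono) auto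
      finally have "constraint_val E c ^ 2 / k \<le> constraint_val E c"
        using k_pos by (simp add: divide_le_eq)
      then show ?thesis using loop_val[OF E] c ijp True by simp
    next
      case False
      have "(\<Sum>a<k. 1 * J E i a j (\<pi> a)) ^ 2 \<le>
          (\<Sum>a<k. 1 ^ 2) * (\<Sum>a<k. J E i a j (\<pi> a) ^ 2)"
        by (rule Cauchy_Schwarz_ineq_sum)
      also have "(\<Sum>a<k. J E i a j (\<pi> a) ^ 2) \<le> (\<Sum>a<k. q E i a * q E j (\<pi> a))"
      proof (intro sum_mono)
        fix a assume "a \<in> {..<k}"
        then have a: "a < k" "\<pi> a < k" using perm_lt i by auto
        show "J E i a j (\<pi> a) ^ 2 \<le> q E i a * q E j (\<pi> a)"
          unfolding power2_eq_square
          using J_le[OF i(1) a(1) i(2) a(2)] J_le[OF i(2) a(2) i(1) a(1)] J_sym[of i a j "\<pi> a"]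
            J_nonneg[OF i(1) a(1) i(2) a(2)] q_nonneg[OF i(1) a(1)]
          by (intro mult_mono) auto
      qed
      finally show ?thesis
        using k_pos False by (simp add: ijp constraint_val_def rounded_val_def divide_le_eq mult.commute)
    qed
  qed
  have "objective E ^ 2 \<le> (\<Sum>c\<in>set_pmf I. pmf I c * constraint_val E c ^ 2)"
    unfolding objective_def by (rule weighted_mean_square) (auto simp: sum_pmf_set_pmf[OF fin])
  then have "objective E ^ 2 / k \<le> (\<Sum>c\<in>set_pmf I. pmf I c * constraint_val E c ^ 2) / k"
    by (rule divide_right_mono) simp
  also have "\<dots> = (\<Sum>c\<in>set_pmf I. pmf I c * (constraint_val E c ^ 2 / k))"
    by (simp add: sum_divide_distrib)
  also have "\<dots> \<le> rounded E"
    unfolding rounded_def by (intro sum_mono mult_left_mono *) auto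
  finally show ?thesis .
qed

lemma rounding_gap:
  assumes E: "state E" and \<tau>: "0 \<le> \<tau>" "\<tau> < 1"
  shows "objective E - rounded E \<le>
    sqrt (\<tau> + (1 - \<tau>) * sqrt (threshold_rank n I \<tau> * mean_corr E))"
proof -
  interpret pair_marginals n k d "q E" "J E" "u E" by (rule pair_marginals[OF E])
  have "objective E - rounded E = (\<Sum>c\<in>set_pmf I. pmf I c * (constraint_val E c - rounded_val E c))"
    by (simp add: objective_def rounded_def sum_subtractf right_diff_distrib)
  also have "\<dots> \<le> (\<Sum>(i, j, \<pi>)\<in>set_pmf I. pmf I (i, j, \<pi>) * (if i =
      j then 0 else sqrt (M i j)))"
  proof (rule sum_mono)
    fix c assume c: "c \<in> set_pmf I"
    obtain i j \<pi> where ijp: "c = (i, j, \<pi>)" by (cases c)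
    note i = inst[OF c[unfolded ijp]]
    have "constraint_val E c - rounded_val E c \<le> (if i = j then 0 else sqrt (M i j))"
      using loop_val[OF E, of i \<pi>] rounding_loss[OF i] c
      by (auto simp: ijp constraint_val_def rounded_val_def)
    then show "pmf I c * (constraint_val E c - rounded_val E c) \<le>
        (case c of (i, j, \<pi>) \<Rightarrow> pmf I (i, j, \<pi>) * (if i = j then 0 else sqrt (M i j)))"
      unfolding ijp prod.case by (intro mult_left_mono) auto
  qed
  also have "\<dots> \<le> sqrt (\<tau> + (1 - \<tau>) * sqrt (threshold_rank n I \<tau> * ((\<Sum>i<n.
      \<Sum>j<n. M i j) / n ^ 2)))"
    by (rule edge_correlation_bound) (use M_sym M_nonneg M_le_1 M_psd \<tau> in auto)
  finally show ?thesis by (simp add: mean_corr_def corr_def)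
qed

text \<open>Averaged over the label b of vertex j, the objective is unchanged and the collision
  probability grows by at least g. Some label of positive probability does at least as well as the
  average of the potential.\<close>

lemma conditioning_step:
  assumes E: "state E" and room: "card E < r" and w: "0 \<le> w" and j: "j < n"
    and gain: "g \<le> (\<Sum>i<n. \<Sum>a<k. \<Sum>b<k. pair_marginals.C (q E) (J E) i a j b ^ 2 / q E j b) /
        n"
  obtains b where "b < k" "state (insert (j, b) E)"
    "potential w E + w * g \<le> potential w (insert (j, b) E)"
proof -
  interpret pair_marginals n k d "q E" "J E" "u E" by (rule pair_marginals[OF E])
  note E' = E[unfolded state_def]
  have q': "q (insert (j, b) E) i a = J E i a j b / q E j b" for i a b
    using E' by (simp add: q_def J_def)
  have obj: "(\<Sum>b<k. q E j b * objective (insert (j, b) E)) = objective E"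
  proof -
    have val: "(\<Sum>b<k. q E j b * constraint_val (insert (j, b) E) c) = constraint_val E c"
      if c: "c \<in> set_pmf I" for c
    proof -
      obtain x y \<pi> where ijp: "c = (x, y, \<pi>)" by (cases c)
      note i = inst[OF c[unfolded ijp]]
      let ?P = "\<lambda>a b. p (insert (x, a) (insert (y, \<pi> a) (insert (j, b) E)))"
      \<comment> \<open>Conditioning on a label of probability 0 divides by 0 and contributes
        nothing. The sum over b is still the full marginal, because every event containing an
        impossible one is itself impossible.\<close>
      have P0: "?P a b = 0" if "a < k" "b < k" "p (insert (j, b) E) = 0" for a b
      proof -
        have s: "insert (j, b) E \<subseteq> grid" using that E' j by auto
        have cc: "card (insert z (insert (j, b) E)) \<le> r + 1" for z
          using card_insert_le_Suc[of z "insert (j, b) E"] card_insert_le_Suc[of "(j, b)" E] room by simp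
        have cc2: "card (insert z' (insert z (insert (j, b) E))) \<le> r + 2" for z z'
          using card_insert_le_Suc[of z' "insert z (insert (j, b) E)"] cc[of z] by simp
        have pa: "\<pi> a < k" using perm_lt i that by auto
        have "p (insert (y, \<pi> a) (insert (j, b) E)) \<le>
            (\<Sum>a'<k. p (insert (y, a') (insert (j, b) E)))"
          by (rule member_le_sum[of "\<pi> a" "{..<k}" "\<lambda>a'. p (insert (y, a') (insert (j, b) E))"])
            (use pa s i cc in \<open>auto intro!: p_nonneg le_trans[OF cc]\<close>)
        also have "\<dots> = p (insert (j, b) E)"
          using p_split[OF s _ i(2)] card_insert_le_Suc[of "(j, b)" E] room by simp
        finally have 1: "p (insert (y, \<pi> a) (insert (j, b) E)) \<le> 0" using that by simp
        have "?P a b \<le> (\<Sum>a'<k. p (insert (x, a') (insert (y, \<pi> a) (insert (j, b) E))))"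
          by (rule member_le_sum[of a "{..<k}" "\<lambda>a'. p (insert (x, a') (insert (y, \<pi> a) (insert (j,
              b) E)))"])
            (use pa s i that cc2 in \<open>auto intro!: p_nonneg\<close>)
        also have "\<dots> = p (insert (y, \<pi> a) (insert (j, b) E))"
          by (rule p_split) (use s pa i cc in auto)
        finally have "?P a b \<le> 0" using 1 by simp
        moreover have "0 \<le> ?P a b" by (rule p_nonneg) (use pa s i that cc2 in auto)
        ultimately show ?thesis by simp
      qed
      have "(\<Sum>b<k. q E j b * constraint_val (insert (j, b) E) c) = (\<Sum>b<k. \<Sum>a<k. ?P a b / p E)"
        unfolding ijp constraint_val_def prod.case sum_distrib_left
      proof (intro sum.cong refl)
        fix a b assume "a \<in> {..<k}" "b \<in> {..<k}"
        then show "q E j b * J (insert (j, b) E) x a y (\<pi> a) = ?P a b / p E"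
          using P0[of a b] by (cases "p (insert (j, b) E) = 0") (auto simp: q_def J_def)
      qed
      also have "\<dots> = (\<Sum>a<k. (\<Sum>b<k. p (insert (j, b) (insert (x, a) (insert (y, \<pi> a) E)))) /
          p E)"
        by (subst sum.swap) (simp add: sum_divide_distrib insert_commute)
      also have "\<dots> = constraint_val E c"
        unfolding ijp constraint_val_def prod.case J_def
      proof (intro sum.cong refl)
        fix a assume "a \<in> {..<k}"
        then have a: "a < k" "\<pi> a < k" using perm_lt i by auto
        have "card (insert (x, a) (insert (y, \<pi> a) E)) \<le> r + 1"
          using card_insert_le_Suc[of "(x, a)" "insert (y, \<pi> a) E"] card_insert_le_Suc[of "(y, \<pi> a)" E]
              room by simp
        then have "(\<Sum>b<k. p (insert (j, b) (insert (x, a) (insert (y, \<pi> a) E)))) =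
            p (insert (x, a) (insert (y, \<pi> a) E))"
          by (intro p_split) (use a i j E' in auto)
        then show "(\<Sum>b<k. p (insert (j, b) (insert (x, a) (insert (y, \<pi> a) E)))) / p E =
            p (insert (x, a) (insert (y, \<pi> a) E)) / p E" by simp
      qed
      finally show ?thesis .
    qed
    have "(\<Sum>b<k. q E j b * objective (insert (j, b) E)) =
        (\<Sum>c\<in>set_pmf I. pmf I c * (\<Sum>b<k. q E j b * constraint_val (insert (j, b) E) c))"
      unfolding objective_def sum_distrib_left by (subst sum.swap) (simp add: mult_ac)
    also have "\<dots> = objective E" unfolding objective_def by (intro sum.cong refl) (simp add: val)
    finally show ?thesis .
  qed
  have coll: "collision E + g \<le> (\<Sum>b<k. q E j b * collision (insert (j, b) E))"
  proof -
    have "(\<Sum>b<k. q E j b * collision (insert (j, b) E)) =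
        (\<Sum>b<k. \<Sum>i<n. \<Sum>a<k. q E j b * (J E i a j b / q E j b) ^ 2) / n"
      by (simp add: collision_def q' sum_distrib_left sum_divide_distrib)
    also have "(\<Sum>b<k. \<Sum>i<n. \<Sum>a<k. q E j b * (J E i a j b / q E j b) ^ 2) =
        (\<Sum>i<n. \<Sum>a<k. \<Sum>b<k. q E j b * (J E i a j b / q E j b) ^ 2)"
      by (rule trans[OF sum.swap]) (rule sum.cong[OF refl], rule sum.swap)
    also have "\<dots> = (\<Sum>i<n. \<Sum>a<k. q E i a ^ 2 + (\<Sum>b<k. C i a j b ^ 2 / q E j b))"
      by (intro sum.cong refl) (use conditioning_square j in auto)
    finally show ?thesis
      using gain by (simp add: collision_def sum.distrib add_divide_distrib)
  qed
  have avg: "potential w E + w * g \<le> (\<Sum>b<k. q E j b * potential w (insert (j, b) E))"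
  proof -
    have "(\<Sum>b<k. q E j b * potential w (insert (j, b) E)) =
        objective E + w * (\<Sum>b<k. q E j b * collision (insert (j, b) E))"
      unfolding potential_def obj[symmetric]
      by (simp add: sum.distrib distrib_left sum_distrib_left mult_ac)
    then show ?thesis using mult_left_mono[OF coll w] by (simp add: potential_def distrib_left)
  qed
  have "\<exists>b<k. 0 < q E j b \<and> potential w E + w * g \<le> potential w (insert (j, b) E)"
  proof (rule ccontr)
    assume neg: "\<not> ?thesis"
    let ?t = "potential w E + w * g"
    \<comment> \<open>A label of positive weight makes the comparison of averages strict and keeps
      the new set a \<open>state\<close>.\<close>
    obtain b0 where b0: "b0 < k" "q E j b0 \<noteq> 0"
      using q_sum[OF j] by (metis lessThan_iff sum.neutral zero_neq_one)
    have "(\<Sum>b<k. q E j b * potential w (insert (j, b) E)) < (\<Sum>b<k. q E j b * ?t)"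
    proof (rule sum_strict_mono_ex1)
      show "\<forall>b\<in>{..<k}. q E j b * potential w (insert (j, b) E) \<le> q E j b * ?t"
      proof
        fix b assume "b \<in> {..<k}"
        then have "b < k" by simp
        show "q E j b * potential w (insert (j, b) E) \<le> q E j b * ?t"
        proof (cases "q E j b = 0")
          case False
          then have "0 < q E j b" using q_nonneg[OF j \<open>b < k\<close>] by simp
          then have "\<not> ?t \<le> potential w (insert (j, b) E)" using neg \<open>b < k\<close> by blast
          then show ?thesis using \<open>0 < q E j b\<close> by (intro mult_left_mono) auto
        qed simp
      qed
      have "0 < q E j b0" using b0 q_nonneg[OF j b0(1)] by simp
      then show "\<exists>b\<in>{..<k}. q E j b * potential w (insert (j, b) E) < q E j b * ?t"
        using neg b0 by (intro bexI[of _ b0]) (auto simp: not_le intro!: mult_strict_left_mono)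
    qed simp
    also have "(\<Sum>b<k. q E j b * ?t) = ?t" using q_sum[OF j] by (simp add: sum_distrib_right[symmetric])
    finally show False using avg by simp
  qed
  then obtain b where b: "b < k" "0 < q E j b" "potential w E + w * g \<le> potential w (insert (j, b) E)"
    by blast
  have "0 < p (insert (j, b) E)" using b(2) E' by (simp add: q_def zero_less_divide_iff)
  then have "state (insert (j, b) E)"
    using E' j b(1) room card_insert_le_Suc[of "(j, b)" E] by (auto simp: state_def)
  with b that show ?thesis by blast
qed

lemma potential_bounds:
  assumes "state E" "0 \<le> w"
  shows "objective E \<le> potential w E" "potential w E \<le> 1 + w" "potential w E \<le> objective E + w"
  using collision_bounds[OF assms(1)] objective_le_1[OF assms(1)] assms(2)
    mult_left_le[of "collision E" w] mult_nonneg_nonneg[of w "collision E"]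
  by (simp_all add: potential_def)

text \<open>By \<open>sum_M_le\<close> the gains of the vertices j average to at least
  \<open>mean_corr E\<close>, so one vertex attains that.\<close>

lemma conditioning_step_corr:
  assumes E: "state E" and room: "card E < r" and w: "0 \<le> w"
    and gain: "g \<le> mean_corr E"
  obtains j b where "j < n" "b < k" "state (insert (j, b) E)"
    "potential w E + w * g \<le> potential w (insert (j, b) E)"
proof -
  interpret pair_marginals n k d "q E" "J E" "u E" by (rule pair_marginals[OF E])
  let ?G = "\<lambda>j. \<Sum>i<n. \<Sum>a<k. \<Sum>b<k. C i a j b ^ 2 / q E j b"
  have "\<exists>j<n. g \<le> ?G j / n"
  proof (rule ccontr)
    assume "\<not> ?thesis"
    then have "?G j / n < g" if "j < n" for j using that by (auto simp: not_le)
    then have "(\<Sum>j<n. ?G j / n) < (\<Sum>j<n. g)" by (intro sum_strict_mono) (use n_pos in auto)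
    then have "(\<Sum>j<n. ?G j) / n < n * g" by (simp add: sum_divide_distrib)
    moreover have "n * g \<le> (\<Sum>i<n. \<Sum>j<n. M i j) / n"
      using gain n_pos by (simp add: mean_corr_def corr_def field_simps power2_eq_square)
    ultimately show False
      using divide_right_mono[OF sum_M_le, of n] by simp
  qed
  then obtain j where j: "j < n" "g \<le> ?G j / n" by blast
  show ?thesis
    by (rule conditioning_step[OF E room w j]) (rule that[OF j(1)])
qed

section \<open>Existence of a good seed and the choice of constants\<close>

lemma state_empty: "state {}"
  by (simp add: state_def p_empty)

text \<open>The program tries only lists of length exactly r. Repeating the head reaches that length
  without changing the conditioning event.\<close>

lemma pad_list:
  assumes "length ps \<le> r" "ps \<noteq> [] \<or> r = 0"
  obtains ps' where "length ps' = r" "set ps' = set ps"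
proof -
  have "set (ps @ replicate (r - length ps) (hd ps)) = set ps"
    using assms by (cases ps) auto
  moreover have "length (ps @ replicate (r - length ps) (hd ps)) = r" using assms by simp
  ultimately show ?thesis using that by blast
qed

text \<open>For positive r the empty list cannot be padded, so the walk starts by conditioning on
  vertex 0; as gains are nonnegative, the potential does not drop.\<close>

lemma initial_seed:
  assumes "0 \<le> w"
  obtains ps where "length ps \<le> 1" "length ps \<le> r" "ps \<noteq> [] \<or> r = 0" "state (set ps)"
    "potential w {} \<le> potential w (set ps)"
proof (cases "r = 0")
  case True
  then show ?thesis using that[of "[]"] state_empty by simp
next
  case False
  interpret pair_marginals n k d "q {}" "J {}" "u {}" by (rule pair_marginals[OF state_empty])
  obtain b where "b < k" "state (insert (0, b) {})" "potential w {} + w * 0 \<le>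
      potential w (insert (0, b) {})"
  proof (rule conditioning_step[OF state_empty _ assms n_pos])
    show "0 \<le> (\<Sum>i<n. \<Sum>a<k. \<Sum>b<k. C i a 0 b ^ 2 / q {} 0 b) / n"
      by (intro divide_nonneg_nonneg sum_nonneg) (auto intro: q_nonneg n_pos)
  qed (use False in auto)
  then show ?thesis using that[of "[(0, b)]"] False by simp
qed

text \<open>\<open>X\<close> is the threshold rank times \<open>mean_corr\<close>. Squaring the gap
  gives x - \<tau> \<le> (1 - \<tau>) * \<open>sqrt X\<close> with x = \<epsilon>^3, and the ratio
  (x - \<tau>) / (1 - \<tau>) is at least x / 2.\<close>

lemma gap_imp_correlation:
  fixes \<epsilon> m :: real
  assumes \<epsilon>: "0 < \<epsilon>" "\<epsilon> < 1" and X: "0 \<le> X"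
    and gap: "\<epsilon> - \<epsilon> * (1 - \<epsilon>) / 4 \<le>
        sqrt (\<epsilon> ^ 900 + (1 - \<epsilon> ^ 900) * sqrt X)"
  shows "\<epsilon> ^ 6 / 4 \<le> X"
proof -
  define x where "x = \<epsilon> ^ 3"
  have x: "0 < x" "x < 1" using \<epsilon> by (simp_all add: x_def power_less_one_iff)
  have \<tau>: "\<epsilon> ^ 900 = x ^ 300" by (simp add: x_def power_mult[symmetric])
  have \<tau>1: "x ^ 300 < 1" using x by (simp add: power_less_one_iff)
  have sq: "0 \<le> \<epsilon> - \<epsilon> * (1 - \<epsilon>) / 4" using \<epsilon> by (simp add: field_simps)
  have "(\<epsilon> - \<epsilon> * (1 - \<epsilon>) / 4) ^ 2 \<le> sqrt (x ^ 300 + (1 - x ^ 300) * sqrt X) ^ 2"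
    using gap sq unfolding \<tau> by (rule power_mono)
  also have "\<dots> = x ^ 300 + (1 - x ^ 300) * sqrt X"
    using x \<tau>1 X by (intro real_sqrt_pow2) (auto intro!: add_nonneg_nonneg mult_nonneg_nonneg)
  finally have 1: "(\<epsilon> - \<epsilon> * (1 - \<epsilon>) / 4) ^ 2 \<le>
      x ^ 300 + (1 - x ^ 300) * sqrt X" .
  \<comment> \<open>The subtracted slack has a factor 1 - \<epsilon>, as does \<epsilon>^2 -
    \<epsilon>^3, so the inequality persists up to \<epsilon> = 1.\<close>
  have "x \<le> (\<epsilon> - \<epsilon> * (1 - \<epsilon>) / 4) ^ 2"
  proof -
    have "(\<epsilon> - \<epsilon> * (1 - \<epsilon>) / 4) ^ 2 - x =
        \<epsilon> ^ 2 * ((1 - \<epsilon>) / 2 + ((1 - \<epsilon>) / 4) ^ 2)"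
      unfolding x_def by (simp add: field_simps power2_eq_square power3_eq_cube)
    also have "\<dots> \<ge> 0" using \<epsilon> by (intro mult_nonneg_nonneg add_nonneg_nonneg) auto
    finally show ?thesis by simp
  qed
  with 1 have 2: "x - x ^ 300 \<le> (1 - x ^ 300) * sqrt X" by simp
  \<comment> \<open>Equivalent to 2 x^300 \<le> x + x^301, which follows from a square once x^599 is
    replaced by the larger x^301.\<close>
  have "(1 - x ^ 300) * (x / 2) \<le> x - x ^ 300"
  proof -
    have "0 \<le> x * (1 - x ^ 299) ^ 2" using x by simp
    also have "\<dots> = x - 2 * x ^ 300 + x ^ 599"
      by (simp add: power2_eq_square algebra_simps power_add[symmetric] flip: power_Suc)
    also have "x ^ 599 \<le> x ^ 301" using x by (intro power_decreasing) auto
    finally have "2 * x ^ 300 \<le> x + x ^ 301" by simp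
    moreover have "x ^ 301 = x ^ 300 * x" by (simp flip: power_Suc2)
    ultimately show ?thesis by (simp add: algebra_simps)
  qed
  with 2 have "(1 - x ^ 300) * (x / 2) \<le> (1 - x ^ 300) * sqrt X" by linarith
  then have "x / 2 \<le> sqrt X" using \<tau>1 by (simp add: mult_le_cancel_left)
  then have "(x / 2) ^ 2 \<le> X" using x X
      by (metis less_eq_real_def power_mono real_sqrt_pow2 zero_le_divide_iff zero_le_numeral)
  moreover have "(x / 2) ^ 2 = \<epsilon> ^ 6 / 4" by (simp add: x_def power_divide power_mult[symmetric])
  ultimately show ?thesis by simp
qed

text \<open>The exponent 893 is what remains of 900 after \<epsilon>^7 is spent on the number of
  steps. For \<epsilon> at most 41/42, Bernoulli gives (42/41)^893 \<ge> 1 + 893/41, which exceeds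
  21.\<close>

lemma large_alphabet_or_small_eps:
  fixes \<epsilon> :: real
  assumes "0 < \<epsilon>" "\<epsilon> < 1" "1 \<le> real k" "21 \<le> real k \<or> \<epsilon> \<le> 41 / 42"
  shows "21 * \<epsilon> ^ 893 \<le> real k"
proof (cases "21 \<le> real k")
  case True
  moreover have "\<epsilon> ^ 893 \<le> 1" using assms by (simp add: power_le_one)
  ultimately show ?thesis by linarith
next
  case False
  then have e: "\<epsilon> \<le> 41 / 42" using assms by simp
  have "1 + real 893 * (1 / 41) \<le> (1 + 1 / 41 :: real) ^ 893" by (rule Bernoulli_inequality) simp
  then have "21 \<le> (42 / 41 :: real) ^ 893" by simp
  then have "21 * (41 / 42 :: real) ^ 893 \<le> (42 / 41) ^ 893 * (41 / 42) ^ 893"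
    by (intro mult_right_mono) auto
  also have "\<dots> = ((42 / 41) * (41 / 42)) ^ 893" by (rule power_mult_distrib[symmetric])
  finally have "21 * (41 / 42 :: real) ^ 893 \<le> 1" by simp
  moreover have "\<epsilon> ^ 893 \<le> (41 / 42) ^ 893" using e assms by (intro power_mono) auto
  ultimately show ?thesis using assms(3) by linarith
qed

text \<open>The exponent 900 serves two purposes. With \<open>\<tau> = x ^ 300\<close> and \<open>x = \<epsilon> ^ 3\<close> the ratio
  \<open>(x - \<tau>) / (1 - \<tau>)\<close> is at least \<open>x / 2\<close>, also for \<open>\<epsilon>\<close> close to 1, where constants cannot be
  absorbed into powers of \<open>\<epsilon>\<close>. And with \<open>m\<close> the threshold rank it makes
  \<open>r\<close> exceed the \<open>20 m / \<epsilon> ^ 7\<close> conditioning steps unless both \<open>k < 21\<close> and \<open>\<epsilon> > 41 / 42\<close>, in which case \<open>v ^ 2 / k > v - \<epsilon>\<close> suffices.\<close>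

theorem good_seed_exists:
  fixes \<epsilon> v :: real
  assumes \<epsilon>: "0 < \<epsilon>" and v: "v \<le> objective {}"
    and rank: "real (threshold_rank n I (\<epsilon> ^ 900)) \<le> \<epsilon> ^ 900 * real r / real k"
  shows "\<exists>ps. length ps = r \<and> state (set ps) \<and> v - \<epsilon> < rounded (set ps)"
proof -
  have v1: "v \<le> 1" using v objective_le_1[OF state_empty] by simp
  have k1: "1 \<le> real k" using k_pos by simp
  have initial: "\<exists>ps. length ps = r \<and> state (set ps) \<and> v \<le> objective (set ps)"
  proof -
    obtain ps where ps: "length ps \<le> r" "ps \<noteq> [] \<or> r = 0" "state (set ps)"
      "potential 0 {} \<le> potential 0 (set ps)" by (rule initial_seed[of 0]) auto
    obtain ps' where "length ps' = r" "set ps' = set ps" by (rule pad_list[OF ps(1,2)])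
    then show ?thesis using ps(3,4) v by (intro exI[of _ ps']) (auto simp: potential_def)
  qed
  \<comment> \<open>The first case needs only a nonnegative rounded value, the second uses
    \<open>rounded_ge_square\<close>, and the third is the correlation argument. Since v is at most
    1, an \<epsilon> above 1 falls under the first.\<close>
  consider "v < \<epsilon>" | "\<epsilon> \<le> v" "\<epsilon> = 1 \<or> real k < 21 \<and>
      41 / 42 < \<epsilon>"
    | "\<epsilon> \<le> v" "\<epsilon> < 1" "21 \<le> real k \<or> \<epsilon> \<le> 41 / 42"
    using v1 by linarith
  then show ?thesis
  proof cases
    case 1
    from initial obtain ps where "length ps = r" "state (set ps)" by blast
    moreover from this have "v - \<epsilon> < rounded (set ps)" using rounded_nonneg[of "set ps"] 1 by linarith
    ultimately show ?thesis by blast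
  next
    case 2
    from initial obtain ps where ps: "length ps = r" "state (set ps)" "v \<le> objective (set ps)" by blast
    have "v - \<epsilon> < v ^ 2 / k"
    proof (cases "\<epsilon> = 1")
      case True
      then have "v = 1" using 2 v1 by simp
      then show ?thesis using True k_pos by simp
    next
      case False
      then have "41 / 42 < \<epsilon>" "real k < 21" using 2 by auto
      then have "41 / 42 < v" using 2 by simp
      then have "(41 / 42) ^ 2 \<le> v ^ 2" by (intro power_mono) auto
      \<comment> \<open>The thresholds 21 and 41/42 fit together here: the product is below 1/2,
        while v^2 is at least (41/42)^2.\<close>
      moreover have "(v - \<epsilon>) * k < 1 / 42 * 21"
        using \<open>41 / 42 < \<epsilon>\<close> \<open>real k < 21\<close> v1 2(1) k1
            by (intro mult_strict_mono') auto
      ultimately have "(v - \<epsilon>) * k < v ^ 2" by (simp add: power2_eq_square)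
      then show ?thesis using k_pos by (simp add: less_divide_eq)
    qed
    also have "v ^ 2 / k \<le> objective (set ps) ^ 2 / k"
      using ps(3) 2(1) \<epsilon> by (intro divide_right_mono power_mono) auto
    also have "\<dots> \<le> rounded (set ps)" by (rule rounded_ge_square[OF ps(2)])
    finally show ?thesis using ps by blast
  next
    case 3
    define m where "m = real (threshold_rank n I (\<epsilon> ^ 900))"
    \<comment> \<open>Chosen so that \<epsilon> * (1 - \<epsilon> + w) = w * (4 + \<epsilon>): the
      factor 1 - \<epsilon> cancels when the total rise of the potential is divided by the rise per
      step.\<close>
    define w where "w = \<epsilon> * (1 - \<epsilon>) / 4"
    have w0: "0 < w" unfolding w_def using \<epsilon> 3(2) by (intro divide_pos_pos mult_pos_pos) auto
    \<comment> \<open>The walk refutes 20 m; the further m, at least 1 and hence above \<epsilon>^7,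
      pays for the round spent on the initial vertex.\<close>
    have large: "21 * m \<le> \<epsilon> ^ 7 * r"
    proof -
      have "m * (21 * \<epsilon> ^ 893) \<le> m * k"
        using large_alphabet_or_small_eps[OF \<epsilon> 3(2) k1 3(3)]
            by (intro mult_left_mono) (auto simp: m_def)
      also have "m * k \<le> \<epsilon> ^ 900 * r" using rank k_pos by (simp add: m_def le_divide_eq)
      also have "\<epsilon> ^ 900 = \<epsilon> ^ 893 * \<epsilon> ^ 7" by (simp flip: power_add)
      finally have "\<epsilon> ^ 893 * (21 * m) \<le> \<epsilon> ^ 893 * (\<epsilon> ^ 7 * r)"
          by (simp add: mult_ac)
      then show ?thesis by (rule mult_left_le_imp_le) (use \<epsilon> in simp)
    qed
    show ?thesis
    proof (rule ccontr)
      assume none: "\<not> ?thesis"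
      \<comment> \<open>If the potential has not dropped, the objective has lost at most w. With no
        good seed the rounding gap is then at least \<epsilon> - w, so the correlation is
        large.\<close>
      have bad: "\<epsilon> ^ 6 / 4 \<le> m * mean_corr (set ps)"
        if ps: "length ps \<le> r" "ps \<noteq> [] \<or> r = 0" "state (set ps)" "potential w {} \<le>
            potential w (set ps)" for ps
      proof (rule gap_imp_correlation[OF \<epsilon> 3(2)])
        interpret pair_marginals n k d "q (set ps)" "J (set ps)" "u (set ps)" by (rule pair_marginals[OF ps(3)])
        show "0 \<le> m * mean_corr (set ps)"
          unfolding mean_corr_def by (intro mult_nonneg_nonneg divide_nonneg_nonneg sum_nonneg) (auto simp:
              m_def mean_corr_def corr_def M_nonneg)
        obtain ps' where ps': "length ps' = r" "set ps' = set ps" by (rule pad_list[OF ps(1,2)])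
        have "\<not> v - \<epsilon> < rounded (set ps')" using none ps(3) ps' by metis
        then have "rounded (set ps) \<le> v - \<epsilon>" by (simp add: ps')
        moreover have "v - w \<le> objective (set ps)"
          using ps(4) v potential_bounds(1)[OF state_empty less_imp_le[OF w0]]
            potential_bounds(3)[OF ps(3) less_imp_le[OF w0]] by linarith
        ultimately have "\<epsilon> - w \<le> objective (set ps) - rounded (set ps)" by simp
        also have "\<dots> \<le> sqrt (\<epsilon> ^ 900 + (1 - \<epsilon> ^ 900) *
            sqrt (m * mean_corr (set ps)))"
          unfolding m_def by (rule rounding_gap[OF ps(3)]) (use \<epsilon> 3(2)
              in \<open>auto simp: power_less_one_iff\<close>)
        finally show "\<epsilon> - \<epsilon> * (1 - \<epsilon>) / 4 \<le>
            sqrt (\<epsilon> ^ 900 + (1 - \<epsilon> ^ 900) *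
            sqrt (m * mean_corr (set ps)))" by (simp add: w_def)
      qed
      obtain ps0 where ps0: "length ps0 \<le> 1" "length ps0 \<le> r" "ps0 \<noteq> [] \<or> r =
          0" "state (set ps0)"
        "potential w {} \<le> potential w (set ps0)" using w0 by (rule initial_seed[OF less_imp_le])
      have m1: "1 \<le> m"
      proof (rule ccontr)
        assume "\<not> 1 \<le> m"
        then have "m = 0" by (simp add: m_def)
        then show False using bad[OF ps0(2-5)] \<epsilon> by simp
      qed
      have r1: "1 \<le> r"
      proof (rule ccontr)
        assume "\<not> 1 \<le> r"
        then have "r = 0" by simp
        then show False using large m1 by simp
      qed
      define g where "g = \<epsilon> ^ 6 / (4 * m)"
      \<comment> \<open>The initial pair and one more pair per step account for t + 1, which must
        stay within r. Every seed on the way satisfies \<open>bad\<close>, so each step gains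
        \<open>w * g\<close>.\<close>
      have walk: "\<exists>ps. length ps \<le> t + 1 \<and> ps \<noteq> [] \<and> state (set ps) \<and>
          potential w {} + t * (w * g) \<le> potential w (set ps)"
        if "t + 1 \<le> r" for t
        using that
      proof (induction t)
        case 0
        then show ?case using ps0 by (intro exI[of _ ps0]) auto
      next
        case (Suc t)
        then obtain ps where ps: "length ps \<le> t + 1" "ps \<noteq> []" "state (set ps)"
          "potential w {} + t * (w * g) \<le> potential w (set ps)" by auto
        have "0 \<le> real t * (w * g)" using w0 m1 \<epsilon> by (auto simp: g_def)
        then have "\<epsilon> ^ 6 / 4 \<le> m * mean_corr (set ps)"
          using ps Suc.prems by (intro bad) auto
        then have g: "g \<le> mean_corr (set ps)"
          using m1 by (simp add: g_def divide_le_eq mult_ac)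
        have room: "card (set ps) < r" using card_length[of ps] ps(1) Suc.prems by linarith
        obtain j b where "state (insert (j, b) (set ps))"
          "potential w (set ps) + w * g \<le> potential w (insert (j, b) (set ps))"
          by (rule conditioning_step_corr[OF ps(3) room less_imp_le[OF w0] g])
        then show ?case using ps by (intro exI[of _ "(j, b) # ps"]) (auto simp: algebra_simps)
      qed
      obtain ps where ps: "state (set ps)" "potential w {} + (r - 1) * (w * g) \<le> potential w (set ps)"
        using walk[of "r - 1"] r1 by auto
      \<comment> \<open>The potential starts at v or more, hence at \<epsilon> or more, and never
        exceeds 1 + w.\<close>
      have "\<epsilon> + (r - 1) * (w * g) \<le> 1 + w"
        using ps(2) potential_bounds(1)[OF state_empty less_imp_le[OF w0]]
          potential_bounds(2)[OF ps(1) less_imp_le[OF w0]] v 3(1) by linarith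
      then have "(real r - 1) * (w * \<epsilon> ^ 6) \<le> (1 - \<epsilon> + w) * (4 * m)"
        using m1 r1 by (simp add: g_def of_nat_diff field_simps)
      then have "\<epsilon> * ((real r - 1) * (w * \<epsilon> ^ 6)) \<le>
          \<epsilon> * ((1 - \<epsilon> + w) * (4 * m))"
        using \<epsilon> by (intro mult_left_mono) auto
      also have "\<epsilon> * ((1 - \<epsilon> + w) * (4 * m)) = w * ((4 + \<epsilon>) * (4 * m))"
        by (simp add: w_def field_simps)
      also have "\<epsilon> * ((real r - 1) * (w * \<epsilon> ^ 6)) = w * ((real r - 1) * \<epsilon> ^ 7)"
        by (simp add: power_numeral_reduce mult_ac)
      finally have "(real r - 1) * \<epsilon> ^ 7 \<le> (4 + \<epsilon>) * (4 * m)"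
        using w0 by (rule mult_left_le_imp_le)
      also have "\<dots> \<le> 5 * (4 * m)" using 3(2) m1 by (intro mult_right_mono) auto
      finally have "\<epsilon> ^ 7 * r \<le> 20 * m + \<epsilon> ^ 7" by (simp add: algebra_simps)
      moreover have "\<epsilon> ^ 7 < 1" using \<epsilon> 3(2) by (simp add: power_less_one_iff)
      ultimately show False using large m1 by linarith
    qed
  qed
qed

end

section \<open>The relaxation as a pseudo-distribution\<close>

definition event_prob :: "lasserre \<Rightarrow> (nat \<times> nat) set \<Rightarrow> real" where
  "event_prob \<sigma> E = measure_pmf.prob (local_dist \<sigma> (fst ` E)) {x. \<forall>(i, a)\<in>E. x i = a}"

definition labelling :: "(nat \<times> nat) set \<Rightarrow> nat \<Rightarrow> nat" where
  "labelling E = restrict (\<lambda>i. THE a. (i, a) \<in> E) (fst ` E)"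

text \<open>A contradictory set describes no partial assignment and gets the zero vector, in
  accordance with its probability 0.\<close>

definition event_vec :: "lasserre \<Rightarrow> (nat \<times> nat) set \<Rightarrow> nat \<Rightarrow> real"
    where
  "event_vec \<sigma> E l = (if single_valued E then lvec \<sigma> (fst ` E) (labelling E) l else 0)"

lemma labelling_eq: "single_valued E \<Longrightarrow> (i, a) \<in> E \<Longrightarrow> labelling E i = a"
  unfolding labelling_def single_valued_def by (auto intro!: the_equality simp: image_iff)

lemma labelling_assignment:
  assumes "E \<subseteq> {..<n} \<times> {..<k}" "single_valued E"
  shows "labelling E \<in> assignments (fst ` E) k"
  unfolding assignments_def
proof (rule PiE_I)
  fix i assume "i \<in> fst ` E"
  then obtain a where "(i, a) \<in> E" by auto
  then show "labelling E i \<in> {..<k}" using assms by (auto simp: labelling_eq)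
qed (simp add: labelling_def)

lemma restrict_eq_labelling:
  assumes "single_valued E"
  shows "restrict x (fst ` E) = labelling E \<longleftrightarrow> (\<forall>(i, a)\<in>E. x i = a)"
proof
  assume eq: "restrict x (fst ` E) = labelling E"
  show "\<forall>(i, a)\<in>E. x i = a"
  proof clarify
    fix i a assume ia: "(i, a) \<in> E"
    then have "i \<in> fst ` E" by force
    then show "x i = a" using fun_cong[OF eq, of i] labelling_eq[OF assms ia] by simp
  qed
next
  assume all: "\<forall>(i, a)\<in>E. x i = a"
  show "restrict x (fst ` E) = labelling E"
  proof
    fix i
    show "restrict x (fst ` E) i = labelling E i"
    proof (cases "i \<in> fst ` E")
      case True
      then obtain a where "(i, a) \<in> E" by auto
      then show ?thesis using True all labelling_eq[OF assms] by auto
    qed (simp add: labelling_def)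
  qed
qed

lemma conflicting_event_empty:
  assumes "(i, a) \<in> E" "(i, b) \<in> E" "a \<noteq> b"
  shows "{x. \<forall>(i, a)\<in>E. x i = a} = {}"
proof (rule equals0I)
  fix x assume "x \<in> {x. \<forall>(i, a)\<in>E. x i = a}"
  then have all: "\<forall>(i, a)\<in>E. x i = a" by simp
  show False using bspec[OF all assms(1)] bspec[OF all assms(2)] assms(3) by simp
qed

lemma fst_image_bounds:
  fixes n k :: nat
  assumes "E \<subseteq> {..<n} \<times> {..<k}"
  shows "fst ` E \<subseteq> {..<n}" "finite E" "card (fst ` E) \<le> card E"
proof -
  show "fst ` E \<subseteq> {..<n}" using assms by auto
  show "finite E" using finite_subset[OF assms] by simp
  then show "card (fst ` E) \<le> card E" by (rule card_image_le)
qed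

text \<open>Consistency of the local distributions lets an event be evaluated on any larger
  admissible vertex set, in particular on one shared by several events.\<close>

lemma event_prob_superset:
  assumes f: "lasserre_feasible n k r \<sigma>"
    and T: "fst ` E \<subseteq> T" "T \<subseteq> {..<n}" "card T \<le> r + 2"
  shows "event_prob \<sigma> E = measure_pmf.prob (local_dist \<sigma> T) {x. \<forall>(i, a)\<in>E. x i = a}"
proof -
  have "local_dist \<sigma> (fst ` E) = map_pmf (\<lambda>x. restrict x (fst ` E)) (local_dist \<sigma> T)"
    using f T unfolding lasserre_feasible_def by metis
  moreover have "(\<forall>(i, a)\<in>E. restrict x (fst ` E) i =
      a) \<longleftrightarrow> (\<forall>(i, a)\<in>E. x i = a)" for x :: "nat \<Rightarrow> nat"
  proof (rule ball_cong[OF refl])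
    fix e assume "e \<in> E"
    then have "fst e \<in> fst ` E" by simp
    then show "(case e of (i, a) \<Rightarrow> restrict x (fst ` E) i =
        a) \<longleftrightarrow> (case e of (i, a) \<Rightarrow> x i = a)"
      by (simp add: split_def)
  qed
  then have "(\<lambda>x. restrict x (fst ` E)) -` {x. \<forall>(i, a)\<in>E. x i = a} =
      {x. \<forall>(i, a)\<in>E. x i = a}"
    by (simp only: vimage_def mem_Collect_eq)
  ultimately show ?thesis unfolding event_prob_def by simp
qed

lemma prob_cong_support:
  "(\<And>x. x \<in> set_pmf D \<Longrightarrow> x \<in> A \<longleftrightarrow> x \<in> B) \<Longrightarrow>
      measure_pmf.prob D A = measure_pmf.prob D B"
  by (rule measure_pmf.finite_measure_eq_AE) (auto simp: AE_measure_pmf_iff)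

lemma sum_prob_labels:
  assumes "\<And>x. x \<in> set_pmf D \<Longrightarrow> f x < (k::nat)"
  shows "(\<Sum>b<k. measure_pmf.prob D {x. f x = b \<and> P x b}) = measure_pmf.prob D {x. P x (f x)}"
proof -
  have "(\<Sum>b<k. measure_pmf.prob D {x. f x = b \<and> P x b}) =
      measure_pmf.prob D (\<Union>b<k. {x. f x = b \<and> P x b})"
    by (rule measure_pmf.finite_measure_finite_Union[symmetric]) (auto simp: disjoint_family_on_def)
  also have "\<dots> = measure_pmf.prob D {x. P x (f x)}"
    by (rule prob_cong_support) (use assms in auto)
  finally show ?thesis .
qed

lemma support_assignments:
  assumes "lasserre_feasible n k r \<sigma>" "T \<subseteq> {..<n}" "card T \<le> r + 2"
  shows "set_pmf (local_dist \<sigma> T) \<subseteq> assignments T k"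
  using assms(1)[unfolded lasserre_feasible_def, THEN conjunct1] assms(2,3) by simp

lemma support_label:
  assumes "lasserre_feasible n k r \<sigma>" "T \<subseteq> {..<n}" "card T \<le>
      r + 2" "x \<in> set_pmf (local_dist \<sigma> T)" "j \<in> T"
  shows "x j < k"
  using support_assignments[OF assms(1-3)] assms(4,5) unfolding assignments_def by auto

text \<open>A set of pairs mentions at most as many vertices as it has elements, so the bound
  \<open>r + 2\<close> on vertices covers every set of at most \<open>r + 2\<close> pairs.\<close>

lemma lasserre_relaxation:
  assumes ug: "ug_instance n k I" "regular_instance n I" and f: "lasserre_feasible n k r \<sigma>"
  shows "ug_relaxation n k I r (ldim \<sigma>) (event_prob \<sigma>) (event_vec \<sigma>)"
proof
  show "ug_instance n k I" "regular_instance n I" by fact+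
  show "event_prob \<sigma> {} = 1" by (simp add: event_prob_def)
  show "0 \<le> event_prob \<sigma> E" for E by (simp add: event_prob_def)
  show "(\<Sum>b<k. event_prob \<sigma> (insert (j, b) E)) = event_prob \<sigma> E"
    if E: "E \<subseteq> {..<n} \<times> {..<k}" "card E \<le> r + 1" and j: "j < n" for E j
  proof -
    let ?T = "insert j (fst ` E)"
    have T: "?T \<subseteq> {..<n}" "card ?T \<le> r + 2"
      using fst_image_bounds[OF E(1)] E(2) j card_insert_le_m1[of "r + 2" "fst ` E" j] by auto
    have "(\<Sum>b<k. event_prob \<sigma> (insert (j, b) E)) =
        (\<Sum>b<k. measure_pmf.prob (local_dist \<sigma> ?T) {x. x j = b \<and> (\<forall>(i, a)\<in>E. x i =
            a)})"
      by (simp add: event_prob_def)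
    also have "\<dots> = measure_pmf.prob (local_dist \<sigma> ?T) {x. \<forall>(i, a)\<in>E. x i = a}"
      by (rule sum_prob_labels) (use support_label[OF f T] in auto)
    also have "\<dots> = event_prob \<sigma> E" by (rule event_prob_superset[OF f _ T, symmetric]) auto
    finally show ?thesis .
  qed
  show "event_prob \<sigma> E = 0" if "(i, a) \<in> E" "(i, b) \<in> E" "a \<noteq> b" for E i a b
    unfolding event_prob_def conflicting_event_empty[OF that] by simp
  show "event_prob \<sigma> (E \<union> F) =
      (\<Sum>l<ldim \<sigma>. event_vec \<sigma> E l * event_vec \<sigma> F l)"
    if E: "E \<subseteq> {..<n} \<times> {..<k}" and F: "F \<subseteq> {..<n} \<times> {..<k}" and c: "card (E
        \<union> F) \<le> r + 2" for E F
  proof (cases "single_valued E \<and> single_valued F")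
    case True
    have "card (fst ` E \<union> fst ` F) \<le> r + 2"
      using fst_image_bounds(3)[of "E \<union> F" n k] E F c by (simp add: image_Un)
    then have "(\<Sum>l<ldim \<sigma>. event_vec \<sigma> E l * event_vec \<sigma> F l) =
        measure_pmf.prob (local_dist \<sigma> (fst ` E \<union> fst ` F))
          {x. restrict x (fst ` E) = labelling E \<and> restrict x (fst ` F) = labelling F}"
      using f True fst_image_bounds(1)[OF E] fst_image_bounds(1)[OF F]
        labelling_assignment[OF E] labelling_assignment[OF F]
      unfolding lasserre_feasible_def by (simp add: event_vec_def)
    also have "\<dots> = event_prob \<sigma> (E \<union> F)"
      using True by (simp add: restrict_eq_labelling event_prob_def image_Un ball_Un)
    finally show ?thesis ..
  next
    case False
    then obtain i a b where "(i, a) \<in> E \<union> F" "(i, b) \<in> E \<union> F" "a \<noteq> b"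
      unfolding single_valued_def by blast
    then have "event_prob \<sigma> (E \<union> F) = 0"
      unfolding event_prob_def by (subst conflicting_event_empty) auto
    then show ?thesis using False by (auto simp: event_vec_def)
  qed
qed

text \<open>Agreement with \<alpha> on \<open>T\<close> is a larger set of functions than the
  singleton, but the support consists of assignments undefined outside \<open>T\<close>, on which
  the two coincide.\<close>

lemma pmf_local_dist:
  assumes f: "lasserre_feasible n k r \<sigma>" and T: "T \<subseteq> {..<n}" "card T \<le>
      r + 2" and \<alpha>: "\<alpha> \<in> assignments T k"
  shows "pmf (local_dist \<sigma> T) \<alpha> = event_prob \<sigma> ((\<lambda>i. (i, \<alpha> i)) ` T)"
proof -
  have "fst ` (\<lambda>i. (i, \<alpha> i)) ` T = T" by (auto simp: image_image)
  moreover have "measure_pmf.prob (local_dist \<sigma> T) {\<alpha>} =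
      measure_pmf.prob (local_dist \<sigma> T) {x. \<forall>(i, a)\<in>(\<lambda>i. (i, \<alpha> i)) ` T. x i =
          a}"
  proof (rule prob_cong_support)
    fix x assume "x \<in> set_pmf (local_dist \<sigma> T)"
    then have "x \<in> assignments T k" using support_assignments[OF f T] by blast
    then have ext: "x = \<alpha>" if "\<And>i. i \<in> T \<Longrightarrow> x i = \<alpha> i"
      using \<alpha> that unfolding assignments_def by (rule PiE_ext)
    show "x \<in> {\<alpha>} \<longleftrightarrow> x \<in> {x. \<forall>(i, a)\<in>(\<lambda>i. (i, \<alpha>
        i)) ` T. x i = a}"
    proof
      assume "x \<in> {x. \<forall>(i, a)\<in>(\<lambda>i. (i, \<alpha> i)) ` T. x i = a}"
      then have "x i = \<alpha> i" if "i \<in> T" for i using that by auto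
      then have "x = \<alpha>" by (rule ext)
      then show "x \<in> {\<alpha>}" by simp
    qed auto
  qed
  ultimately show ?thesis by (simp add: event_prob_def measure_pmf_single)
qed

lemma expectation_eq_sum:
  fixes g :: "'a \<Rightarrow> real"
  shows "finite (set_pmf I) \<Longrightarrow> measure_pmf.expectation I g =
      (\<Sum>c\<in>set_pmf I. pmf I c * g c)"
  by (subst integral_measure_pmf_real[of "set_pmf I"]) (auto simp: mult.commute)

lemma lasserre_objective_eq:
  assumes ug: "ug_instance n k I" "regular_instance n I" and f: "lasserre_feasible n k r \<sigma>"
  shows "lasserre_objective I \<sigma> = ug_relaxation.objective k I (event_prob \<sigma>) {}"
proof -
  interpret ug_relaxation n k I r "ldim \<sigma>" "event_prob \<sigma>" "event_vec \<sigma>"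
    by (rule lasserre_relaxation[OF assms])
  show ?thesis
    unfolding lasserre_objective_def objective_def expectation_eq_sum[OF fin]
  proof (rule sum.cong[OF refl])
    fix c assume c: "c \<in> set_pmf I"
    obtain i j \<pi> where ijp: "c = (i, j, \<pi>)" by (cases c)
    note i = inst[OF c[unfolded ijp]]
    have T: "{i, j} \<subseteq> {..<n}" "card {i, j} \<le> r + 2" using i by (auto simp: card_insert_if)
    have "constraint_val {} c = (\<Sum>a<k. measure_pmf.prob (local_dist \<sigma> {i, j}) {x. x i = a \<and>
        x j = \<pi> a})"
      unfolding ijp constraint_val_def prod.case J_def p_empty by (simp add: event_prob_def)
    also have "\<dots> = measure_pmf.prob (local_dist \<sigma> {i, j}) {x. x j = \<pi> (x i)}"
      by (rule sum_prob_labels) (use support_label[OF f T] in auto)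
    finally show "pmf I c * (case c of (i, j, \<pi>) \<Rightarrow> measure_pmf.prob (local_dist \<sigma> {i,
        j}) {x. x j = \<pi> (x i)}) =
        pmf I c * constraint_val {} c" by (simp add: ijp)
  qed
qed

text \<open>A point mass with one-dimensional vectors. It shows that the value of an optimal
  relaxation solution is at least that of the best assignment.\<close>

definition integral_solution :: "(nat \<Rightarrow> nat) \<Rightarrow> lasserre" where
  "integral_solution x = \<lparr>local_dist = (\<lambda>T. return_pmf (restrict x T)), ldim = 1,
     lvec = (\<lambda>S \<alpha> l. if restrict x S = \<alpha> then 1 else 0)\<rparr>"

lemma integral_solution_feasible:
  assumes "x \<in> assignments {..<n} k"
  shows "lasserre_feasible n k r (integral_solution x)"
proof -
  have "restrict x T \<in> assignments T k" if "T \<subseteq> {..<n}" for T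
    using assms that unfolding assignments_def by (auto simp: PiE_iff)
  moreover have "restrict (restrict x T) S = restrict x S" if "S \<subseteq> T" for S T
    using that by (simp add: Int_absorb1)
  ultimately show ?thesis
    unfolding lasserre_feasible_def integral_solution_def
    by (auto simp: measure_return_pmf)
qed

lemma ug_val_eq_sum:
  assumes "finite (set_pmf I)"
  shows "ug_val I x = (\<Sum>(i, j, \<pi>)\<in>set_pmf I. pmf I (i, j, \<pi>) * (if x j =
      \<pi> (x i) then 1 else 0))"
  unfolding ug_val_def prob_eq_sum[OF assms] by (simp add: split_def)

lemma integral_solution_objective:
  assumes "ug_instance n k I"
  shows "lasserre_objective I (integral_solution x) = ug_val I x"
  unfolding lasserre_objective_def expectation_eq_sum[OF finite_set_pmf_ug[OF assms]]
    ug_val_eq_sum[OF finite_set_pmf_ug[OF assms]]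
  by (intro sum.cong refl) (auto simp: integral_solution_def measure_return_pmf indicator_def)

lemma ug_opt_le_lasserre:
  assumes ug: "ug_instance n k I" and opt: "lasserre_optimal n k r I \<sigma>"
  shows "ug_opt n k I \<le> lasserre_objective I \<sigma>"
proof -
  have "finite (assignments {..<n} k)" unfolding assignments_def by (intro finite_PiE) auto
  moreover have "assignments {..<n} k \<noteq> {}"
    using ug unfolding assignments_def ug_instance_def by (auto simp: PiE_eq_empty_iff)
  ultimately have "ug_opt n k I \<in> ug_val I ` assignments {..<n} k"
    unfolding ug_opt_def by (intro Max_in) auto
  then obtain x where x: "x \<in> assignments {..<n} k" "ug_opt n k I = ug_val I x" by auto
  then show ?thesis
    using opt integral_solution_feasible[OF x(1)] integral_solution_objective[OF ug]
    unfolding lasserre_optimal_def by metis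
qed

section \<open>Running time of programs\<close>

text \<open>An exponent for the running time: with every loop count at most Z, a program takes at
  most \<open>Z ^ depth\<close> steps. It depends on the program text alone, so for a fixed program
  it is a constant.\<close>

primrec depth :: "prog \<Rightarrow> nat" where
  "depth Skip = 0"
| "depth (NSet e f) = 0"
| "depth (RSet e f) = 0"
| "depth (Seq P Q) = Suc (max (depth P) (depth Q))"
| "depth (Cond b P Q) = Suc (max (depth P) (depth Q))"
| "depth (While b P) = Suc (Suc (depth P))"

definition runs :: "ug_input \<Rightarrow> nat \<Rightarrow> prog \<Rightarrow> memory \<Rightarrow> (memory
    \<Rightarrow> bool) \<Rightarrow> bool" where
  "runs In Z P s Q \<longleftrightarrow> (\<exists>t s'. exec In P s t s' \<and> t \<le> Z ^ depth P \<and>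
      Q s')"

definition nset :: "memory \<Rightarrow> nat \<Rightarrow> nat \<Rightarrow> memory" where
  "nset s a v = s\<lparr>nmem := (nmem s)(a := v)\<rparr>"

definition rset :: "memory \<Rightarrow> nat \<Rightarrow> real \<Rightarrow> memory" where
  "rset s a v = s\<lparr>rmem := (rmem s)(a := v)\<rparr>"

lemma nset_simps [simp]:
  "nmem (nset s a v) = (nmem s)(a := v)" "rmem (nset s a v) = rmem s"
  "nmem (rset s a w) = nmem s" "rmem (rset s a w) = (rmem s)(a := w)"
  by (simp_all add: nset_def rset_def)

lemma runs_mono: "runs In Z P s Q \<Longrightarrow> (\<And>s'. Q s' \<Longrightarrow> R s') \<Longrightarrow>
    runs In Z P s R"
  unfolding runs_def by blast

lemma runs_NSet: "Q (nset s (neval In s e) (neval In s f)) \<Longrightarrow> runs In Z (NSet e f) s Q"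
  unfolding runs_def nset_def by (intro exI conjI, rule exec.NSet) simp_all

lemma runs_RSet: "Q (rset s (neval In s e) (reval In s f)) \<Longrightarrow> runs In Z (RSet e f) s Q"
  unfolding runs_def rset_def by (intro exI conjI, rule exec.RSet) simp_all

lemma runs_Skip: "Q s \<Longrightarrow> runs In Z Skip s Q"
  unfolding runs_def by (intro exI conjI, rule exec.Skip) simp_all

lemma pow_Suc_ge:
  assumes "4 \<le> (Z::nat)" "t \<le> Z ^ a" "u \<le> Z ^ b"
  shows "t + u \<le> Z ^ Suc (max a b)"
proof -
  have "Z ^ a \<le> Z ^ max a b" "Z ^ b \<le> Z ^ max a b" using assms(1) by (auto intro!: power_increasing)
  then have "t + u \<le> 2 * Z ^ max a b" using assms by linarith
  also have "\<dots> \<le> Z ^ Suc (max a b)" using assms(1) by simp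
  finally show ?thesis .
qed

lemma runs_Seq:
  assumes Z: "4 \<le> Z" and P: "runs In Z P s R" and Q: "\<And>s'. R s' \<Longrightarrow> runs In Z Q s' S"
  shows "runs In Z (Seq P Q) s S"
proof -
  obtain t s' where 1: "exec In P s t s'" "t \<le> Z ^ depth P" "R s'" using P unfolding runs_def by blast
  obtain u s'' where 2: "exec In Q s' u s''" "u \<le> Z ^ depth Q" "S s''"
    using Q[OF 1(3)] unfolding runs_def by blast
  show ?thesis
    unfolding runs_def depth.simps
    using exec.Seq[OF 1(1) 2(1)] pow_Suc_ge[OF Z 1(2) 2(2)] 2(3) by blast
qed

lemma runs_Seq_NSet:
  assumes "4 \<le> Z" "runs In Z Q (nset s (neval In s e) (neval In s f)) S"
  shows "runs In Z (Seq (NSet e f) Q) s S"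
  by (rule runs_Seq[OF assms(1), of _ "NSet e f" s "\<lambda>s'. s' = nset s (neval In s e) (neval In s f)"])
    (use assms in \<open>auto intro: runs_NSet\<close>)

lemma runs_Seq_RSet:
  assumes "4 \<le> Z" "runs In Z Q (rset s (neval In s e) (reval In s f)) S"
  shows "runs In Z (Seq (RSet e f) Q) s S"
  by (rule runs_Seq[OF assms(1), of _ "RSet e f" s "\<lambda>s'. s' = rset s (neval In s e) (reval In s f)"])
    (use assms in \<open>auto intro: runs_RSet\<close>)

lemma runs_Cond:
  assumes Z: "4 \<le> Z" and "beval In s b \<Longrightarrow>
      runs In Z P s S" "\<not> beval In s b \<Longrightarrow> runs In Z Q s S"
  shows "runs In Z (Cond b P Q) s S"
proof (cases "beval In s b")
  case True
  then obtain t s' where 1: "exec In P s t s'" "t \<le> Z ^ depth P" "S s'" using assms unfolding runs_def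
      by blast
  have "1 \<le> Z ^ depth Q" using Z by simp
  then show ?thesis
    unfolding runs_def depth.simps
    using exec.CondTrue[OF True 1(1), of Q] pow_Suc_ge[OF Z 1(2), of 1 "depth Q"] 1(3) by blast
next
  case False
  then obtain t s' where 1: "exec In Q s t s'" "t \<le> Z ^ depth Q" "S s'" using assms unfolding runs_def
      by blast
  have "1 \<le> Z ^ depth P" using Z by simp
  then show ?thesis
    unfolding runs_def depth.simps
    using exec.CondFalse[OF False 1(1), of P] pow_Suc_ge[OF Z _ 1(2), of 1 "depth P"] 1(3)
    by (metis add.commute)
qed

text \<open>The invariant is indexed by the number of completed iterations. With D the cost of the
  body, N (D + 1) + 1 is at most 3 Z D, hence at most Z^2 D; so a loop raises the exponent by
  2.\<close>

lemma runs_While: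
  assumes Z: "4 \<le> Z" and N: "N \<le> Z" and init: "Inv 0 s"
    and step: "\<And>i s. Inv i s \<Longrightarrow> beval In s b \<Longrightarrow> i < N \<and>
        runs In Z P s (Inv (Suc i))"
    and exit: "\<And>i s. Inv i s \<Longrightarrow> \<not> beval In s b \<Longrightarrow> Q s"
  shows "runs In Z (While b P) s Q"
proof -
  let ?D = "Z ^ depth P"
  have *: "\<exists>t s'. exec In (While b P) s t s' \<and> t \<le> d * (?D + 1) + 1 \<and>
      Q s'" if "Inv i s" "d = N - i" for d i s
    using that
  proof (induction d arbitrary: i s)
    case 0
    then have "\<not> beval In s b" using step by fastforce
    then show ?case using exec.WhileFalse exit[OF 0(1)] by fastforce
  next
    case (Suc d)
    show ?case
    proof (cases "beval In s b")
      case True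
      then obtain t s' where 1: "exec In P s t s'" "t \<le> ?D" "Inv (Suc i) s'"
        using step[OF Suc.prems(1)] unfolding runs_def by blast
      have d: "d = N - Suc i" using Suc.prems(2) by simp
      obtain u s'' where 2: "exec In (While b P) s' u s''" "u \<le> d * (?D + 1) + 1" "Q s''"
        using Suc.IH[OF 1(3) d] by blast
      show ?thesis using exec.WhileTrue[OF True 1(1) 2(1)] 1(2) 2(2,3) by fastforce
    next
      case False
      then show ?thesis using exec.WhileFalse exit[OF Suc.prems(1)] by fastforce
    qed
  qed
  obtain t s' where 1: "exec In (While b P) s t s'" "t \<le> N * (?D + 1) + 1" "Q s'"
    using *[OF init refl] by auto
  have "N * (?D + 1) + 1 \<le> Z * (?D + 1) + 1" using N by (intro add_mono mult_le_mono) auto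
  also have "\<dots> \<le> Z * (3 * ?D)"
  proof -
    have "1 \<le> ?D" "1 \<le> Z" using Z by auto
    then have "Z * (?D + 1) + 1 \<le> Z * (?D + 1) + Z * ?D" by (simp add: Suc_le_eq)
    also have "\<dots> \<le> Z * (3 * ?D)" using \<open>1 \<le> ?D\<close>
        by (simp add: distrib_left[symmetric])
    finally show ?thesis .
  qed
  also have "\<dots> \<le> Z * (Z * ?D)" using Z by simp
  finally have "t \<le> Z ^ depth (While b P)" using 1(2) by simp
  with 1 show ?thesis unfolding runs_def by blast
qed

section \<open>Counted loops and frame conditions\<close>

definition var :: "nat \<Rightarrow> nexp" where "var j = NAdd NumVertices (NLit j)"

abbreviation cell :: "nat \<Rightarrow> nexp" where "cell j \<equiv> NMem (var j)"

definition for_loop :: "nat \<Rightarrow> nexp \<Rightarrow> prog \<Rightarrow> prog" where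
  "for_loop j bd P = Seq (NSet (var j) (NLit 0))
     (While (NLess (cell j) bd) (Seq P (NSet (var j) (NAdd (cell j) (NLit 1)))))"

lemma neval_var [simp]: "neval In s (var j) = in_n In + j"
  by (simp add: var_def)

lemma runs_for:
  assumes Z: "4 \<le> Z" and N: "N \<le> Z"
    and init: "Inv 0 (nset s (in_n In + j) 0)"
    and bound: "\<And>i s. Inv i s \<Longrightarrow> neval In s bd = N"
    and step: "\<And>i s. i < N \<Longrightarrow> Inv i s \<Longrightarrow> nmem s (in_n In + j) =
        i \<Longrightarrow>
      runs In Z P s (\<lambda>s'. nmem s' (in_n In + j) = i \<and> Inv (Suc i) (nset s' (in_n In + j) (Suc i)))"
    and fin: "\<And>s. Inv N s \<Longrightarrow> nmem s (in_n In + j) = N \<Longrightarrow> Q s"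
  shows "runs In Z (for_loop j bd P) s Q"
  unfolding for_loop_def
proof (rule runs_Seq_NSet[OF Z], rule runs_While[OF Z N, where Inv = "\<lambda>i s. Inv i s \<and>
    nmem s (in_n In + j) = i \<and> i \<le> N"])
  show "Inv 0 (nset s (neval In s (var j)) (neval In s (NLit 0))) \<and>
      nmem (nset s (neval In s (var j)) (neval In s (NLit 0))) (in_n In + j) = 0 \<and> 0 \<le> N"
    using init by simp
next
  fix i s assume I: "Inv i s \<and> nmem s (in_n In + j) = i \<and> i \<le> N"
    and b: "beval In s (NLess (cell j) bd)"
  then have i: "i < N" using bound[of i s] by auto
  show "i < N \<and> runs In Z (Seq P (NSet (var j) (NAdd (cell j) (NLit 1)))) s
      (\<lambda>s. Inv (Suc i) s \<and> nmem s (in_n In + j) = Suc i \<and> Suc i \<le> N)"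
    by (rule conjI[OF i], rule runs_Seq[OF Z step[of i s]]) (use I i in \<open>auto intro!: runs_NSet\<close>)
next
  fix i s assume "Inv i s \<and> nmem s (in_n In + j) = i \<and> i \<le>
      N" "\<not> beval In s (NLess (cell j) bd)"
  then show "Q s" using bound[of i s] fin[of s] by auto
qed

definition frame :: "nat set \<Rightarrow> nat set \<Rightarrow> memory \<Rightarrow> memory \<Rightarrow>
    bool" where
  "frame X Y s s' \<longleftrightarrow> (\<forall>a. a \<notin> X \<longrightarrow> nmem s' a =
      nmem s a) \<and> (\<forall>b. b \<notin> Y \<longrightarrow> rmem s' b = rmem s b)"

lemma frame_refl [simp]: "frame X Y s s"
  by (simp add: frame_def)

lemma frame_trans: "frame X Y s s' \<Longrightarrow> frame X' Y' s' s'' \<Longrightarrow>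
    X' \<subseteq> X \<Longrightarrow> Y' \<subseteq> Y \<Longrightarrow> frame X Y s s''"
  unfolding frame_def subset_iff by metis

lemma frame_nsetI: "frame X Y s s' \<Longrightarrow> a \<in> X \<Longrightarrow> frame X Y s (nset s' a v)"
  by (auto simp: frame_def)

lemma frame_rsetI: "frame X Y s s' \<Longrightarrow> a \<in> Y \<Longrightarrow> frame X Y s (rset s' a v)"
  by (auto simp: frame_def)

lemma frame_nmem: "frame X Y s s' \<Longrightarrow> a \<notin> X \<Longrightarrow> nmem s' a = nmem s a"
  and frame_rmem: "frame X Y s s' \<Longrightarrow> a \<notin> Y \<Longrightarrow> rmem s' a = rmem s a"
  by (auto simp: frame_def)

text \<open>Memory layout, with \<open>n\<close> the number of vertices. The first \<open>n\<close> natural cells hold the best assignment so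
  far, the next 20 cells are scratch variables, then come \<open>r + 1\<close> seed vertices, \<open>r + 1\<close> seed labels and
  the \<open>n\<close> labels of the assignment under construction. The seed slot \<open>r\<close> is a sentinel: a queried vertex is
  written there before it is searched for among the seeds.

  Scratch variables: 0 number of seed lists, 1 its loop counter, 2 to 5 copying and decoding, 6 current vertex,
  7 and 8 its candidate and best label, 9 and 10 constraint and label of the sum, 11 search index, 12 number of
  labelled vertices, 13 and 14 queried vertex and label, 15 accumulator. Real cells: 0 best value, 1 seed
  probability, 2 best conditional expectation, 3 accumulator, 4 and 5 queried marginals.\<close>

definition seed_vertex :: "nexp \<Rightarrow> nexp" where
  "seed_vertex e = NAdd (NAdd NumVertices (NLit 20)) e"

definition seed_label :: "nexp \<Rightarrow> nexp" where
  "seed_label e = NAdd (NAdd (NAdd NumVertices NumRounds) (NLit 21)) e"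

definition work :: "nexp \<Rightarrow> nexp" where
  "work e = NAdd (NAdd (NAdd (NAdd NumVertices NumRounds) NumRounds) (NLit 22)) e"

definition beq :: "nexp \<Rightarrow> nexp \<Rightarrow> bexp" where
  "beq e f = BAnd (BNot (NLess e f)) (BNot (NLess f e))"

lemma address_simps [simp]:
  "neval In s (seed_vertex e) = in_n In + 20 + neval In s e"
  "neval In s (seed_label e) = in_n In + in_r In + 21 + neval In s e"
  "neval In s (work e) = in_n In + in_r In + in_r In + 22 + neval In s e"
  "beval In s (beq e f) \<longleftrightarrow> neval In s e = neval In s f"
  by (auto simp: seed_vertex_def seed_label_def work_def beq_def)

definition seeds_at :: "ug_input \<Rightarrow> memory \<Rightarrow> (nat \<times> nat) list \<Rightarrow> bool"
    where
  "seeds_at In s ps \<longleftrightarrow> ps =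
      map (\<lambda>c. (nmem s (in_n In + 20 + c), nmem s (in_n In + in_r In + 21 + c))) [0..<in_r In]"

text \<open>Meaning of an \<open>LProb\<close> query in terms of the queried list of pairs;
  \<open>map_of\<close> reproduces the rule that the first label of a repeated vertex
  counts.\<close>

definition lookup_prob :: "ug_input \<Rightarrow> (nat \<times> nat) list \<Rightarrow> real" where
  "lookup_prob In qs = (let T = fst ` set qs; \<alpha> = restrict (\<lambda>i. the (map_of qs i)) T in
     if length qs \<le> in_r In + 2 \<and> T \<subseteq> {..<in_n In} \<and>
         \<alpha> \<in> assignments T (in_k In)
     then pmf (local_dist (in_sol In) T) \<alpha> else 0)"

lemma reval_LProb:
  "reval In s (LProb e f g) = lookup_prob In
     (map (\<lambda>c. (nmem s (neval In s f + c), nmem s (neval In s g + c))) [0..<neval In s e])"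
proof -
  let ?q = "neval In s e" and ?b = "neval In s f" and ?b' = "neval In s g"
  let ?qs = "map (\<lambda>c. (nmem s (?b + c), nmem s (?b' + c))) [0..<?q]"
  have z: "zip (map (nmem s) [?b..<?b + ?q]) (map (nmem s) [?b'..<?b' + ?q]) = ?qs"
    by (rule nth_equalityI) auto
  have T: "query_set s ?q ?b = fst ` set ?qs"
  proof -
    have "map fst ?qs = map (nmem s) [?b..<?b + ?q]" by (rule nth_equalityI) auto
    then have "set (map fst ?qs) = query_set s ?q ?b" unfolding query_set_def by simp
    then show ?thesis unfolding set_map ..
  qed
  show ?thesis
    unfolding reval.simps legal_query_def query_labels_def T z lookup_prob_def Let_def by simp
qed

text \<open>If vertex i is already seeded with another label, the query would ignore the appended
  label a and return the probability of the seeds. The \<open>map_of\<close> test detects this and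
  yields 0.\<close>

definition marginal :: "ug_input \<Rightarrow> (nat \<times> nat) list \<Rightarrow> real \<Rightarrow> nat
    \<Rightarrow> (nat \<Rightarrow> nat) \<Rightarrow> nat \<Rightarrow> nat \<Rightarrow> real" where
  "marginal In ps p0 t y i a = (if i < t then if y i = a then 1 else 0
     else if map_of (ps @ [(i, a)]) i = Some a then lookup_prob In (ps @ [(i, a)]) / p0 else 0)"

definition work_at :: "ug_input \<Rightarrow> memory \<Rightarrow> nat \<Rightarrow> nat" where
  "work_at In s i = nmem s (in_n In + in_r In + in_r In + 22 + i)"

definition find_seed :: prog where
  "find_seed = While (BNot (beq (NMem (seed_vertex (cell 11))) (cell 13)))
            (NSet (var 11) (NAdd (cell 11) (NLit 1)))"

definition query_marginal :: prog where
  "query_marginal = Cond (beq (NMem (seed_label (cell 11))) (cell 14))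
         (RSet (NLit 4) (RDiv (LProb (NAdd NumRounds (NLit 1)) (seed_vertex (NLit 0)) (seed_label (NLit 0)))
             (RMem (NLit 1))))
         (RSet (NLit 4) (RLit 0))"

definition marginal_prog :: prog where
  "marginal_prog =
   Cond (NLess (cell 13) (cell 12))
     (Cond (beq (NMem (work (cell 13))) (cell 14)) (RSet (NLit 4) (RLit 1)) (RSet (NLit 4) (RLit 0)))
     (Seq (NSet (seed_vertex NumRounds) (cell 13))
     (Seq (NSet (seed_label NumRounds) (cell 14))
     (Seq (NSet (var 11) (NLit 0))
     (Seq find_seed query_marginal))))"

lemma map_of_first_index:
  assumes "m < N" "v m = i" "\<And>c. c < m \<Longrightarrow> v c \<noteq> i"
  shows "map_of (map (\<lambda>c. (v c, l c)) [0..<N]) i = Some (l m)"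
proof -
  have "[0..<N] = [0..<m] @ m # [Suc m..<N]"
    using assms(1) upt_add_eq_append[of 0 m "N - m"] upt_conv_Cons[of m N] by simp
  moreover have "map_of (map (\<lambda>c. (v c, l c)) [0..<m]) i = None"
    unfolding map_of_eq_None_iff
  proof
    assume "i \<in> fst ` set (map (\<lambda>c. (v c, l c)) [0..<m])"
    then obtain c where "c < m" "v c = i" by auto
    with assms(3) show False by blast
  qed
  ultimately show ?thesis using assms(2) by (simp add: map_add_def)
qed

lemma runs_marginal:
  assumes Z: "4 \<le> Z" "in_r In \<le> Z" and seeds: "seeds_at In s ps"
  defines "n \<equiv> in_n In" and "r \<equiv> in_r In"
  shows "runs In Z marginal_prog s (\<lambda>s'. frame {n + 11, n + 20 + r, n + r + 21 + r} {4} s s' \<and>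
    rmem s' 4 = marginal In ps (rmem s 1) (nmem s (n + 12)) (work_at In s) (nmem s (n + 13)) (nmem s (n + 14)))"
proof (cases "nmem s (n + 13) < nmem s (n + 12)")
  case True
  then show ?thesis
    unfolding marginal_prog_def
    by (auto intro!: runs_Cond[OF Z(1)] runs_RSet frame_rsetI simp: n_def marginal_def work_at_def)
next
  case False
  define i a where "i = nmem s (n + 13)" and "a = nmem s (n + 14)"
  define s1 where "s1 = nset (nset (nset s (n + 20 + r) i) (n + r + 21 + r) a) (n + 11) 0"
  have len: "length ps = r" using seeds by (simp add: seeds_at_def r_def)
  have full: "map (\<lambda>c. (nmem s1 (n + 20 + c), nmem s1 (n + r + 21 + c))) [0..<Suc r] = ps @ [(i, a)]"
    unfolding seeds[unfolded seeds_at_def, folded n_def r_def]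
    by (auto simp: s1_def)
  show ?thesis
    unfolding marginal_prog_def
  proof (rule runs_Cond[OF Z(1)], goal_cases)
    case 1
    then show ?case using False by (simp add: n_def)
  next
    case 2
      let ?R = "\<lambda>s'. \<exists>m\<le>r. s' = nset s1 (n + 11) m \<and> nmem s1 (n + 20 + m) = i \<and>
          (\<forall>c<m. nmem s1 (n + 20 + c) \<noteq> i)"
      have loop: "runs In Z find_seed s1 ?R"
      unfolding find_seed_def
      proof (rule runs_While[OF Z, where Inv = "\<lambda>m s'. m \<le> in_r In \<and> s' =
          nset s1 (n + 11) m \<and> (\<forall>c<m. nmem s1 (n + 20 + c) \<noteq> i)"])
        show "0 \<le> in_r In \<and> s1 = nset s1 (n + 11) 0 \<and>
            (\<forall>c<0. nmem s1 (n + 20 + c) \<noteq> i)"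
          by (auto simp: s1_def nset_def)
      next
        fix m s' assume I: "m \<le> in_r In \<and> s' = nset s1 (n + 11) m \<and>
            (\<forall>c<m. nmem s1 (n + 20 + c) \<noteq> i)"
          and b: "beval In s' (BNot (beq (NMem (seed_vertex (cell 11))) (cell 13)))"
        have ne: "nmem s1 (n + 20 + m) \<noteq> i" using I b by (auto simp: n_def s1_def i_def r_def)
        \<comment> \<open>The sentinel slot r holds i, so an unsuccessful comparison can only occur
          before it.\<close>
        have "m \<noteq> in_r In" using ne by (auto simp: s1_def r_def)
        then have m: "m < in_r In" using I by simp
        moreover have "runs In Z (NSet (var 11) (NAdd (cell 11) (NLit 1))) s'
            (\<lambda>s'. Suc m \<le> in_r In \<and> s' = nset s1 (n + 11) (Suc m) \<and>
                (\<forall>c<Suc m. nmem s1 (n + 20 + c) \<noteq> i))"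
          by (rule runs_NSet) (use I m ne in \<open>auto simp: n_def nset_def less_Suc_eq\<close>)
        ultimately show "m < in_r In \<and> runs In Z (NSet (var 11) (NAdd (cell 11) (NLit 1))) s'
            (\<lambda>s'. Suc m \<le> in_r In \<and> s' = nset s1 (n + 11) (Suc m) \<and>
                (\<forall>c<Suc m. nmem s1 (n + 20 + c) \<noteq> i))" ..
      next
        fix m s' assume I: "m \<le> in_r In \<and> s' = nset s1 (n + 11) m \<and>
            (\<forall>c<m. nmem s1 (n + 20 + c) \<noteq> i)"
          and b: "\<not> beval In s' (BNot (beq (NMem (seed_vertex (cell 11))) (cell 13)))"
        then have "nmem s1 (n + 20 + m) = i" by (auto simp: n_def s1_def i_def r_def)
        with I show "?R s'" by (auto simp: r_def)
      qed
      have main: "runs In Z (Seq find_seed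
         query_marginal) s1
        (\<lambda>s'. frame {n + 11, n + 20 + r, n + r + 21 + r} {4} s s' \<and>
          rmem s' 4 = marginal In ps (rmem s 1) (nmem s (n + 12)) (work_at In s) (nmem s (n + 13)) (nmem s (n +
              14)))"
      proof (rule runs_Seq[OF Z(1) loop])
        fix s' assume "?R s'"
        then obtain m where m: "m \<le> r" "s' = nset s1 (n + 11) m" "nmem s1 (n + 20 + m) = i"
          "\<forall>c<m. nmem s1 (n + 20 + c) \<noteq> i" by blast
        have mo: "map_of (ps @ [(i, a)]) i = Some (nmem s1 (n + r + 21 + m))"
          unfolding full[symmetric] by (rule map_of_first_index) (use m in auto)
        have fr: "frame {n + 11, n + 20 + r, n + r + 21 + r} {4} s s'"
          unfolding m(2) s1_def by (intro frame_nsetI) auto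
        have lab: "nmem s' (n + r + 21 + m) = nmem s1 (n + r + 21 + m)" unfolding m(2) by simp
        have a': "nmem s' (n + 14) = a" "nmem s' (n + 11) = m" "rmem s' = rmem s"
          unfolding m(2) by (simp_all add: s1_def a_def)
        have full': "map (\<lambda>c. (nmem s' (n + 20 + c), nmem s' (n + r + 21 + c))) [0..<r + 1] =
            ps @ [(i, a)]"
          unfolding full[symmetric] m(2) by simp
        show "runs In Z query_marginal s'
          (\<lambda>s'. frame {n + 11, n + 20 + r, n + r + 21 + r} {4} s s' \<and>
          rmem s' 4 = marginal In ps (rmem s 1) (nmem s (n + 12)) (work_at In s) (nmem s (n + 13)) (nmem s (n +
              14)))"
        unfolding query_marginal_def
        proof ((rule runs_Cond[OF Z(1)]; rule runs_RSet; rule conjI), goal_cases)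
          case 1
          show ?case by (rule frame_rsetI[OF fr]) simp
        next
          case 2
          then show ?case using False mo lab a' full'
            by (simp add: marginal_def reval_LProb n_def[symmetric] r_def[symmetric] i_def[symmetric]
                a_def[symmetric] del: reval.simps(9))
        next
          case 3
          show ?case by (rule frame_rsetI[OF fr]) simp
        next
          case 4
          then show ?case using False mo lab a'
            by (simp add: marginal_def n_def[symmetric] r_def[symmetric] i_def[symmetric] a_def[symmetric])
        qed
      qed
    show ?case
      by (intro runs_Seq_NSet[OF Z(1)]) (use main in \<open>simp add: s1_def n_def r_def i_def a_def\<close>)
  qed
qed

section \<open>The rounding program\<close>

lemma seeds_at_frame:
  assumes "frame X Y s s'" "seeds_at In s ps"
    "\<And>c. c < in_r In \<Longrightarrow> in_n In + 20 + c \<notin> X \<and>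
        in_n In + in_r In + 21 + c \<notin> X"
  shows "seeds_at In s' ps"
  using assms by (simp add: seeds_at_def frame_def)

lemma work_at_frame:
  assumes "frame X Y s s'" "\<And>i. in_n In + in_r In + in_r In + 22 + i \<notin> X"
  shows "work_at In s' = work_at In s"
  using assms by (auto simp: work_at_def frame_def)

text \<open>\<open>exp_val In ps p0 t y\<close> is the expected value if the vertices below \<open>t\<close> are labelled by \<open>y\<close> and the others
  independently by their marginals conditioned on the seeds \<open>ps\<close> of probability \<open>p0\<close>. A loop is counted exactly,
  so that the expression stays multilinear.\<close>

definition exp_val_term :: "ug_input \<Rightarrow> (nat \<times> nat) list \<Rightarrow> real \<Rightarrow> nat
    \<Rightarrow> (nat \<Rightarrow> nat) \<Rightarrow> ug_constraint \<Rightarrow> nat \<Rightarrow> real"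
    where
  "exp_val_term In ps p0 t y = (\<lambda>(i, j, \<pi>) a. marginal In ps p0 t y i a *
     (if i = j then if \<pi> a = a then 1 else 0 else marginal In ps p0 t y j (\<pi> a)))"

definition exp_val :: "ug_input \<Rightarrow> (nat \<times> nat) list \<Rightarrow> real \<Rightarrow> nat
    \<Rightarrow> (nat \<Rightarrow> nat) \<Rightarrow> real" where
  "exp_val In ps p0 t y = (\<Sum>c<length (in_list In). \<Sum>a<in_k In.
     pmf (in_inst In) (in_list In ! c) * exp_val_term In ps p0 t y (in_list In ! c) a)"

definition second_factor :: prog where
  "second_factor = Cond (beq (CFst (cell 9)) (CSnd (cell 9)))
      (Cond (beq (CPerm (cell 9) (cell 10)) (cell 10))
        (RSet (NLit 4) (RLit 1)) (RSet (NLit 4) (RLit 0)))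
      (Seq (NSet (var 13) (CSnd (cell 9))) (Seq (NSet (var 14) (CPerm (cell 9) (cell 10))) marginal_prog))"

definition accumulate :: prog where
  "accumulate = RSet (NLit 3) (RAdd (RMem (NLit 3)) (RMul (CProb (cell 9)) (RMul (RMem (NLit 5)) (RMem (NLit
      4)))))"

definition exp_val_body :: prog where
  "exp_val_body =
   Seq (NSet (var 13) (CFst (cell 9))) (Seq (NSet (var 14) (cell 10)) (Seq marginal_prog
   (Seq (RSet (NLit 5) (RMem (NLit 4)))
   (Seq second_factor
     accumulate))))"

definition exp_val_prog :: prog where
  "exp_val_prog = Seq (RSet (NLit 3) (RLit 0)) (for_loop 9 NumConstraints (for_loop 10 NumLabels exp_val_body))"

definition exp_val_cells :: "ug_input \<Rightarrow> nat set" where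
  "exp_val_cells In = {in_n In + 9, in_n In + 10, in_n In + 11, in_n In + 13, in_n In + 14,
     in_n In + 20 + in_r In, in_n In + in_r In + 21 + in_r In}"

lemma exp_val_cells_seeds: "c < in_r In \<Longrightarrow> in_n In + 20 + c \<notin> exp_val_cells In \<and>
    in_n In + in_r In + 21 + c \<notin> exp_val_cells In"
  by (auto simp: exp_val_cells_def)

lemma exp_val_cells_work: "in_n In + in_r In + in_r In + 22 + i \<notin> exp_val_cells In"
  by (auto simp: exp_val_cells_def)

lemma runs_marginal':
  assumes Z: "4 \<le> Z" "in_r In \<le> Z" and seeds: "seeds_at In s ps"
    and post: "\<And>s'. frame {in_n In + 11, in_n In + 20 + in_r In, in_n In + in_r In + 21 + in_r In} {4} s
        s' \<Longrightarrow>
      rmem s' 4 = marginal In ps (rmem s 1) (nmem s (in_n In + 12)) (work_at In s) (nmem s (in_n In + 13))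
          (nmem s (in_n In + 14)) \<Longrightarrow> Q s'"
  shows "runs In Z marginal_prog s Q"
  by (rule runs_mono[OF runs_marginal[OF Z seeds]]) (use post in auto)

lemma runs_exp_val_body:
  assumes Z: "4 \<le> Z" "in_r In \<le> Z" and seeds: "seeds_at In s0 ps"
    and fr: "frame (exp_val_cells In) {3, 4, 5} s0 s"
    and c: "nmem s (in_n In + 9) = c" "c < length (in_list In)" and a: "nmem s (in_n In + 10) = a"
  shows "runs In Z exp_val_body s (\<lambda>s'. frame (exp_val_cells In) {3, 4, 5} s0 s' \<and>
    nmem s' (in_n In + 9) = c \<and> nmem s' (in_n In + 10) = a \<and>
    rmem s' 3 = rmem s 3 + pmf (in_inst In) (in_list In ! c) *
      exp_val_term In ps (rmem s0 1) (nmem s0 (in_n In + 12)) (work_at In s0) (in_list In ! c) a)"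
proof -
  let ?n = "in_n In" and ?r = "in_r In"
  let ?X = "exp_val_cells In" and ?Y = "{3, 4, 5} :: nat set"
  let ?Q = "\<lambda>s'. frame ?X ?Y s0 s' \<and> nmem s' (?n + 9) = c \<and> nmem s' (?n + 10) = a \<and>
    rmem s' 3 = rmem s 3 + pmf (in_inst In) (in_list In ! c) *
      exp_val_term In ps (rmem s0 1) (nmem s0 (?n + 12)) (work_at In s0) (in_list In ! c) a"
  obtain i j \<pi> where ijp: "in_list In ! c = (i, j, \<pi>)" by (cases "in_list In ! c")
  let ?m = "marginal In ps (rmem s0 1) (nmem s0 (?n + 12)) (work_at In s0)"
  have ctx: "seeds_at In s' ps" "rmem s' 1 = rmem s0 1" "nmem s' (?n + 12) = nmem s0 (?n + 12)"
    "work_at In s' = work_at In s0" if "frame ?X ?Y s0 s'" for s'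
    using seeds_at_frame[OF that seeds exp_val_cells_seeds] work_at_frame[OF that exp_val_cells_work]
      frame_rmem[OF that, of 1] frame_nmem[OF that, of "?n + 12"] by (auto simp: exp_val_cells_def)
  have sub: "{?n + 11, ?n + 20 + ?r, ?n + ?r + 21 + ?r} \<subseteq> ?X" by (auto simp: exp_val_cells_def)
  define s1 where "s1 = nset (nset s (?n + 13) i) (?n + 14) a"
  have fr1: "frame ?X ?Y s0 s1" unfolding s1_def by (intro frame_nsetI fr) (auto simp: exp_val_cells_def)
  have s1: "nmem s1 (?n + 9) = c" "nmem s1 (?n + 10) = a" "nmem s1 (?n + 13) = i" "nmem s1 (?n + 14) =
      a" "rmem s1 = rmem s"
    using c a by (simp_all add: s1_def)
  let ?R2 = "\<lambda>s'. frame ?X ?Y s0 s' \<and> nmem s' (?n + 9) = c \<and> nmem s' (?n + 10) = a \<and>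
      rmem s' 3 = rmem s 3 \<and> rmem s' 4 = ?m i a"
  let ?R3 = "\<lambda>s'. frame ?X ?Y s0 s' \<and> nmem s' (?n + 9) = c \<and> nmem s' (?n + 10) = a \<and>
      rmem s' 3 = rmem s 3 \<and> rmem s' 5 = ?m i a \<and>
    rmem s' 4 = (if i = j then if \<pi> a = a then 1 else 0 else ?m j (\<pi> a))"
  have M1: "runs In Z marginal_prog s1 ?R2"
  proof (rule runs_marginal'[OF Z ctx(1)[OF fr1]])
    fix s' assume f: "frame {?n + 11, ?n + 20 + ?r, ?n + ?r + 21 + ?r} {4} s1 s'"
      and v: "rmem s' 4 = marginal In ps (rmem s1 1) (nmem s1 (?n + 12)) (work_at In s1) (nmem s1 (?n + 13))
          (nmem s1 (?n + 14))"
    show "?R2 s'"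
      using frame_trans[OF fr1 f sub] v frame_nmem[OF f, of "?n + 9"] frame_nmem[OF f, of "?n + 10"]
        frame_rmem[OF f, of 3] by (simp add: ctx[OF fr1] ctx[OF fr] s1 del: One_nat_def)
  qed
  have main: "runs In Z second_factor
      (rset s' 5 (?m i a)) ?R3" if s': "?R2 s'" for s'
  unfolding second_factor_def
  proof (rule runs_Cond[OF Z(1)], goal_cases)
    case 1
    then have "i = j" using s' c by (simp add: ijp)
    then show ?case
      using s' c by (intro runs_Cond[OF Z(1)] runs_RSet) (auto simp: ijp intro!: frame_rsetI)
  next
    case 2
    then have ij: "i \<noteq> j" using s' c by (simp add: ijp)
    define s2 where "s2 = nset (nset (rset s' 5 (?m i a)) (?n + 13) j) (?n + 14) (\<pi> a)"
    have fr2: "frame ?X ?Y s0 s2"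
      unfolding s2_def using s' by (intro frame_nsetI frame_rsetI) (auto simp: exp_val_cells_def)
    have s2: "nmem s2 (?n + 9) = c" "nmem s2 (?n + 10) = a" "nmem s2 (?n + 13) = j" "nmem s2 (?n + 14) =
        \<pi> a"
      "rmem s2 3 = rmem s 3" "rmem s2 5 = ?m i a"
      using s' by (simp_all add: s2_def)
    have "runs In Z marginal_prog s2 ?R3"
    proof (rule runs_marginal'[OF Z ctx(1)[OF fr2]])
      fix s'' assume f: "frame {?n + 11, ?n + 20 + ?r, ?n + ?r + 21 + ?r} {4} s2 s''"
        and v: "rmem s'' 4 = marginal In ps (rmem s2 1) (nmem s2 (?n + 12)) (work_at In s2) (nmem s2 (?n + 13))
            (nmem s2 (?n + 14))"
      show "?R3 s''"
        using frame_trans[OF fr2 f sub] v frame_nmem[OF f, of "?n + 9"] frame_nmem[OF f, of "?n + 10"]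
          frame_rmem[OF f, of 3] frame_rmem[OF f, of 5] ij by (simp add: ctx[OF fr2] s2 del: One_nat_def)
    qed
    then show ?case
      by (intro runs_Seq_NSet[OF Z(1)]) (use s' c in \<open>simp add: s2_def ijp\<close>)
  qed
  have rest: "runs In Z (Seq (RSet (NLit 5) (RMem (NLit 4)))
   (Seq second_factor
     accumulate)) s'
   ?Q"
    if s': "?R2 s'" for s'
  proof (rule runs_Seq_RSet[OF Z(1)], rule runs_Seq[OF Z(1), where R = ?R3])
    have "rset s' (neval In s' (NLit 5)) (reval In s' (RMem (NLit 4))) = rset s' 5 (?m i a)" using s' by simp
    then show "runs In Z second_factor
      (rset s' (neval In s' (NLit 5)) (reval In s' (RMem (NLit 4)))) ?R3"
      using main[OF s'] by simp
  next
    fix s'' assume s'': "?R3 s''"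
    show "runs In Z accumulate
      s'' ?Q"
      unfolding accumulate_def
      by (rule runs_RSet) (use s'' c(2) in \<open>auto simp: ijp exp_val_term_def intro!: frame_rsetI\<close>)
  qed
  have "runs In Z (Seq marginal_prog (Seq (RSet (NLit 5) (RMem (NLit 4)))
   (Seq second_factor
     accumulate))) s1
   ?Q"
    by (rule runs_Seq[OF Z(1) M1 rest])
  then show ?thesis
    unfolding exp_val_body_def
    by (intro runs_Seq_NSet[OF Z(1)]) (use c a in \<open>simp add: s1_def ijp\<close>)
qed

lemma runs_exp_val:
  assumes Z: "4 \<le> Z" "in_r In \<le> Z" "in_k In \<le> Z" "length (in_list In) \<le>
      Z" and seeds: "seeds_at In s0 ps"
  shows "runs In Z exp_val_prog s0 (\<lambda>s'. frame (exp_val_cells In) {3, 4, 5} s0 s' \<and>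
    rmem s' 3 = exp_val In ps (rmem s0 1) (nmem s0 (in_n In + 12)) (work_at In s0))"
proof -
  let ?n = "in_n In"
  let ?X = "exp_val_cells In" and ?Y = "{3, 4, 5} :: nat set"
  define T where "T c a = pmf (in_inst In) (in_list In ! c) *
      exp_val_term In ps (rmem s0 1) (nmem s0 (?n + 12)) (work_at In s0) (in_list In ! c) a" for c a
  let ?I = "\<lambda>c s. frame ?X ?Y s0 s \<and> rmem s 3 = (\<Sum>c'<c. \<Sum>a<in_k In. T c' a)"
  have cells: "?n + 9 \<in> ?X" "?n + 10 \<in> ?X" by (auto simp: exp_val_cells_def)
  show ?thesis
    unfolding exp_val_prog_def
  proof (rule runs_Seq_RSet[OF Z(1)], rule runs_for[OF Z(1) Z(4), where Inv = ?I])
    show "?I 0 (nset (rset s0 (neval In s0 (NLit 3)) (reval In s0 (RLit 0))) (?n + 9) 0)"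
      by (auto intro!: frame_nsetI frame_rsetI cells)
  next
    fix c s assume c: "c < length (in_list In)" and I: "?I c s" and cn: "nmem s (?n + 9) = c"
    let ?J = "\<lambda>a s. frame ?X ?Y s0 s \<and> nmem s (?n + 9) = c \<and>
      rmem s 3 = (\<Sum>c'<c. \<Sum>a<in_k In. T c' a) + (\<Sum>a'<a. T c a')"
    show "runs In Z (for_loop 10 NumLabels exp_val_body) s
      (\<lambda>s'. nmem s' (?n + 9) = c \<and> ?I (Suc c) (nset s' (?n + 9) (Suc c)))"
    proof (rule runs_for[OF Z(1) Z(3), where Inv = ?J])
      show "?J 0 (nset s (?n + 10) 0)" using I cn by (auto intro!: frame_nsetI cells)
    next
      fix a s' assume a: "a < in_k In" and J: "?J a s'" and an: "nmem s' (?n + 10) = a"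
      show "runs In Z exp_val_body s' (\<lambda>s''. nmem s'' (?n + 10) = a \<and>
          ?J (Suc a) (nset s'' (?n + 10) (Suc a)))"
        by (rule runs_mono[OF runs_exp_val_body[OF Z(1,2) seeds _ _ c an]])
          (use J in \<open>auto simp: T_def intro!: frame_nsetI cells\<close>)
    next
      fix s' assume "?J (in_k In) s'"
      then show "nmem s' (?n + 9) = c \<and> ?I (Suc c) (nset s' (?n + 9) (Suc c))"
        by (auto intro!: frame_nsetI cells)
    qed simp
  next
    fix s assume "?I (length (in_list In)) s"
    then show "frame ?X ?Y s0 s \<and> rmem s 3 = exp_val In ps (rmem s0 1) (nmem s0 (?n + 12)) (work_at In s0)"
      by (simp add: exp_val_def T_def)
  qed simp
qed

section \<open>Derandomization by conditional expectations\<close>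

definition try_label :: prog where
  "try_label = Seq (NSet (work (cell 6)) (cell 7)) (Seq exp_val_prog
     (Cond (RLess (RMem (NLit 2)) (RMem (NLit 3)))
       (Seq (RSet (NLit 2) (RMem (NLit 3))) (NSet (var 8) (cell 7))) Skip))"

definition choose_label :: prog where
  "choose_label = Seq (NSet (var 12) (NAdd (cell 6) (NLit 1))) (Seq (RSet (NLit 2) (RLit (- 1)))
     (Seq (NSet (var 8) (NLit 0)) (Seq (for_loop 7 NumLabels try_label)
     (NSet (work (cell 6)) (cell 8)))))"

definition round_prog :: prog where
  "round_prog = Seq (RSet (NLit 1) (LProb NumRounds (seed_vertex (NLit 0)) (seed_label (NLit 0))))
     (Seq (for_loop 6 NumVertices choose_label)
     (Seq (NSet (var 12) NumVertices) exp_val_prog))"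

locale ug_run =
  fixes In :: ug_input and Z n k r :: nat
  defines "n \<equiv> in_n In" and "k \<equiv> in_k In" and "r \<equiv> in_r In"
  assumes Z4: "4 \<le> Z" and nZ: "n \<le> Z" and kZ: "k \<le> Z" and rZ: "r \<le> Z"
    and listZ: "length (in_list In) \<le> Z" and countZ: "(n * k) ^ r \<le> Z"
    and ug: "ug_instance n k (in_inst In)"
    and n0: "0 < n"
    and list: "distinct (in_list In)" "set (in_list In) = set_pmf (in_inst In)"
begin

lemma k0: "0 < k" using ug by (simp add: ug_instance_def)

lemma constraint_dest:
  assumes "c < length (in_list In)" "in_list In ! c = (i, j, \<pi>)"
  shows "i < n" "j < n" "\<pi> permutes {..<k}" "a < k \<Longrightarrow> \<pi> a < k"
proof -
  have "(i, j, \<pi>) \<in> set_pmf (in_inst In)" using assms list(2) nth_mem by metis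
  from ug_instance_dest[OF ug this] show "i < n" "j < n" and p: "\<pi> permutes {..<k}" by auto
  show "a < k \<Longrightarrow> \<pi> a < k" using permutes_in_image[OF p, of a] by simp
qed

lemma lookup_prob_nonneg: "0 \<le> lookup_prob In qs"
  by (simp add: lookup_prob_def Let_def)

lemma marginal_nonneg: "0 \<le> p0 \<Longrightarrow> 0 \<le> marginal In ps p0 t y i a"
  by (simp add: marginal_def lookup_prob_nonneg)

lemma exp_val_nonneg: "0 \<le> p0 \<Longrightarrow> 0 \<le> exp_val In ps p0 t y"
  unfolding exp_val_def exp_val_term_def
  by (intro sum_nonneg mult_nonneg_nonneg) (auto split: prod.splits simp: marginal_nonneg)

lemma marginal_cong: "(\<And>i. i < t \<Longrightarrow> y i = y' i) \<Longrightarrow>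
    marginal In ps p0 t y i a = marginal In ps p0 t y' i a"
  by (simp add: marginal_def)

lemma exp_val_cong: "(\<And>i. i < t \<Longrightarrow> y i = y' i) \<Longrightarrow> exp_val In ps p0 t y =
    exp_val In ps p0 t y'"
proof -
  assume "\<And>i. i < t \<Longrightarrow> y i = y' i"
  then have "marginal In ps p0 t y = marginal In ps p0 t y'" by (intro ext) (rule marginal_cong)
  then show "exp_val In ps p0 t y = exp_val In ps p0 t y'" by (simp only: exp_val_def exp_val_term_def)
qed

lemma sum_list_constraints:
  "(\<Sum>c<length (in_list In). f (in_list In ! c)) = (\<Sum>c\<in>set_pmf (in_inst In). f c)"
  using sum.reindex_bij_betw[OF bij_betw_nth[OF list(1) refl refl], of f] list(2) by simp

text \<open>Once every vertex is labelled all marginals are indicators, so only the summand with a =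
  \<open>y i\<close> survives for each constraint.\<close>

lemma exp_val_full:
  assumes y: "\<And>i. i < n \<Longrightarrow> y i < k"
  shows "exp_val In ps p0 n y = ug_val (in_inst In) y"
proof -
  have "(\<Sum>a<k. pmf (in_inst In) c * exp_val_term In ps p0 n y c a) =
      (case c of (i, j, \<pi>) \<Rightarrow> pmf (in_inst In) (i, j, \<pi>) * (if y j =
          \<pi> (y i) then 1 else 0))"
    if c: "c \<in> set_pmf (in_inst In)" for c
  proof -
    obtain i j \<pi> where ijp: "c = (i, j, \<pi>)" by (cases c)
    note d = ug_instance_dest[OF ug c[unfolded ijp]]
    have "(\<Sum>a<k. exp_val_term In ps p0 n y c a) = (\<Sum>a<k. if a = y i then if y j =
        \<pi> (y i) then 1 else 0 else 0)"
      by (intro sum.cong refl) (use d in \<open>auto simp: ijp exp_val_term_def marginal_def\<close>)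
    also have "\<dots> = (if y j = \<pi> (y i) then 1 else 0)" using y d by simp
    finally show ?thesis by (simp add: ijp sum_distrib_left[symmetric])
  qed
  then show ?thesis
    unfolding exp_val_def sum_list_constraints ug_val_eq_sum[OF finite_set_pmf_ug[OF ug]] k_def[symmetric]
      sum_list_constraints[of "\<lambda>c. \<Sum>a<k. pmf (in_inst In) c * exp_val_term In ps p0 n y c a"]
    by (intro sum.cong refl) auto
qed

text \<open>The marginal of vertex t occurs at most once in each summand, loops included, so the
  expectation is the average of its values with t fixed to each label; summands without t use that
  the marginal of t sums to 1.\<close>

lemma exp_val_multilinear:
  assumes t: "t < n" and one: "(\<Sum>a<k. marginal In ps p0 0 y t a) = 1"
  shows "exp_val In ps p0 t y = (\<Sum>a<k. marginal In ps p0 0 y t a * exp_val In ps p0 (Suc t) (y(t := a)))"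
proof -
  let ?m0 = "marginal In ps p0 0 y t"
  have other: "marginal In ps p0 (Suc t) (y(t := a)) i b =
      marginal In ps p0 t y i b" if "i \<noteq> t" for a b i
    using that by (auto simp: marginal_def less_Suc_eq)
  have self: "marginal In ps p0 (Suc t) (y(t := a)) t b = (if b = a then 1 else 0)"
    "marginal In ps p0 t y t b = ?m0 b" for a b
    by (auto simp: marginal_def)
  have pick: "(\<Sum>a<k. ?m0 a * ((if b = a then 1 else 0) * x)) = ?m0 b * x" if "b < k" for b x
  proof -
    have "(\<Sum>a<k. ?m0 a * ((if b = a then 1 else 0) * x)) = (\<Sum>a<k. if b = a then ?m0 b * x else 0)"
      by (intro sum.cong) auto
    then show ?thesis using that by simp
  qed
  have const: "(\<Sum>a<k. ?m0 a * x) = x" for x using one by (simp add: sum_distrib_right[symmetric])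
  have each: "exp_val_term In ps p0 t y (i, j, \<pi>) b =
      (\<Sum>a<k. ?m0 a * exp_val_term In ps p0 (Suc t) (y(t := a)) (i, j, \<pi>) b)"
    if "b < k" "\<pi> b < k" for i j \<pi> b
  proof (cases "i = t")
    case True
    then show ?thesis
      using pick[OF that(1)] pick[OF that(1), of 1]
      by (cases "j = t") (simp_all add: exp_val_term_def self other)
  next
    case False
    show ?thesis
    proof (cases "j = t")
      case True
      have "(\<Sum>a<k. ?m0 a * (marginal In ps p0 t y i b * (if \<pi> b = a then 1 else 0))) =
          (\<Sum>a<k. ?m0 a * ((if \<pi> b = a then 1 else 0) * marginal In ps p0 t y i b))"
        by (simp add: mult_ac)
      then show ?thesis
        using pick[OF that(2), of "marginal In ps p0 t y i b"] True False
        by (simp add: exp_val_term_def self other mult_ac)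
    next
      case False
      then show ?thesis using \<open>i \<noteq> t\<close> by (simp add: exp_val_term_def other const)
    qed
  qed
  have "exp_val In ps p0 t y = (\<Sum>c<length (in_list In). \<Sum>b<k. \<Sum>a<k. ?m0 a *
      (pmf (in_inst In) (in_list In ! c) * exp_val_term In ps p0 (Suc t) (y(t := a)) (in_list In ! c) b))"
    unfolding exp_val_def k_def[symmetric]
  proof (intro sum.cong refl)
    fix c b assume "c \<in> {..<length (in_list In)}" "b \<in> {..<k}"
    then have cb: "c < length (in_list In)" "b < k" by auto
    obtain i j \<pi> where ijp: "in_list In ! c = (i, j, \<pi>)" by (cases "in_list In ! c")
    have "\<pi> b < k" using constraint_dest(4)[OF cb(1) ijp cb(2)] .
    from each[of b \<pi> i j, OF cb(2) this]
    show "pmf (in_inst In) (in_list In ! c) * exp_val_term In ps p0 t y (in_list In ! c) b =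
        (\<Sum>a<k. ?m0 a * (pmf (in_inst In) (in_list In ! c) * exp_val_term In ps p0 (Suc t) (y(t := a))
            (in_list In ! c) b))"
      unfolding ijp by (simp add: sum_distrib_left mult_ac)
  qed
  also have "\<dots> = (\<Sum>a<k. \<Sum>c<length (in_list In). \<Sum>b<k. ?m0 a *
      (pmf (in_inst In) (in_list In ! c) * exp_val_term In ps p0 (Suc t) (y(t := a)) (in_list In ! c) b))"
    by (rule trans[OF sum.cong[OF refl sum.swap] sum.swap])
  also have "\<dots> = (\<Sum>a<k. ?m0 a * exp_val In ps p0 (Suc t) (y(t := a)))"
    unfolding exp_val_def k_def[symmetric] by (simp add: sum_distrib_left)
  finally show ?thesis .
qed

text \<open>The enumeration also meets lists of probability 0, for which all marginals vanish
  through division by 0. The guarantee of the derandomization is stated for normalized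
  lists.\<close>

definition normalized :: "(nat \<times> nat) list \<Rightarrow> real \<Rightarrow> bool" where
  "normalized ps p0 \<longleftrightarrow> (\<forall>i<n. (\<Sum>a<k. marginal In ps p0 0 (\<lambda>_. 0) i a) =
      1)"

lemma marginal_0: "marginal In ps p0 0 y i a = marginal In ps p0 0 y' i a"
  by (simp add: marginal_def)

text \<open>An average over the labels of vertex t cannot exceed their maximum.\<close>

lemma exp_val_greedy:
  assumes "t < n" "normalized ps p0" "0 \<le> p0" "\<And>a. a < k \<Longrightarrow>
      exp_val In ps p0 (Suc t) (y(t := a)) \<le> v"
  shows "exp_val In ps p0 t y \<le> v"
proof -
  have one: "(\<Sum>a<k. marginal In ps p0 0 y t a) = 1"
    using assms(1,2) marginal_0[of ps p0 y t _ "\<lambda>_. 0"] by (simp add: normalized_def)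
  have "exp_val In ps p0 t y = (\<Sum>a<k. marginal In ps p0 0 y t a * exp_val In ps p0 (Suc t) (y(t := a)))"
    by (rule exp_val_multilinear[OF assms(1) one])
  also have "\<dots> \<le> (\<Sum>a<k. marginal In ps p0 0 y t a * v)"
    by (intro sum_mono mult_left_mono) (use assms in \<open>auto simp: marginal_nonneg\<close>)
  also have "\<dots> = v" using one by (simp add: sum_distrib_right[symmetric])
  finally show ?thesis .
qed

definition round_cells :: "nat set" where
  "round_cells = {n + 6..n + 14} \<union> {n + 20 + r, n + r + 21 + r} \<union> {n + r + r + 22..}"

lemma exp_val_cells_sub: "exp_val_cells In \<subseteq> round_cells"
  by (auto simp: exp_val_cells_def round_cells_def n_def r_def)

lemma round_cells_seeds: "c < in_r In \<Longrightarrow> in_n In + 20 + c \<notin> round_cells \<and>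
    in_n In + in_r In + 21 + c \<notin> round_cells"
  by (auto simp: round_cells_def n_def r_def)

lemma work_at_nset: "work_at In (nset s (n + r + r + 22 + i) v) = (work_at In s)(i := v)"
  by (auto simp: work_at_def n_def r_def)

lemma work_at_nset_var: "j < 20 \<Longrightarrow> work_at In (nset s (n + j) v) = work_at In s"
  by (auto simp: work_at_def n_def r_def)

lemma work_at_rset: "work_at In (rset s j v) = work_at In s"
  by (auto simp: work_at_def)

lemma runs_exp_val':
  assumes seeds: "seeds_at In s ps"
    and post: "\<And>s'. frame (exp_val_cells In) {3, 4, 5} s s' \<Longrightarrow> work_at In s' =
        work_at In s \<Longrightarrow>
      rmem s' 3 = exp_val In ps (rmem s 1) (nmem s (n + 12)) (work_at In s) \<Longrightarrow> Q s'"
  shows "runs In Z exp_val_prog s Q"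
  by (rule runs_mono[OF runs_exp_val[OF Z4 rZ[unfolded r_def] kZ[unfolded k_def] listZ seeds]])
    (use post work_at_frame[OF _ exp_val_cells_work] in \<open>auto simp: n_def\<close>)

lemma runs_choose_label:
  assumes fr: "frame round_cells {1, 2, 3, 4, 5} s0 s" and seeds: "seeds_at In s0 ps"
    and p0: "rmem s 1 = p0" "0 \<le> p0" and t: "nmem s (n + 6) = t" "t < n"
  shows "runs In Z choose_label s (\<lambda>s'. frame round_cells {1, 2, 3, 4, 5} s0 s' \<and> rmem s' 1 =
      p0 \<and> nmem s' (n + 6) = t \<and>
    (\<exists>a<k. work_at In s' = (work_at In s)(t := a) \<and>
      (\<forall>a'<k. exp_val In ps p0 (Suc t) ((work_at In s)(t := a')) \<le>
          exp_val In ps p0 (Suc t) ((work_at In s)(t := a)))))"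
proof -
  let ?X = round_cells and ?Y = "{1, 2, 3, 4, 5} :: nat set"
  let ?y = "work_at In s"
  let ?e = "\<lambda>a. exp_val In ps p0 (Suc t) (?y(t := a))"
  \<comment> \<open>Cell t of the assignment holds the candidate being tested, so the invariant
    fixes the assignment only up to its value at t.\<close>
  let ?J = "\<lambda>b s'. frame ?X ?Y s0 s' \<and> rmem s' 1 = p0 \<and> nmem s' (n + 6) = t \<and>
      nmem s' (n + 12) = Suc t \<and>
    (\<forall>a. (work_at In s')(t := a) = ?y(t := a)) \<and> nmem s' (n + 8) < k \<and>
    rmem s' 2 \<le> ?e (nmem s' (n + 8)) \<and> (\<forall>a<b. ?e a \<le> rmem s' 2)"
  have cells: "n + 6 \<in> ?X" "n + 7 \<in> ?X" "n + 8 \<in> ?X" "n + 12 \<in> ?X" "n + r + r + 22 + i \<in>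
      ?X" for i
    by (auto simp: round_cells_def)
  have ecells: "n + 6 \<notin> exp_val_cells In" "n + 7 \<notin> exp_val_cells In" "n + 8 \<notin>
      exp_val_cells In" "n + 12 \<notin> exp_val_cells In"
    by (auto simp: exp_val_cells_def n_def)
  have loop: "runs In Z (for_loop 7 NumLabels try_label) s1 (?J k)" if s1: "?J 0 s1" for s1
  proof (rule runs_for[OF Z4 kZ, where Inv = ?J])
    show "?J 0 (nset s1 (in_n In + 7) 0)"
      using s1 by (auto simp: n_def[symmetric] work_at_nset_var intro!: frame_nsetI cells)
    show "neval In s NumLabels = k" for s by (simp add: k_def)
  next
    fix b s' assume b: "b < k" and J: "?J b s'" and bn: "nmem s' (in_n In + 7) = b"
    define s2 where "s2 = nset s' (n + r + r + 22 + t) b"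
    have fr2: "frame ?X ?Y s0 s2" unfolding s2_def using J by (intro frame_nsetI cells) auto
    have w2: "work_at In s2 = ?y(t := b)" unfolding s2_def work_at_nset using J by blast
    have s2: "rmem s2 = rmem s'" "nmem s2 (n + 6) = t" "nmem s2 (n + 7) = b" "nmem s2 (n + 8) = nmem s' (n + 8)"
      "nmem s2 (n + 12) = Suc t"
      using J bn by (auto simp: s2_def n_def)
    let ?R = "\<lambda>s''. frame ?X ?Y s0 s'' \<and> work_at In s'' = ?y(t := b) \<and> rmem s'' 3 =
        ?e b \<and> rmem s'' 1 = p0 \<and>
      rmem s'' 2 = rmem s' 2 \<and> nmem s'' (n + 6) = t \<and> nmem s'' (n + 7) = b \<and> nmem s'' (n + 8) =
          nmem s' (n + 8) \<and>
      nmem s'' (n + 12) = Suc t"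
    have "runs In Z exp_val_prog s2 ?R"
    proof (rule runs_exp_val'[OF seeds_at_frame[OF fr2 seeds round_cells_seeds]])
      fix s'' assume f: "frame (exp_val_cells In) {3, 4, 5} s2 s''" and w: "work_at In s'' = work_at In s2"
        and v: "rmem s'' 3 = exp_val In ps (rmem s2 1) (nmem s2 (n + 12)) (work_at In s2)"
      show "?R s''"
        using frame_trans[OF fr2 f exp_val_cells_sub] w v J
          frame_nmem[OF f ecells(1)] frame_nmem[OF f ecells(2)] frame_nmem[OF f ecells(3)] frame_nmem[OF f
              ecells(4)]
          frame_rmem[OF f, of 1] frame_rmem[OF f, of 2]
        by (simp add: s2 w2 del: One_nat_def)
    qed
    then have "runs In Z (Seq exp_val_prog
     (Cond (RLess (RMem (NLit 2)) (RMem (NLit 3)))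
       (Seq (RSet (NLit 2) (RMem (NLit 3))) (NSet (var 8) (cell 7))) Skip)) s2
       (\<lambda>s''. nmem s'' (n + 7) = b \<and> ?J (Suc b) (nset s'' (n + 7) (Suc b)))"
    proof (rule runs_Seq[OF Z4])
      fix s'' assume R: "?R s''"
      have upd: "(work_at In s'')(t := a) = ?y(t := a)" for a using R by simp
      show "runs In Z (Cond (RLess (RMem (NLit 2)) (RMem (NLit 3)))
       (Seq (RSet (NLit 2) (RMem (NLit 3))) (NSet (var 8) (cell 7))) Skip) s''
       (\<lambda>s''. nmem s'' (n + 7) = b \<and> ?J (Suc b) (nset s'' (n + 7) (Suc b)))"
      proof (rule runs_Cond[OF Z4], goal_cases)
        case 1
        then have lt: "rmem s' 2 < ?e b" using R by simp
        have "?e a \<le> ?e b" if "a < Suc b" for a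
          using that J lt by (cases "a = b") (auto intro: order_trans[of _ "rmem s' 2"] dest: less_imp_le)
        then show ?case
          by (intro runs_Seq_RSet[OF Z4] runs_NSet)
            (use R b in \<open>auto simp: n_def[symmetric] work_at_nset_var work_at_rset upd intro!:
                frame_nsetI frame_rsetI cells\<close>)
      next
        case 2
        then have ge: "?e b \<le> rmem s' 2" using R by simp
        have "?e a \<le> rmem s' 2" if "a < Suc b" for a
          using that J ge by (cases "a = b") auto
        then show ?case
          by (intro runs_Skip)
            (use R J in \<open>auto simp: n_def[symmetric] work_at_nset_var work_at_rset upd intro!:
                frame_nsetI frame_rsetI cells\<close>)
      qed
    qed
    then show "runs In Z try_label s' (\<lambda>s''. nmem s'' (in_n In + 7) = b \<and>
        ?J (Suc b) (nset s'' (in_n In + 7) (Suc b)))"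
      unfolding try_label_def
      by (intro runs_Seq_NSet[OF Z4]) (use J bn in \<open>simp add: s2_def n_def r_def\<close>)
  qed
  \<comment> \<open>Expected values are nonnegative, so the initial record -1 lies below that of
    label 0 and the invariant holds with candidate 0.\<close>
  define s1 where "s1 = nset (rset (nset s (n + 12) (Suc t)) 2 (- 1)) (n + 8) 0"
  have s1: "?J 0 s1"
    using fr p0 t k0 exp_val_nonneg[OF p0(2), of ps "Suc t" "?y(t := 0)"]
    by (auto simp: s1_def work_at_nset_var work_at_rset intro!: frame_nsetI frame_rsetI cells)
  have "runs In Z (Seq (for_loop 7 NumLabels try_label) (NSet (work (cell 6)) (cell 8))) s1
      (\<lambda>s'. frame ?X ?Y s0 s' \<and> rmem s' 1 = p0 \<and> nmem s' (n + 6) = t \<and>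
        (\<exists>a<k. work_at In s' = ?y(t := a) \<and> (\<forall>a'<k. ?e a' \<le> ?e a)))"
  proof (rule runs_Seq[OF Z4 loop[OF s1]], rule runs_NSet)
    fix s' assume J: "?J k s'"
    have addr: "neval In s' (work (cell 6)) = n + r + r + 22 + t" using J by (simp add: n_def r_def)
    have val: "neval In s' (cell 8) = nmem s' (n + 8)" by (simp add: n_def)
    show "frame ?X ?Y s0 (nset s' (neval In s' (work (cell 6))) (neval In s' (cell 8))) \<and>
        rmem (nset s' (neval In s' (work (cell 6))) (neval In s' (cell 8))) 1 = p0 \<and>
        nmem (nset s' (neval In s' (work (cell 6))) (neval In s' (cell 8))) (n + 6) = t \<and>
        (\<exists>a<k. work_at In (nset s' (neval In s' (work (cell 6))) (neval In s' (cell 8))) =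
            ?y(t := a) \<and>
          (\<forall>a'<k. ?e a' \<le> ?e a))"
      unfolding addr val work_at_nset
    proof (intro conjI exI[of _ "nmem s' (n + 8)"] allI impI)
      show "frame ?X ?Y s0 (nset s' (n + r + r + 22 + t) (nmem s' (n + 8)))"
        using J by (intro frame_nsetI cells) auto
      show "?e a \<le> ?e (nmem s' (n + 8))" if "a < k" for a
        using J that by (auto intro: order_trans)
    qed (use J in auto)
  qed
  then show ?thesis
    unfolding choose_label_def
    by (intro runs_Seq_NSet[OF Z4] runs_Seq_RSet[OF Z4]) (use t in \<open>simp add: s1_def n_def\<close>)
qed

text \<open>The expectation never decreases while vertices are fixed one by one. For every seed
  list, also a degenerate one, the outcome is a valid assignment together with its exact value, so
  comparing the outcomes of all lists is sound.\<close>

lemma runs_round: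
  assumes seeds: "seeds_at In s0 ps"
  shows "runs In Z round_prog s0 (\<lambda>s'. frame round_cells {1, 2, 3, 4, 5} s0 s' \<and>
    (\<forall>i<n. work_at In s' i < k) \<and> rmem s' 3 = ug_val (in_inst In) (work_at In s') \<and>
    (normalized ps (lookup_prob In ps) \<longrightarrow>
        exp_val In ps (lookup_prob In ps) 0 (\<lambda>_. 0) \<le> rmem s' 3))"
proof -
  let ?X = round_cells and ?Y = "{1, 2, 3, 4, 5} :: nat set"
  let ?p = "lookup_prob In ps"
  let ?Q = "\<lambda>s'. frame ?X ?Y s0 s' \<and> (\<forall>i<n. work_at In s' i < k) \<and>
      rmem s' 3 = ug_val (in_inst In) (work_at In s') \<and>
      (normalized ps ?p \<longrightarrow> exp_val In ps ?p 0 (\<lambda>_. 0) \<le> rmem s' 3)"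
  let ?I = "\<lambda>t s. frame ?X ?Y s0 s \<and> rmem s 1 = ?p \<and> (\<forall>i<t. work_at In s i < k) \<and>
    (normalized ps ?p \<longrightarrow> exp_val In ps ?p 0 (\<lambda>_. 0) \<le>
        exp_val In ps ?p t (work_at In s))"
  have cells: "n + 6 \<in> ?X" "n + 12 \<in> ?X" by (auto simp: round_cells_def)
  have p0: "0 \<le> ?p" by (rule lookup_prob_nonneg)
  define s1 where "s1 = rset s0 1 ?p"
  have s1: "frame ?X ?Y s0 s1" "rmem s1 1 = ?p" unfolding s1_def by (auto intro!: frame_rsetI)
  have loop: "runs In Z (for_loop 6 NumVertices choose_label) s1 (?I n)"
  proof (rule runs_for[OF Z4 nZ, where Inv = ?I])
    show "?I 0 (nset s1 (in_n In + 6) 0)"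
      using s1 exp_val_cong[of 0 "\<lambda>_. 0" "work_at In s1" ps ?p]
      by (auto simp: n_def[symmetric] work_at_nset_var intro!: frame_nsetI cells)
    show "neval In s NumVertices = n" for s by (simp add: n_def)
  next
    fix t s assume t: "t < n" and I: "?I t s" and tn: "nmem s (in_n In + 6) = t"
    show "runs In Z choose_label s (\<lambda>s'. nmem s' (in_n In + 6) = t \<and>
        ?I (Suc t) (nset s' (in_n In + 6) (Suc t)))"
    proof (rule runs_mono[OF runs_choose_label[of s0 s ps ?p t]])
      show "frame ?X ?Y s0 s" "seeds_at In s0 ps" "rmem s 1 = ?p" "0 \<le> ?p" "nmem s (n + 6) = t" "t < n"
        using I seeds p0 t tn by (auto simp: n_def)
    next
      fix s' assume R: "frame ?X ?Y s0 s' \<and> rmem s' 1 = ?p \<and> nmem s' (n + 6) = t \<and>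
        (\<exists>a<k. work_at In s' = (work_at In s)(t := a) \<and>
        (\<forall>a'<k. exp_val In ps ?p (Suc t) ((work_at In s)(t := a')) \<le>
            exp_val In ps ?p (Suc t) ((work_at In s)(t := a))))"
      then obtain a where a: "a < k" "work_at In s' = (work_at In s)(t := a)"
        "\<And>a'. a' < k \<Longrightarrow> exp_val In ps ?p (Suc t) ((work_at In s)(t := a')) \<le>
            exp_val In ps ?p (Suc t) ((work_at In s)(t := a))"
        by blast
      have "exp_val In ps ?p 0 (\<lambda>_. 0) \<le>
          exp_val In ps ?p (Suc t) (work_at In s')" if "normalized ps ?p"
      proof -
        have "exp_val In ps ?p 0 (\<lambda>_. 0) \<le> exp_val In ps ?p t (work_at In s)" using I that by blast
        also have "\<dots> \<le> exp_val In ps ?p (Suc t) (work_at In s')"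
          unfolding a(2) by (rule exp_val_greedy[OF t that p0 a(3)])
        finally show ?thesis .
      qed
      moreover have "\<forall>i<Suc t. work_at In s' i < k" using I a by (auto simp: less_Suc_eq)
      ultimately show "nmem s' (in_n In + 6) = t \<and> ?I (Suc t) (nset s' (in_n In + 6) (Suc t))"
        using R by (auto simp: n_def[symmetric] work_at_nset_var intro!: frame_nsetI cells)
    qed
  next
    fix s assume "?I n s" then show "?I n s" .
  qed
  have "runs In Z (Seq (for_loop 6 NumVertices choose_label) (Seq (NSet (var 12) NumVertices) exp_val_prog)) s1
    ?Q"
  proof (rule runs_Seq[OF Z4 loop], rule runs_Seq_NSet[OF Z4])
    fix s assume I: "?I n s"
    define s2 where "s2 = nset s (n + 12) n"
    have fr2: "frame ?X ?Y s0 s2" unfolding s2_def using I by (intro frame_nsetI cells) auto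
    have w2: "work_at In s2 = work_at In s" by (simp add: s2_def work_at_nset_var)
    have s2: "rmem s2 = rmem s" "nmem s2 (n + 12) = n" by (simp_all add: s2_def)
    have "runs In Z exp_val_prog s2 ?Q"
    proof (rule runs_exp_val'[OF seeds_at_frame[OF fr2 seeds round_cells_seeds]])
      fix s' assume f: "frame (exp_val_cells In) {3, 4, 5} s2 s'" and w: "work_at In s' = work_at In s2"
        and v: "rmem s' 3 = exp_val In ps (rmem s2 1) (nmem s2 (n + 12)) (work_at In s2)"
      have v': "rmem s' 3 = exp_val In ps ?p n (work_at In s)" using v I by (simp add: s2 w2 del: One_nat_def)
      also have "\<dots> = ug_val (in_inst In) (work_at In s)" by (rule exp_val_full) (use I in blast)
      finally show "?Q s'"
        using frame_trans[OF fr2 f exp_val_cells_sub] I v' by (simp add: w w2)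
    qed
    then show "runs In Z exp_val_prog (nset s (neval In s (var 12)) (neval In s NumVertices)) ?Q"
      by (simp add: s2_def n_def)
  qed
  moreover have "map (\<lambda>c. (nmem s0 (in_n In + 20 + c), nmem s0 (in_n In + in_r In + 21 + c))) [0..<in_r
      In] = ps"
    using seeds by (simp add: seeds_at_def)
  ultimately show ?thesis
    unfolding round_prog_def
    by (intro runs_Seq_RSet[OF Z4]) (simp add: s1_def reval_LProb del: reval.simps(9))
qed

end

section \<open>Enumeration of the seeds\<close>

text \<open>The machine only adds and subtracts natural numbers, so division is repeated
  subtraction; it is applied to values at most Z and hence takes at most Z iterations.\<close>

definition divmod_prog :: "nexp \<Rightarrow> prog" where
  "divmod_prog e = Seq (NSet (var 5) (NLit 0)) (While (BNot (NLess (cell 3) e))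
     (Seq (NSet (var 3) (NSub (cell 3) e)) (NSet (var 5) (NAdd (cell 5) (NLit 1)))))"

definition decode_digit :: prog where
  "decode_digit = Seq (divmod_prog NumLabels) (Seq (NSet (seed_label (cell 4)) (cell 3))
     (Seq (NSet (var 3) (cell 5)) (Seq (divmod_prog NumVertices)
     (Seq (NSet (seed_vertex (cell 4)) (cell 3)) (NSet (var 3) (cell 5))))))"

definition decode_prog :: prog where
  "decode_prog = Seq (NSet (var 3) (cell 1)) (for_loop 4 NumRounds
     decode_digit)"

definition multiply_prog :: prog where
  "multiply_prog = for_loop 7 NumVertices (for_loop 10 NumLabels (NSet (var 15) (NAdd (cell 15) (cell 0))))"

definition count_prog :: prog where
  "count_prog = Seq (NSet (var 0) (NLit 1)) (for_loop 4 NumRounds (Seq (NSet (var 15) (NLit 0))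
     (Seq multiply_prog
       (NSet (var 0) (cell 15)))))"

definition copy_prog :: prog where
  "copy_prog = for_loop 2 NumVertices (NSet (cell 2) (NMem (work (cell 2))))"

definition try_seed :: prog where
  "try_seed = Seq decode_prog (Seq round_prog (Cond (RLess (RMem (NLit 0)) (RMem (NLit 3)))
     (Seq (RSet (NLit 0) (RMem (NLit 3))) copy_prog) Skip))"

definition main_prog :: prog where
  "main_prog = Seq count_prog (Seq (RSet (NLit 0) (RLit (- 1))) (for_loop 1 (cell 0) try_seed))"

lemma runs_divmod:
  assumes Z: "4 \<le> Z" and D: "nmem s (in_n In + 3) = D" "D \<le> Z" and e: "\<And>s. neval In s e =
      m" "0 < m"
    and post: "Q (nset (nset s (in_n In + 3) (D mod m)) (in_n In + 5) (D div m))"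
  shows "runs In Z (divmod_prog e) s Q"
  unfolding divmod_prog_def
proof (rule runs_Seq_NSet[OF Z], rule runs_While[OF Z D(2),
    where Inv = "\<lambda>c s'. \<exists>x. c * m + x = D \<and> s' =
        nset (nset s (in_n In + 3) x) (in_n In + 5) c"])
  show "\<exists>x. 0 * m + x = D \<and> nset s (neval In s (var 5)) (neval In s (NLit 0)) =
      nset (nset s (in_n In + 3) x) (in_n In + 5) 0"
    using D(1) by (auto simp: nset_def)
next
  fix c s' assume "\<exists>x. c * m + x = D \<and> s' = nset (nset s (in_n In + 3) x) (in_n In + 5) c"
    and b: "beval In s' (BNot (NLess (cell 3) e))"
  then obtain x where x: "c * m + x = D" "s' = nset (nset s (in_n In + 3) x) (in_n In + 5) c" by blast
  have mx: "m \<le> x" using b x(2) e(1) by simp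
  have "c \<le> c * m" using e(2) by simp
  then have "c < D" using x(1) mx e(2) by linarith
  moreover have "runs In Z (Seq (NSet (var 3) (NSub (cell 3) e)) (NSet (var 5) (NAdd (cell 5) (NLit 1)))) s'
     (\<lambda>s'. \<exists>x. Suc c * m + x = D \<and> s' =
         nset (nset s (in_n In + 3) x) (in_n In + 5) (Suc c))"
    by (rule runs_Seq_NSet[OF Z], rule runs_NSet, rule exI[of _ "x - m"])
      (use x mx e in \<open>auto simp: nset_def fun_upd_twist\<close>)
  ultimately show "c < D \<and> runs In Z (Seq (NSet (var 3) (NSub (cell 3) e)) (NSet (var 5) (NAdd (cell 5)
      (NLit 1)))) s'
     (\<lambda>s'. \<exists>x. Suc c * m + x = D \<and> s' =
         nset (nset s (in_n In + 3) x) (in_n In + 5) (Suc c))" ..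
next
  fix c s' assume "\<exists>x. c * m + x = D \<and> s' = nset (nset s (in_n In + 3) x) (in_n In + 5) c"
    and b: "\<not> beval In s' (BNot (NLess (cell 3) e))"
  then obtain x where x: "c * m + x = D" "s' = nset (nset s (in_n In + 3) x) (in_n In + 5) c" by blast
  have "x < m" using b x(2) e(1) by simp
  then have "D mod m = x" "D div m = c" using x(1) by auto
  then show "Q s'" using post x(2) by simp
qed

context ug_run
begin

text \<open>The c-th digit of w in base n * k, itself split as vertex * k + label.\<close>

definition digit :: "nat \<Rightarrow> nat \<Rightarrow> nat \<times> nat" where
  "digit w c = (w div (n * k) ^ c div k mod n, w div (n * k) ^ c mod k)"

text \<open>Horner's scheme with the head of the list as lowest digit: prepending the pair (v, a)
  turns w into w * (n * k) + (v * k + a).\<close>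

lemma digits_surj:
  "length ps = l \<Longrightarrow> set ps \<subseteq> {..<n} \<times> {..<k} \<Longrightarrow>
      \<exists>w<(n * k) ^ l. map (digit w) [0..<l] = ps"
proof (induction l arbitrary: ps)
  case (Suc l)
  then obtain v a qs where ps: "ps = (v, a) # qs" by (cases ps) auto
  then have va: "v < n" "a < k" and "length qs = l" "set qs \<subseteq> {..<n} \<times> {..<k}"
      using Suc.prems by auto
  then obtain w where w: "w < (n * k) ^ l" "map (digit w) [0..<l] = qs" using Suc.IH by blast
  define x where "x = w * (n * k) + (v * k + a)"
  have small: "v * k + a < n * k"
  proof -
    have "v * k + a < (v + 1) * k" using va by simp
    also have "\<dots> \<le> n * k" using va by (intro mult_le_mono) auto
    finally show ?thesis .
  qed
  have xd: "x div (n * k) = w" "x mod (n * k) = v * k + a" using small n0 k0 by (auto simp: x_def)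
  have "x < (w + 1) * (n * k)" using small by (simp add: x_def)
  also have "\<dots> \<le> (n * k) ^ l * (n * k)" using w(1) by (intro mult_le_mono) auto
  finally have "x < (n * k) ^ Suc l" by (simp add: mult.commute)
  moreover have "digit x 0 = (v, a)"
  proof -
    have "x = (w * n + v) * k + a" by (simp add: x_def algebra_simps)
    then have "x mod k = a" "x div k = w * n + v" using va k0 by auto
    then show ?thesis using va by (simp add: digit_def)
  qed
  moreover have "digit x (Suc c) = digit w c" for c
    by (simp only: digit_def power_Suc div_mult2_eq[of x "n * k"] xd)
  ultimately have "map (digit x \<circ> Suc) [0..<l] = qs"
    unfolding w(2)[symmetric] by (intro map_cong) auto
  with \<open>x < (n * k) ^ Suc l\<close> \<open>digit x 0 = (v, a)\<close> show ?case
    by (intro exI[of _ x]) (simp add: ps upt_rec[of 0 "Suc l"] map_Suc_upt[symmetric] del: upt_Suc)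
qed simp

definition decode_cells :: "nat set" where
  "decode_cells = {n + 3, n + 4, n + 5} \<union> {n + 20..<n + 20 + r} \<union> {n + r + 21..<n + r + 21 + r}"

lemma runs_decode:
  assumes w: "nmem s0 (n + 1) = w" "w \<le> Z"
  shows "runs In Z decode_prog s0 (\<lambda>s'. frame decode_cells {} s0 s' \<and>
      seeds_at In s' (map (digit w) [0..<r]))"
proof -
  let ?B = "\<lambda>c. (n * k) ^ c"
  let ?I = "\<lambda>c (s::memory). frame decode_cells {} s0 s \<and> nmem s (n + 3) = w div ?B c \<and>
    (\<forall>c'<c. c' < r \<longrightarrow> (nmem s (n + 20 + c'), nmem s (n + r + 21 + c')) = digit w c')"
  have cells: "n + 3 \<in> decode_cells" "n + 4 \<in> decode_cells" "n + 5 \<in> decode_cells"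
      by (auto simp: decode_cells_def)
  have cells': "n + 20 + c \<in> decode_cells" "n + r + 21 + c \<in> decode_cells" if "c < r" for c
    using that by (auto simp: decode_cells_def)
  have kk: "neval In s NumLabels = k" and nn: "neval In s NumVertices = n" for s by (simp_all add: k_def n_def)
  show ?thesis
    unfolding decode_prog_def
  proof (rule runs_Seq_NSet[OF Z4], rule runs_for[OF Z4 rZ, where Inv = ?I])
    show "?I 0 (nset (nset s0 (neval In s0 (var 3)) (neval In s0 (cell 1))) (in_n In + 4) 0)"
      using w by (auto simp: n_def[symmetric] intro!: frame_nsetI cells)
    show "neval In s NumRounds = r" for s by (simp add: r_def)
  next
    fix c s assume c: "c < r" and I: "?I c s" and cn: "nmem s (in_n In + 4) = c"
    define D where "D = w div ?B c"
    have DZ: "D \<le> Z" using w(2) div_le_dividend[of w "?B c"] unfolding D_def by linarith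
    have D'Z: "D div k \<le> Z" using DZ div_le_dividend[of D k] by linarith
    define s1 where "s1 = nset (nset s (n + 3) (D mod k)) (n + 5) (D div k)"
    define s2 where "s2 = nset (nset s1 (n + r + 21 + c) (D mod k)) (n + 3) (D div k)"
    define s3 where "s3 = nset (nset s2 (n + 3) (D div k mod n)) (n + 5) (D div k div n)"
    define s4 where "s4 = nset (nset s3 (n + 20 + c) (D div k mod n)) (n + 3) (D div k div n)"
    have cn': "nmem s (n + 4) = c" using cn by (simp add: n_def)
    have fin: "nmem s4 (n + 4) = c \<and> ?I (Suc c) (nset s4 (n + 4) (Suc c))"
    proof (intro conjI allI impI)
      show "nmem s4 (n + 4) = c" using cn' by (simp add: s1_def s2_def s3_def s4_def)
      show "frame decode_cells {} s0 (nset s4 (n + 4) (Suc c))"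
        unfolding s1_def s2_def s3_def s4_def using I c by (intro frame_nsetI cells cells') auto
      have "D div k div n = w div ?B (Suc c)"
        by (simp add: D_def div_mult2_eq[symmetric] mult_ac)
      then show "nmem (nset s4 (n + 4) (Suc c)) (n + 3) = w div ?B (Suc c)"
        by (simp add: s4_def)
      fix c' assume c': "c' < Suc c" "c' < r"
      show "(nmem (nset s4 (n + 4) (Suc c)) (n + 20 + c'), nmem (nset s4 (n + 4) (Suc c)) (n + r + 21 + c')) =
          digit w c'"
      proof (cases "c' = c")
        case True
        then show ?thesis using c by (simp add: s1_def s2_def s3_def s4_def digit_def D_def)
      next
        case False
        then have "c' < c" using c' by simp
        then show ?thesis using I c c' by (simp add: s1_def s2_def s3_def s4_def)
      qed
    qed
    have Ds: "nmem s (n + 3) = D" using I by (simp add: D_def)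
    show "runs In Z decode_digit s
     (\<lambda>s'. nmem s' (in_n In + 4) = c \<and> ?I (Suc c) (nset s' (in_n In + 4) (Suc c)))"
    unfolding decode_digit_def
    proof (rule runs_Seq[OF Z4 runs_divmod[OF Z4 _ DZ kk k0, where Q = "\<lambda>s'. s' = s1"]], goal_cases)
      case 1
      show ?case using Ds by (simp add: n_def)
    next
      case 2
      show ?case by (simp add: s1_def n_def)
    next
      case (3 s')
      have rest: "runs In Z (Seq (divmod_prog NumVertices)
          (Seq (NSet (seed_vertex (cell 4)) (cell 3)) (NSet (var 3) (cell 5)))) s2
          (\<lambda>s'. nmem s' (in_n In + 4) = c \<and> ?I (Suc c) (nset s' (in_n In + 4) (Suc c)))"
      proof (rule runs_Seq[OF Z4 runs_divmod[OF Z4 _ D'Z nn n0, where Q = "\<lambda>s'. s' = s3"]], goal_cases)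
        case 1
        show ?case by (simp add: s2_def n_def)
      next
        case 2
        show ?case by (simp add: s3_def n_def)
      next
        case (3 s')
        have e4: "nset (nset s3 (neval In s3 (seed_vertex (cell 4))) (neval In s3 (cell 3)))
            (neval In (nset s3 (neval In s3 (seed_vertex (cell 4))) (neval In s3 (cell 3))) (var 3))
            (neval In (nset s3 (neval In s3 (seed_vertex (cell 4))) (neval In s3 (cell 3))) (cell 5)) = s4"
          using cn' by (simp add: s1_def s2_def s3_def s4_def n_def r_def)
        show ?case unfolding 3
          by (rule runs_Seq_NSet[OF Z4], rule runs_NSet, unfold e4) (use fin
              in \<open>simp add: n_def[symmetric]\<close>)
      qed
      show ?case unfolding 3
        by (intro runs_Seq_NSet[OF Z4]) (use rest cn' in \<open>simp add: s1_def s2_def n_def r_def\<close>)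
    qed
  next
    fix s assume I: "?I r s"
    have "seeds_at In s (map (digit w) [0..<r])"
      unfolding seeds_at_def n_def[symmetric] r_def[symmetric] using I by (intro map_cong) auto
    then show "frame decode_cells {} s0 s \<and> seeds_at In s (map (digit w) [0..<r])" using I by blast
  qed
qed

lemma runs_count:
  "runs In Z count_prog s0 (\<lambda>s'. (\<forall>a<n. nmem s' a = nmem s0 a) \<and> nmem s' n = (n * k) ^ r)"
proof -
  let ?F = "\<lambda>s::memory. \<forall>a<n. nmem s a = nmem s0 a"
  let ?I = "\<lambda>c (s::memory). ?F s \<and> nmem s n = (n * k) ^ c"
  show ?thesis
    unfolding count_prog_def
  proof (rule runs_Seq_NSet[OF Z4], rule runs_for[OF Z4 rZ, where Inv = ?I])
    show "?I 0 (nset (nset s0 (neval In s0 (var 0)) (neval In s0 (NLit 1))) (in_n In + 4) 0)"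
      by (simp add: n_def)
    show "neval In s NumRounds = r" for s by (simp add: r_def)
  next
    fix c s assume I: "?I c s" and cn: "nmem s (in_n In + 4) = c"
    let ?b = "(n * k) ^ c"
    let ?I1 = "\<lambda>i (s::memory). ?F s \<and> nmem s n = ?b \<and> nmem s (n + 4) = c \<and>
        nmem s (n + 15) = i * k * ?b"
    have inner: "runs In Z multiply_prog
        s1 (?I1 n)" if "?I1 0 s1" for s1
  unfolding multiply_prog_def
    proof (rule runs_for[OF Z4 nZ, where Inv = ?I1])
      show "?I1 0 (nset s1 (in_n In + 7) 0)" using that by (simp add: n_def)
      show "neval In s NumVertices = n" for s by (simp add: n_def)
    next
      fix i s assume I1: "?I1 i s" and i: "nmem s (in_n In + 7) = i"
      let ?I2 = "\<lambda>j (s::memory). ?F s \<and> nmem s n = ?b \<and> nmem s (n + 4) = c \<and>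
          nmem s (n + 7) = i \<and> nmem s (n + 15) = (i * k + j) * ?b"
      show "runs In Z (for_loop 10 NumLabels (NSet (var 15) (NAdd (cell 15) (cell 0)))) s
        (\<lambda>s'. nmem s' (in_n In + 7) = i \<and> ?I1 (Suc i) (nset s' (in_n In + 7) (Suc i)))"
      proof (rule runs_for[OF Z4 kZ, where Inv = ?I2])
        show "?I2 0 (nset s (in_n In + 10) 0)" using I1 i by (simp add: n_def)
        show "neval In s NumLabels = k" for s by (simp add: k_def)
      next
        fix j s assume "?I2 j s" "nmem s (in_n In + 10) = j"
        then show "runs In Z (NSet (var 15) (NAdd (cell 15) (cell 0))) s
          (\<lambda>s'. nmem s' (in_n In + 10) = j \<and> ?I2 (Suc j) (nset s' (in_n In + 10) (Suc j)))"
          by (intro runs_NSet) (auto simp: n_def algebra_simps)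
      next
        fix s assume "?I2 k s"
        then show "nmem s (in_n In + 7) = i \<and> ?I1 (Suc i) (nset s (in_n In + 7) (Suc i))"
          by (simp add: n_def algebra_simps)
      qed
    qed
    show "runs In Z (Seq (NSet (var 15) (NLit 0)) (Seq multiply_prog (NSet (var 0) (cell 15)))) s
        (\<lambda>s'. nmem s' (in_n In + 4) = c \<and> ?I (Suc c) (nset s' (in_n In + 4) (Suc c)))"
      by (rule runs_Seq_NSet[OF Z4], rule runs_Seq[OF Z4 inner], use I cn
          in \<open>simp add: n_def\<close>, rule runs_NSet)
        (auto simp: n_def)
  qed simp
qed

lemma runs_copy:
  "runs In Z copy_prog s0 (\<lambda>s'. (\<forall>i<n. nmem s' i = work_at In s0 i) \<and> nmem s' n =
      nmem s0 n \<and>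
    nmem s' (n + 1) = nmem s0 (n + 1) \<and> rmem s' = rmem s0)"
proof -
  let ?I = "\<lambda>c s. (\<forall>i<c. nmem s i = work_at In s0 i) \<and> nmem s n = nmem s0 n \<and>
      nmem s (n + 1) = nmem s0 (n + 1) \<and>
    rmem s = rmem s0 \<and> work_at In s = work_at In s0"
  show ?thesis
    unfolding copy_prog_def
  proof (rule runs_for[OF Z4 nZ, where Inv = "\<lambda>c s. c \<le> n \<and> ?I c s"])
    show "0 \<le> n \<and> ?I 0 (nset s0 (in_n In + 2) 0)"
      by (simp add: n_def[symmetric] work_at_nset_var del: add_2_eq_Suc')
    show "neval In s NumVertices = n" for s by (simp add: n_def)
  next
    fix c s assume c: "c < n" and I: "c \<le> n \<and> ?I c s" and cn: "nmem s (in_n In + 2) = c"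
    have val: "neval In s (NMem (work (cell 2))) = work_at In s0 c"
    proof -
      have "neval In s (NMem (work (cell 2))) = work_at In s c" using cn by (simp add: work_at_def)
      also have "\<dots> = work_at In s0 c" using I by metis
      finally show ?thesis .
    qed
    have addr: "neval In s (cell 2) = c" using cn by simp
    have wk: "work_at In (nset s c v) = work_at In s" for v
      using c by (auto simp: work_at_def n_def)
    show "runs In Z (NSet (cell 2) (NMem (work (cell 2)))) s
      (\<lambda>s'. nmem s' (in_n In + 2) = c \<and> Suc c \<le> n \<and>
          ?I (Suc c) (nset s' (in_n In + 2) (Suc c)))"
      by (rule runs_NSet, unfold val addr)
        (use I c cn in \<open>auto simp: n_def[symmetric] wk work_at_nset_var less_Suc_eq simp del:
            add_2_eq_Suc'\<close>)
  qed auto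
qed

lemma ug_val_cong:
  assumes "\<And>i. i < n \<Longrightarrow> x i = y i"
  shows "ug_val (in_inst In) x = ug_val (in_inst In) y"
    unfolding ug_val_eq_sum[OF finite_set_pmf_ug[OF ug]]
  proof (intro sum.cong refl)
    fix c assume c: "c \<in> set_pmf (in_inst In)"
    obtain i j \<pi> where ijp: "c = (i, j, \<pi>)" by (cases c)
    show "(case c of (i, j, \<pi>) \<Rightarrow> pmf (in_inst In) (i, j, \<pi>) * (if x j =
        \<pi> (x i) then 1 else 0)) =
        (case c of (i, j, \<pi>) \<Rightarrow> pmf (in_inst In) (i, j, \<pi>) * (if y j =
            \<pi> (y i) then 1 else 0))"
      using assms ug_instance_dest[OF ug c[unfolded ijp]] by (simp add: ijp)
  qed

text \<open>The stored record is a lower bound for the value of the stored assignment and an upper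
  bound for the expectations of all normalized lists tried so far.\<close>

theorem runs_main:
  assumes s0: "\<forall>i<n. nmem s0 i < k"
  shows "runs In Z main_prog s0 (\<lambda>s'. (\<forall>i<n. nmem s' i < k) \<and>
    (\<forall>ps. length ps = r \<longrightarrow> set ps \<subseteq> {..<n} \<times> {..<k} \<longrightarrow>
        normalized ps (lookup_prob In ps) \<longrightarrow>
      exp_val In ps (lookup_prob In ps) 0 (\<lambda>_. 0) \<le> ug_val (in_inst In) (nmem s')))"
proof -
  let ?N = "(n * k) ^ r"
  let ?e = "\<lambda>ps. exp_val In ps (lookup_prob In ps) 0 (\<lambda>_. 0)"
  let ?ps = "\<lambda>w. map (digit w) [0..<r]"
  let ?v = "ug_val (in_inst In)"
  let ?g = "\<lambda>w. normalized (?ps w) (lookup_prob In (?ps w))"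
  let ?I = "\<lambda>w (s::memory). nmem s n = ?N \<and> (\<forall>i<n. nmem s i < k) \<and> rmem s 0 \<le>
      ?v (nmem s) \<and>
    (\<forall>w'<w. ?g w' \<longrightarrow> ?e (?ps w') \<le> rmem s 0)"
  note v_cong = ug_val_cong
  have "runs In Z (Seq (RSet (NLit 0) (RLit (- 1))) (for_loop 1 (cell 0) try_seed)) s1 (?I ?N)"
    if s1: "(\<forall>a<n. nmem s1 a = nmem s0 a) \<and> nmem s1 n = ?N" for s1
  proof (rule runs_Seq_RSet[OF Z4], rule runs_for[OF Z4 countZ, where Inv = ?I])
    \<comment> \<open>The initial record lies below the value of whatever assignment the output
      cells contain, so the lower-bound half of the invariant holds before anything has been
      copied.\<close>
    have "- 1 \<le> ?v x" for x unfolding ug_val_def by (rule order_trans[of _ 0]) auto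
    then show "?I 0 (nset (rset s1 (neval In s1 (NLit 0)) (reval In s1 (RLit (- 1)))) (in_n In + 1) 0)"
      using s1 s0 by (auto simp: n_def[symmetric])
    show "neval In s (cell 0) = ?N" if "?I w s" for w s using that by (simp add: n_def[symmetric])
  next
    fix w s assume w: "w < ?N" and I: "?I w s" and wn: "nmem s (in_n In + 1) = w"
    have wZ: "w \<le> Z" using w countZ by linarith
    have dec: "runs In Z decode_prog s (\<lambda>s'. frame decode_cells {} s s' \<and> seeds_at In s' (?ps w))"
      by (rule runs_decode) (use wn wZ in \<open>auto simp: n_def\<close>)
    show "runs In Z try_seed s (\<lambda>s'. nmem s' (in_n In + 1) = w \<and>
        ?I (Suc w) (nset s' (in_n In + 1) (Suc w)))"
      unfolding try_seed_def
    proof (rule runs_Seq[OF Z4 dec])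
      fix s' assume D: "frame decode_cells {} s s' \<and> seeds_at In s' (?ps w)"
      then have rd: "runs In Z round_prog s' (\<lambda>s''. frame round_cells {1, 2, 3, 4, 5} s' s'' \<and>
        (\<forall>i<n. work_at In s'' i < k) \<and> rmem s'' 3 = ?v (work_at In s'') \<and>
        (?g w \<longrightarrow> ?e (?ps w) \<le> rmem s'' 3))"
        by (intro runs_round) blast
      show "runs In Z (Seq round_prog (Cond (RLess (RMem (NLit 0)) (RMem (NLit 3)))
         (Seq (RSet (NLit 0) (RMem (NLit 3))) copy_prog) Skip)) s'
         (\<lambda>s'. nmem s' (in_n In + 1) = w \<and> ?I (Suc w) (nset s' (in_n In + 1) (Suc w)))"
      proof (rule runs_Seq[OF Z4 rd])
        fix t assume R: "frame round_cells {1, 2, 3, 4, 5} s' t \<and>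
          (\<forall>i<n. work_at In t i < k) \<and> rmem t 3 = ?v (work_at In t) \<and>
          (?g w \<longrightarrow> ?e (?ps w) \<le> rmem t 3)"
        have keep: "nmem t a = nmem s a" if "a \<le> n + 1" for a
          using frame_nmem[of decode_cells "{}" s s' a] frame_nmem[of round_cells "{1, 2, 3, 4, 5}" s' t a] D R
              that
          by (auto simp: decode_cells_def round_cells_def)
        have keep0: "rmem t 0 = rmem s 0"
          using frame_rmem[of decode_cells "{}" s s' 0] frame_rmem[of round_cells "{1, 2, 3, 4, 5}" s' t 0] D R
              by auto
        have t: "nmem t n = ?N" "nmem t (n + 1) = w" "\<And>i. i < n \<Longrightarrow> nmem t i = nmem s i"
          using keep I wn by (auto simp: n_def)
        have vt: "?v (nmem t) = ?v (nmem s)" by (rule v_cong) (use t in auto)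
        have shift: "?I (Suc w) (nset t' (n + 1) (Suc w))" if "nmem t' n =
            ?N" "\<forall>i<n. nmem t' i < k" "rmem t' 0 \<le> ?v (nmem t')"
          "\<forall>w'<Suc w. ?g w' \<longrightarrow> ?e (?ps w') \<le> rmem t' 0" for t' :: memory
        proof -
          have "?v (nmem (nset t' (n + 1) (Suc w))) = ?v (nmem t')" by (rule v_cong) auto
          then show ?thesis using that by simp
        qed
        show "runs In Z (Cond (RLess (RMem (NLit 0)) (RMem (NLit 3))) (Seq (RSet (NLit 0) (RMem (NLit 3)))
            copy_prog) Skip) t
           (\<lambda>s'. nmem s' (in_n In + 1) = w \<and> ?I (Suc w) (nset s' (in_n In + 1) (Suc w)))"
        proof (rule runs_Cond[OF Z4], goal_cases)
          case 1
          then have lt: "rmem s 0 < rmem t 3" by (simp add: keep0)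
          let ?t1 = "rset t 0 (rmem t 3)"
          have "runs In Z copy_prog ?t1 (\<lambda>s'. nmem s' (n + 1) = w \<and>
              ?I (Suc w) (nset s' (n + 1) (Suc w)))"
          proof (rule runs_mono[OF runs_copy[of ?t1]])
            fix t' :: memory assume C: "(\<forall>i<n. nmem t' i = work_at In ?t1 i) \<and> nmem t' n =
                nmem ?t1 n \<and>
              nmem t' (n + 1) = nmem ?t1 (n + 1) \<and> rmem t' = rmem ?t1"
            have "?v (nmem t') = ?v (work_at In t)" by (rule v_cong) (use C
                in \<open>auto simp: work_at_rset\<close>)
            moreover have "?e (?ps w') \<le> rmem t 3" if "w' < Suc w" "?g w'" for w'
              using that R I lt by (cases "w' = w") (auto simp: less_Suc_eq intro: order_trans[of _ "rmem s 0"])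
            ultimately show "nmem t' (n + 1) = w \<and> ?I (Suc w) (nset t' (n + 1) (Suc w))"
              using C R t by (intro conjI[OF _ shift]) (auto simp: work_at_rset)
          qed
          then show ?case by (intro runs_Seq_RSet[OF Z4]) (simp add: n_def)
        next
          case 2
          then have ge: "rmem t 3 \<le> rmem s 0" by (simp add: keep0)
          have "?e (?ps w') \<le> rmem t 0" if "w' < Suc w" "?g w'" for w'
            using that R I ge by (cases "w' = w") (auto simp: less_Suc_eq keep0)
          then have "?I (Suc w) (nset t (n + 1) (Suc w))"
            using I t vt keep0 by (intro shift) auto
          then show ?case using t by (intro runs_Skip) (simp add: n_def)
        qed
      qed
    qed
  next
    fix s :: memory assume "?I ?N s" then show "?I ?N s" .
  qed
  then have "runs In Z main_prog s0 (?I ?N)"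
    unfolding main_prog_def by (rule runs_Seq[OF Z4 runs_count])
  then show ?thesis
  proof (rule runs_mono)
    fix s :: memory assume I: "?I ?N s"
    have "?e ps \<le> ?v (nmem s)" if ps: "length ps =
        r" "set ps \<subseteq> {..<n} \<times> {..<k}" "normalized ps (lookup_prob In ps)" for ps
    proof -
      obtain w where "w < ?N" "?ps w = ps" using digits_surj[OF ps(1,2)] by blast
      moreover have "rmem s 0 \<le> ?v (nmem s)" using I by blast
      ultimately show ?thesis using I ps(3) by (metis order_trans)
    qed
    then show "(\<forall>i<n. nmem s i < k) \<and> (\<forall>ps. length ps = r \<longrightarrow>
        set ps \<subseteq> {..<n} \<times> {..<k} \<longrightarrow>
      normalized ps (lookup_prob In ps) \<longrightarrow> ?e ps \<le> ?v (nmem s))" using I by blast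
  qed
qed

end

section \<open>The approximation guarantee\<close>

lemma map_of_single_valued:
  assumes "single_valued (set qs)" "(i, a) \<in> set qs"
  shows "map_of qs i = Some a"
proof (cases "map_of qs i")
  case None
  then have "i \<notin> fst ` set qs" by (simp add: map_of_eq_None_iff)
  then show ?thesis using assms(2) by force
next
  case (Some b)
  then have "(i, b) \<in> set qs" by (rule map_of_SomeD)
  then show ?thesis using Some single_valuedD[OF assms(1)] assms(2) by fastforce
qed

text \<open>For a single-valued list the first label of a vertex is its only one, so the assignment
  that is queried has exactly the listed pairs as its graph.\<close>

lemma lookup_prob_eq:
  assumes f: "lasserre_feasible (in_n In) (in_k In) (in_r In) (in_sol In)"
    and sub: "set qs \<subseteq> {..<in_n In} \<times> {..<in_k In}" and len: "length qs \<le> in_r In + 2"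
    and sv: "single_valued (set qs)"
  shows "lookup_prob In qs = event_prob (in_sol In) (set qs)"
proof -
  define T where "T = fst ` set qs"
  define \<alpha> where "\<alpha> = restrict (\<lambda>i. the (map_of qs i)) T"
  have \<alpha>: "\<alpha> i = a" if "(i, a) \<in> set qs" for i a
    using map_of_single_valued[OF sv that] that by (force simp: \<alpha>_def T_def)
  have graph: "(\<lambda>i. (i, \<alpha> i)) ` T = set qs"
    unfolding T_def using \<alpha> by (force simp: image_image image_iff)
  have T: "T \<subseteq> {..<in_n In}" "card T \<le> in_r In + 2"
    using sub len card_image_le[of "set qs" fst] card_length[of qs] by (auto simp: T_def)
  have as: "\<alpha> \<in> assignments T (in_k In)"
    unfolding assignments_def
  proof (rule PiE_I)
    fix i assume "i \<in> T"
    then obtain a where "(i, a) \<in> set qs" by (auto simp: T_def)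
    then show "\<alpha> i \<in> {..<in_k In}" using \<alpha> sub by auto
  qed (simp add: \<alpha>_def)
  have "lookup_prob In qs = pmf (local_dist (in_sol In) T) \<alpha>"
    using T as len by (simp add: lookup_prob_def Let_def \<alpha>_def[symmetric] T_def[symmetric])
  also have "\<dots> = event_prob (in_sol In) (set qs)"
    by (simp only: pmf_local_dist[OF f T as] graph)
  finally show ?thesis .
qed

context ug_run
begin

context
  fixes ps :: "(nat \<times> nat) list"
  assumes regular: "regular_instance n (in_inst In)"
    and feasible: "lasserre_feasible n k r (in_sol In)"
    and len: "length ps = r"
    and state: "ug_relaxation.state n k r (event_prob (in_sol In)) (set ps)"
begin

interpretation relax: ug_relaxation n k "in_inst In" r "ldim (in_sol In)" "event_prob (in_sol In)" "event_vec
    (in_sol In)"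
  by (rule lasserre_relaxation[OF ug regular feasible])

lemma state_single_valued: "single_valued (set ps)"
proof (rule ccontr)
  assume "\<not> ?thesis"
  then obtain i a b where "(i, a) \<in> set ps" "(i, b) \<in> set ps" "a \<noteq> b"
      unfolding single_valued_def by blast
  then have "event_prob (in_sol In) (set ps) = 0"
    using state unfolding relax.state_def by (intro relax.p_excl) auto
  then show False using state unfolding relax.state_def by simp
qed

lemma lookup_prob_seed: "lookup_prob In ps = event_prob (in_sol In) (set ps)"
  using lookup_prob_eq[of In ps] feasible state[unfolded relax.state_def] state_single_valued len
  by (simp add: n_def k_def r_def)

text \<open>If the seeds give vertex i another label, the program returns 0 by its label test and
  the relaxation returns 0 because the pairs contradict each other; otherwise appending the pair
  keeps the list single-valued.\<close>

lemma marginal_eq: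
  assumes "i < n" "a < k"
  shows "marginal In ps (lookup_prob In ps) 0 y i a = relax.q (set ps) i a"
proof (cases "map_of (ps @ [(i, a)]) i = Some a")
  case True
  have sub: "set ps \<subseteq> {..<n} \<times> {..<k}" using state by (simp add: relax.state_def)
  have uniq: "b = a" if "(i, b) \<in> set ps" for b
    using map_of_single_valued[OF state_single_valued that] True by simp
  have "single_valued (set (ps @ [(i, a)]))"
    using state_single_valued uniq unfolding single_valued_def by auto
  then have "lookup_prob In (ps @ [(i, a)]) = event_prob (in_sol In) (insert (i, a) (set ps))"
    using lookup_prob_eq[of In "ps @ [(i, a)]"] feasible sub assms len by (simp add: n_def k_def r_def)
  then show ?thesis using True by (simp add: marginal_def relax.q_def lookup_prob_seed del: map_of_append)
next
  case False
  then obtain b where b: "map_of ps i = Some b" "b \<noteq> a"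
    by (cases "map_of ps i") (auto simp: map_add_def)
  then have "(i, b) \<in> set ps" by (simp add: map_of_SomeD)
  then have "event_prob (in_sol In) (insert (i, a) (set ps)) = 0"
    using b(2) assms state relax.card_insert_le_Suc[of "(i, a)" "set ps"] unfolding relax.state_def
    by (intro relax.p_excl[of _ i a b]) auto
  then show ?thesis using False by (simp add: marginal_def relax.q_def del: map_of_append)
qed

lemma seed_normalized: "normalized ps (lookup_prob In ps)"
proof -
  interpret pair_marginals n k "ldim (in_sol In)" "relax.q (set ps)" "relax.J (set ps)" "relax.u (set ps)"
    by (rule relax.pair_marginals[OF state])
  show ?thesis unfolding normalized_def using q_sum by (simp add: marginal_eq)
qed

lemma exp_val_eq_rounded: "exp_val In ps (lookup_prob In ps) 0 (\<lambda>_. 0) = relax.rounded (set ps)"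
proof -
  let ?e = "exp_val_term In ps (lookup_prob In ps) 0 (\<lambda>_. 0)"
  have "exp_val In ps (lookup_prob In ps) 0 (\<lambda>_. 0) =
      (\<Sum>c\<in>set_pmf (in_inst In). \<Sum>a<k. pmf (in_inst In) c * ?e c a)"
    unfolding exp_val_def k_def[symmetric] by (rule sum_list_constraints)
  also have "\<dots> = relax.rounded (set ps)"
    unfolding relax.rounded_def
  proof (rule sum.cong[OF refl])
    fix c assume c: "c \<in> set_pmf (in_inst In)"
    obtain i j \<pi> where ijp: "c = (i, j, \<pi>)" by (cases c)
    note d = ug_instance_dest[OF ug c[unfolded ijp]]
    have "(\<Sum>a<k. ?e c a) = relax.rounded_val (set ps) c"
      unfolding ijp relax.rounded_val_def prod.case
      using d relax.perm_lt[OF d(3)] by (auto simp: exp_val_term_def marginal_eq intro!: sum.cong)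
    then show "(\<Sum>a<k. pmf (in_inst In) c * ?e c a) = pmf (in_inst In) c * relax.rounded_val (set ps) c"
      by (simp add: sum_distrib_left[symmetric])
  qed
  finally show ?thesis .
qed

end

end

text \<open>\<open>time_bound\<close> uses one number both as factor and as exponent; 5^e serves as
  both since e \<le> 5^e. The summand 4 comes from the requirement 4 \<le> Z in the running time
  rules.\<close>

lemma power_time_bound:
  assumes "1 \<le> (B::nat)"
  shows "(B + 4) ^ e \<le> 5 ^ e * B ^ 5 ^ e"
proof -
  have "(B + 4) ^ e \<le> (5 * B) ^ e" using assms by (intro power_mono) auto
  also have "\<dots> = 5 ^ e * B ^ e" by (rule power_mult_distrib)
  also have "B ^ e \<le> B ^ 5 ^ e"
    using assms less_imp_le[OF less_exp[of e]] power_mono[of 2 "5 :: nat" e]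
    by (intro power_increasing) auto
  finally show ?thesis by simp
qed

theorem theorem1p2:
  shows "\<exists>(c::real) (P::prog) (C::nat). 0 < c \<and>
    (\<forall>(\<epsilon>::real) (n::nat) (k::nat) (r::nat) (I::ug_constraint pmf) (cs::ug_constraint list)
        (\<sigma>::lasserre) (In::ug_input).
       0 < \<epsilon> \<longrightarrow>
       ug_instance n k I \<longrightarrow>
       regular_instance n I \<longrightarrow>
       real (threshold_rank n I (\<epsilon> powr c)) \<le> \<epsilon> powr c * real r / real k \<longrightarrow>
       distinct cs \<longrightarrow> set cs = set_pmf I \<longrightarrow>
       lasserre_optimal n k r I \<sigma> \<longrightarrow>
       In = \<lparr>in_n = n, in_k = k, in_r = r, in_eps = \<epsilon>, in_inst = I, in_list = cs, in_sol = \<sigma>\<rparr> \<longrightarrow>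
       (\<exists>x \<in> assignments {..<n} k.
          outputs_within P In (time_bound C In) x \<and> ug_val I x > ug_opt n k I - \<epsilon>))"
proof (intro exI[of _ "900 :: real"] exI[of _ main_prog] exI[of _ "5 ^ depth main_prog"] conjI allI impI)
  fix \<epsilon> :: real and n k r I and cs :: "ug_constraint list" and \<sigma> :: lasserre and In :: ug_input
  assume \<epsilon>: "0 < \<epsilon>" and ug: "ug_instance n k I" and reg: "regular_instance n I"
    and rank: "real (threshold_rank n I (\<epsilon> powr 900)) \<le> \<epsilon> powr 900 * real r / real k"
    and cs: "distinct cs" "set cs = set_pmf I" and opt: "lasserre_optimal n k r I \<sigma>"
    and In: "In = \<lparr>in_n = n, in_k = k, in_r = r, in_eps = \<epsilon>, in_inst = I, in_list = cs, in_sol = \<sigma>\<rparr>"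
  have f: "lasserre_feasible n k r \<sigma>" using opt by (simp add: lasserre_optimal_def)
  interpret relax: ug_relaxation n k I r "ldim \<sigma>" "event_prob \<sigma>" "event_vec \<sigma>"
    by (rule lasserre_relaxation[OF ug reg f])
  \<comment> \<open>The base of \<open>time_bound\<close>; it dominates every loop count, including
    the number (n * k)^r of seed lists.\<close>
  define B where "B = r + length cs + (n * k) ^ (r + 2)"
  have nk: "n \<le> n * k" "k \<le> n * k" "1 \<le> n * k" using relax.n_pos relax.k_pos by auto
  have nkB: "n * k \<le> B" "(n * k) ^ r \<le> B"
  proof -
    have "n * k \<le> (n * k) ^ (r + 2)" by (rule self_le_power[OF nk(3)]) simp
    then show "n * k \<le> B" unfolding B_def by (rule trans_le_add2)
    have "(n * k) ^ r \<le> (n * k) ^ (r + 2)" using nk(3) by (intro power_increasing) auto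
    then show "(n * k) ^ r \<le> B" unfolding B_def by (rule trans_le_add2)
  qed
  have B1: "1 \<le> B" using nk nkB by linarith
  have nB: "n \<le> B + 4" "k \<le> B + 4" "(n * k) ^ r \<le> B + 4"
    using nk nkB by linarith+
  have rB: "r \<le> B + 4" "length cs \<le> B + 4" by (simp_all add: B_def)
  interpret run: ug_run In "B + 4" n k r
    using nB rB ug cs relax.n_pos by unfold_locales (simp_all add: In)
  let ?s0 = "\<lparr>nmem = \<lambda>_. 0, rmem = \<lambda>_. 0\<rparr>"
  have "runs In (B + 4) main_prog ?s0 (\<lambda>s'. (\<forall>i<n. nmem s' i < k) \<and>
    (\<forall>ps. length ps = r \<longrightarrow> set ps \<subseteq> {..<n} \<times> {..<k} \<longrightarrow> run.normalized ps (lookup_prob In ps) \<longrightarrow>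
      exp_val In ps (lookup_prob In ps) 0 (\<lambda>_. 0) \<le> ug_val (in_inst In) (nmem s')))"
    by (rule run.runs_main) (simp add: relax.k_pos)
  then obtain t s where run: "exec In main_prog ?s0 t s" "t \<le> (B + 4) ^ depth main_prog" "\<forall>i<n. nmem s i < k"
    and best: "\<And>ps. length ps = r \<Longrightarrow> set ps \<subseteq> {..<n} \<times> {..<k} \<Longrightarrow> run.normalized ps (lookup_prob In ps) \<Longrightarrow>
      exp_val In ps (lookup_prob In ps) 0 (\<lambda>_. 0) \<le> ug_val I (nmem s)"
    unfolding runs_def by (auto simp: In)
  define x where "x = restrict (nmem s) {..<n}"
  have "x \<in> assignments {..<n} k" using run(3) by (auto simp: x_def assignments_def)
  moreover have "outputs_within main_prog In (time_bound (5 ^ depth main_prog) In) x"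
  proof -
    have "t \<le> time_bound (5 ^ depth main_prog) In"
      using run(2) power_time_bound[OF B1, of "depth main_prog"] by (simp add: time_bound_def In B_def)
    then show ?thesis using run(1) unfolding outputs_within_def x_def by (auto simp: In)
  qed
  moreover have "ug_opt n k I - \<epsilon> < ug_val I x"
  proof -
    have "ug_opt n k I \<le> relax.objective {}"
      using ug_opt_le_lasserre[OF ug opt] lasserre_objective_eq[OF ug reg f] by simp
    moreover have "\<epsilon> powr 900 = \<epsilon> ^ 900" using \<epsilon> by (simp add: powr_numeral)
    ultimately obtain ps where ps: "length ps = r" "relax.state (set ps)" "ug_opt n k I - \<epsilon> < relax.rounded (set ps)"
      using relax.good_seed_exists[OF \<epsilon>, of "ug_opt n k I"] rank by auto
    have "set ps \<subseteq> {..<n} \<times> {..<k}" using ps(2) by (simp add: relax.state_def)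
    moreover have "run.normalized ps (lookup_prob In ps)"
      by (rule run.seed_normalized) (use reg f ps in \<open>simp_all add: In\<close>)
    moreover have "exp_val In ps (lookup_prob In ps) 0 (\<lambda>_. 0) = relax.rounded (set ps)"
      using run.exp_val_eq_rounded[of ps] reg f ps by (simp add: In)
    moreover have "ug_val I x = ug_val I (nmem s)"
      using run.ug_val_cong[of x "nmem s"] by (simp add: In x_def)
    ultimately show ?thesis using best[of ps] ps by simp
  qed
  ultimately show "\<exists>x\<in>assignments {..<n} k. outputs_within main_prog In (time_bound (5 ^ depth main_prog) In) x \<and>
      ug_opt n k I - \<epsilon> < ug_val I x" by blast
qed simp

end
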